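(* Let the potential $\varphi\in H^1_p(\tau_h)$ be determined by $$\int_\Omega \frac{\rho}{B^2}\,\nabla_\perp\psi\cdot\nabla_\perp\varphi\,dV=\int_\Omega\psi\,w\,dV+\int_{\partial\Omega}\psi\,\frac{\rho}{B^2}\,\nabla_\perp\varphi\cdot\vec n_{\partial\Omega}\,dS\qquad\forall\,\psi\in H^1_p(\tau_h),$$ and let the velocity $\vec v\in H^{\mathrm{Div}}(\tau_h)$ be determined by $\vec v=\frac{\hat b}{B}\times\nabla_\perp\varphi$. Assume: (i) either $w\in H^1_{\tilde p}(\tau_h)$ satisfies $$\int_\Omega \psi\,(\partial_t w+\vec v\cdot\nabla w)\,dV=0\qquad\forall\,\psi\in H^1_{\tilde p}(\tau_h),$$ or $w\in L^2_{\tilde p}(\tau_h)$ satisfies $$\int_\Omega \eta\,(\partial_t w+\vec v\cdot\nabla w)\,dV-\int_\Gamma\Big[\vec v\cdot\vec n_\Gamma\,\{\eta\}\,[\![w]\!]-\delta\,|\vec v\cdot\vec n_\Gamma|\,[\![\eta]\!]\,[\![w]\!]\Big]dS=0\qquad\forall\,\eta\in L^2_{\tilde p}(\tau_h),$$ where $\delta\in[0,1/2]$ is the upwinding parameter, and where $\tilde p\ge p$; (ii) $\nabla\cdot\vec v=0$ in $\Omega$; (iii) $\int_{\partial\Omega}w\,\varphi\,\vec v\cdot\vec n_{\partial\Omega}\,dS=0$; (iv) $\int_{\partial\Omega}\varphi\,\nabla_\perp\varphi\cdot\vec n_{\partial\Omega}\,dS=0$; (v) $\int_{\partial\Omega}\partial_t\varphi\,\nabla_\perp\varphi\cdot\vec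 n_{\partial\Omega}\,dS=0$. Then the spatially discretized ODEs, which are continuous in time, conserve energy: $$\frac{d}{dt}\int_\Omega\frac{\rho}{B^2}\,\nabla_\perp\varphi\cdot\nabla_\perp\varphi\,dV=0 .$$ Note that conditions (iii), (iv) and (v) are met by periodic or homogeneous Dirichlet boundary conditions (or a mixture thereof) on $w$ and $\varphi$.
   Context: $\Omega$ is the computational domain, with boundary $\partial\Omega$ and outward normal $\vec n_{\partial\Omega}$, and $\tau_h$ is a finite element mesh covering $\Omega$ with cells $K$. $\Gamma$ is the union of the internal faces between cells, and $\vec n_\Gamma$ is a uniquely oriented unit normal on each face of $\Gamma$. For a function $\eta$ that may be discontinuous across $\Gamma$, $\eta^+$ and $\eta^-$ denote its upwind and downwind values on $\Gamma$ with respect to $\vec n_\Gamma$ (so $\vec n_\Gamma$ points from the $+$ side to the $-$ side); the jump and average are $[\![\eta]\!]=\eta^+-\eta^-$ and $\{\eta\}=(\eta^++\eta^-)/2$. Spaces: $L^2_{q}(\tau_h)$ is the space of piecewise polynomial functions of order $\le q$ that are potentially discontinuous across $\Gamma$; $H^1_{q}(\tau_h)$ is the space of continuous piecewise polynomial functions of order $\le q$; $H^{\mathrm{Div}}(\tau_h)$ is the space of piecewise polynomial vector fields whose normal component is continuous across $\Gamma$. The functions $w$ and $\varphi$ depend on continuous time $t$; the gradient of a discontinuous function is taken cell by cell. Physical quantities: $w$ is the vorticity, $\varphi$ the potential, $\rho$ the mass density, $\vec B$ the magnetic field, $B=|\vec B|$ its magnitude and $\hat b=\vec B/B$ its direction.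 $\nabla_\perp=(\mathbf 1-\hat b\otimes\hat b)\cdot\nabla$ is the part of the gradient perpendicular to $\hat b$. The vorticity equation being discretized is the one without sources and dissipation, $\partial_t w+\nabla\cdot(w\vec v)=0$, equivalently $\partial_t w+\vec v\cdot\nabla w=0$ for divergence-free $\vec v$. The two weak forms in (i) are its continuous and discontinuous Galerkin discretizations. One half of the conserved integral is the kinetic energy.
   Formalization: Conditions (iv) and (v) are taken with the weight ρ/B² inside the boundary integrals; without it the claim fails when ρ/B² varies on ∂Ω. The mesh is read as conforming with convex polyhedral cells, ρ/B² is bounded, and periodic faces count as part of Γ. *)

theory Defs
  imports "HOL-Analysis.Analysis"
begin

section \<open>Meshes\<close>

text \<open>
  Cells are convex polyhedra. A pair \<open>(F, a)\<close> in \<open>glue\<close> identifies the outer face \<open>F\<close> with the outer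
  face \<open>F + a\<close> (periodicity); with \<open>glue = {}\<close> the domain is an ordinary polyhedral domain of
  \<open>\<real>\<^sup>3\<close>. \<open>nrm F\<close> is the chosen unit normal on an internal face \<open>F\<close>.
\<close>

record fe_mesh =
  cells :: "(real^3) set set"
  glue :: "((real^3) set \<times> (real^3)) set"
  nrm :: "(real^3) set \<Rightarrow> real^3"

text \<open>The closed domain; \<open>cell_interiors\<close> is the domain without its boundary and \<open>\<Gamma>\<close>.\<close>

definition domain :: "fe_mesh \<Rightarrow> (real^3) set" where
  "domain M = \<Union>(cells M)"

definition cell_interiors :: "fe_mesh \<Rightarrow> (real^3) set" where
  "cell_interiors M = (\<Union>K\<in>cells M. interior K)"

definition shared_faces :: "fe_mesh \<Rightarrow> (real^3) set set" where
  "shared_faces M =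
    {F. \<exists>K\<in>cells M. \<exists>L\<in>cells M. K \<noteq> L \<and> F facet_of K \<and> F facet_of L}"

definition outer_faces :: "fe_mesh \<Rightarrow> (real^3) set set" where
  "outer_faces M = {F. \<exists>K\<in>cells M. F facet_of K} - shared_faces M"

definition outward_unit_normal :: "(real^3) set \<Rightarrow> (real^3) set \<Rightarrow> real^3 \<Rightarrow> bool" where
  "outward_unit_normal K F n \<longleftrightarrow> norm n = 1 \<and> (\<forall>x\<in>F. \<forall>y\<in>K. n \<bullet> (y - x) \<le> 0)"

definition outer_normal :: "fe_mesh \<Rightarrow> (real^3) set \<Rightarrow> real^3" where
  "outer_normal M F = (THE n. \<exists>K\<in>cells M. F facet_of K \<and> outward_unit_normal K F n)"

text \<open>
  The faces of \<open>\<Gamma>\<close>. A point \<open>x\<close> of \<open>F\<close> is approached from the \<open>+\<close> side at \<open>x\<close> and from the \<open>-\<close> side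
  at \<open>x + a\<close>, where \<open>a = 0\<close> unless the face is a periodic one.
\<close>

definition internal_faces :: "fe_mesh \<Rightarrow> ((real^3) set \<times> (real^3)) set" where
  "internal_faces M = (\<lambda>F. (F, 0)) ` shared_faces M \<union> glue M"

definition boundary_faces :: "fe_mesh \<Rightarrow> (real^3) set set" where
  "boundary_faces M = outer_faces M - (\<Union>(F, a)\<in>glue M. {F, (+) a ` F})"

text \<open>
  The normal of a glued pair points out of the domain at \<open>F\<close>, hence into it at \<open>F + a\<close>; the
  opposite orientation is obtained by listing the pair as \<open>(F + a, - a)\<close> instead.
\<close>

definition is_fe_mesh :: "fe_mesh \<Rightarrow> bool" where
  "is_fe_mesh M \<longleftrightarrow>
     finite (cells M) \<and> cells M \<noteq> {} \<and>
     (\<forall>K\<in>cells M. polytope K \<and> interior K \<noteq> {}) \<and>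
     (\<forall>K\<in>cells M. \<forall>L\<in>cells M. (K \<inter> L) face_of K \<and> (K \<inter> L) face_of L) \<and>
     (\<forall>F\<in>shared_faces M. norm (nrm M F) = 1 \<and> (\<forall>x\<in>F. \<forall>y\<in>F. nrm M F \<bullet> (y - x) = 0)) \<and>
     (\<forall>(F, a)\<in>glue M. F \<in> outer_faces M \<and> (+) a ` F \<in> outer_faces M \<and>
        nrm M F = outer_normal M F \<and> outer_normal M ((+) a ` F) = - outer_normal M F) \<and>
     (\<forall>(F, a)\<in>glue M. \<forall>(G, b)\<in>glue M. (F, a) \<noteq> (G, b) \<longrightarrow>
        {F, (+) a ` F} \<inter> {G, (+) b ` G} = {})"


section \<open>Traces, surface integrals, differential operators\<close>

text \<open>
  The value at \<open>x\<close> of a function discontinuous across a face, approached from the side into which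
  \<open>d\<close> points. As \<open>n\<close> points from \<open>+\<close> to \<open>-\<close>, the \<open>+\<close> value is taken in direction \<open>- n\<close>; on the
  boundary, \<open>- n\<close> is likewise the inner side.
\<close>

definition side_value :: "real^3 \<Rightarrow> (real^3 \<Rightarrow> 'a::t2_space) \<Rightarrow> real^3 \<Rightarrow> 'a" where
  "side_value d f x = Lim (at_right 0) (\<lambda>s::real. f (x + s *\<^sub>R d))"

abbreviation plus_value :: "real^3 \<Rightarrow> (real^3 \<Rightarrow> 'a::t2_space) \<Rightarrow> real^3 \<Rightarrow> 'a" where
  "plus_value n f x \<equiv> side_value (- n) f x"

abbreviation minus_value :: "real^3 \<Rightarrow> real^3 \<Rightarrow> (real^3 \<Rightarrow> 'a::t2_space) \<Rightarrow> real^3 \<Rightarrow> 'a" where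
  "minus_value n a f x \<equiv> side_value n f (x + a)"

definition jump :: "real^3 \<Rightarrow> real^3 \<Rightarrow> (real^3 \<Rightarrow> real) \<Rightarrow> real^3 \<Rightarrow> real" where
  "jump n a f x = plus_value n f x - minus_value n a f x"

definition average :: "real^3 \<Rightarrow> real^3 \<Rightarrow> (real^3 \<Rightarrow> real) \<Rightarrow> real^3 \<Rightarrow> real" where
  "average n a f x = (plus_value n f x + minus_value n a f x) / 2"

text \<open>
  Area on a flat set is two-dimensional Lebesgue measure in an orthonormal parametrization of its
  plane; the integral does not depend on the parametrization chosen. Integrals are taken with
  respect to the complete measure, so that values on null sets (gradients on \<open>\<Gamma>\<close>, traces on edges)
  are irrelevant.
\<close>

definition flat_chart :: "(real^3) set \<Rightarrow> real^2 \<Rightarrow> real^3" where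
  "flat_chart F = (SOME h.
     (\<exists>c e1 e2. norm e1 = 1 \<and> norm e2 = 1 \<and> e1 \<bullet> e2 = 0 \<and>
        h = (\<lambda>y. c + y$1 *\<^sub>R e1 + y$2 *\<^sub>R e2)) \<and> F \<subseteq> range h)"

definition surface_integral :: "(real^3) set \<Rightarrow> (real^3 \<Rightarrow> real) \<Rightarrow> real" where
  "surface_integral F f = (LINT y : flat_chart F -` F | lebesgue. f (flat_chart F y))"

text \<open>Integrands on \<open>\<partial>\<Omega>\<close> and \<open>\<Gamma>\<close> receive the normal (and the shift \<open>a\<close>) of the face as arguments.\<close>

definition boundary_integral :: "fe_mesh \<Rightarrow> (real^3 \<Rightarrow> real^3 \<Rightarrow> real) \<Rightarrow> real" where
  "boundary_integral M g =
     (\<Sum>F\<in>boundary_faces M. surface_integral F (g (outer_normal M F)))"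

definition internal_face_integral ::
    "fe_mesh \<Rightarrow> (real^3 \<Rightarrow> real^3 \<Rightarrow> real^3 \<Rightarrow> real) \<Rightarrow> real" where
  "internal_face_integral M g =
     (\<Sum>(F, a)\<in>internal_faces M. surface_integral F (g (nrm M F) a))"

definition grad :: "(real^3 \<Rightarrow> real) \<Rightarrow> real^3 \<Rightarrow> real^3" where
  "grad f x = (\<chi> i. frechet_derivative f (at x) (axis i 1))"

definition divergence :: "(real^3 \<Rightarrow> real^3) \<Rightarrow> real^3 \<Rightarrow> real" where
  "divergence u x = (\<Sum>i\<in>UNIV. frechet_derivative u (at x) (axis i 1) $ i)"

definition time_deriv :: "(real \<Rightarrow> real^3 \<Rightarrow> real) \<Rightarrow> real \<Rightarrow> real^3 \<Rightarrow> real" where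
  "time_deriv f t x = deriv (\<lambda>s. f s x) t"


section \<open>Finite element spaces\<close>

text \<open>Polynomials of total degree at most \<open>q\<close>, with multi-indices \<open>\<alpha>\<close>.\<close>

definition poly_degree_le :: "nat \<Rightarrow> (real^3 \<Rightarrow> real) set" where
  "poly_degree_le q = {f. \<exists>c. \<forall>x.
     f x = (\<Sum>\<alpha> | (\<Sum>i\<in>UNIV. \<alpha> i) \<le> q. c \<alpha> * (\<Prod>i\<in>UNIV. x$i ^ \<alpha> (i::3)))}"

definition L2_space :: "fe_mesh \<Rightarrow> nat \<Rightarrow> (real^3 \<Rightarrow> real) set" where
  "L2_space M q = {f. \<forall>K\<in>cells M. \<exists>g\<in>poly_degree_le q. \<forall>x\<in>interior K. f x = g x}"

definition H1_space :: "fe_mesh \<Rightarrow> nat \<Rightarrow> (real^3 \<Rightarrow> real) set" where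
  "H1_space M q = {f \<in> L2_space M q. continuous_on (domain M) f \<and>
     (\<forall>(F, a)\<in>glue M. \<forall>x\<in>F. f (x + a) = f x)}"

definition HDiv_space :: "fe_mesh \<Rightarrow> (real^3 \<Rightarrow> real^3) set" where
  "HDiv_space M = {u.
     (\<forall>K\<in>cells M. \<exists>g. polynomial_function g \<and> (\<forall>x\<in>interior K. u x = g x)) \<and>
     (\<forall>(F, a)\<in>internal_faces M. \<forall>x\<in>rel_interior F.
        plus_value (nrm M F) u x \<bullet> nrm M F = minus_value (nrm M F) a u x \<bullet> nrm M F)}"


section \<open>The discretized vorticity equation\<close>

definition bhat :: "(real^3 \<Rightarrow> real^3) \<Rightarrow> real^3 \<Rightarrow> real^3" where
  "bhat B x = B x /\<^sub>R norm (B x)"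

definition perp :: "(real^3 \<Rightarrow> real^3) \<Rightarrow> real^3 \<Rightarrow> real^3 \<Rightarrow> real^3" where
  "perp B x u = u - (bhat B x \<bullet> u) *\<^sub>R bhat B x"

definition grad_perp :: "(real^3 \<Rightarrow> real^3) \<Rightarrow> (real^3 \<Rightarrow> real) \<Rightarrow> real^3 \<Rightarrow> real^3" where
  "grad_perp B f x = perp B x (grad f x)"

text \<open>The perpendicular normal derivative on the boundary, with the gradient taken from inside.\<close>

definition normal_grad_perp ::
    "(real^3 \<Rightarrow> real^3) \<Rightarrow> (real^3 \<Rightarrow> real) \<Rightarrow> real^3 \<Rightarrow> real^3 \<Rightarrow> real" where
  "normal_grad_perp B f n x = perp B x (plus_value n (grad f) x) \<bullet> n"

definition inertia :: "(real^3 \<Rightarrow> real) \<Rightarrow> (real^3 \<Rightarrow> real^3) \<Rightarrow> real^3 \<Rightarrow> real" where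
  "inertia \<rho> B x = \<rho> x / (norm (B x))\<^sup>2"

definition potential_equation ::
    "fe_mesh \<Rightarrow> nat \<Rightarrow> (real^3 \<Rightarrow> real) \<Rightarrow> (real^3 \<Rightarrow> real^3) \<Rightarrow>
     (real^3 \<Rightarrow> real) \<Rightarrow> (real^3 \<Rightarrow> real) \<Rightarrow> bool" where
  "potential_equation M p \<rho> B w \<phi> \<longleftrightarrow> (\<forall>\<psi>\<in>H1_space M p.
     (LINT x : domain M | lebesgue. inertia \<rho> B x * (grad_perp B \<psi> x \<bullet> grad_perp B \<phi> x)) =
     (LINT x : domain M | lebesgue. \<psi> x * w x) +
     boundary_integral M (\<lambda>n x. \<psi> x * inertia \<rho> B x * normal_grad_perp B \<phi> n x))"

definition continuous_Galerkin ::
    "fe_mesh \<Rightarrow> nat \<Rightarrow> (real^3 \<Rightarrow> real^3) \<Rightarrow> (real^3 \<Rightarrow> real) \<Rightarrow> (real^3 \<Rightarrow> real) \<Rightarrow> bool" where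
  "continuous_Galerkin M q v w w' \<longleftrightarrow> (\<forall>\<psi>\<in>H1_space M q.
     (LINT x : domain M | lebesgue. \<psi> x * (w' x + v x \<bullet> grad w x)) = 0)"

text \<open>On \<open>\<Gamma>\<close> the normal component of \<open>v\<close> is single-valued; it is evaluated on the \<open>+\<close> side.\<close>

definition discontinuous_Galerkin ::
    "fe_mesh \<Rightarrow> nat \<Rightarrow> real \<Rightarrow> (real^3 \<Rightarrow> real^3) \<Rightarrow> (real^3 \<Rightarrow> real) \<Rightarrow> (real^3 \<Rightarrow> real) \<Rightarrow> bool" where
  "discontinuous_Galerkin M q \<delta> v w w' \<longleftrightarrow> (\<forall>\<eta>\<in>L2_space M q.
     (LINT x : domain M | lebesgue. \<eta> x * (w' x + v x \<bullet> grad w x)) -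
     internal_face_integral M (\<lambda>n a x.
        (plus_value n v x \<bullet> n) * average n a \<eta> x * jump n a w x -
        \<delta> * \<bar>plus_value n v x \<bullet> n\<bar> * jump n a \<eta> x * jump n a w x) = 0)"

definition energy ::
    "fe_mesh \<Rightarrow> (real^3 \<Rightarrow> real) \<Rightarrow> (real^3 \<Rightarrow> real^3) \<Rightarrow> (real^3 \<Rightarrow> real) \<Rightarrow> real" where
  "energy M \<rho> B \<phi> =
     (LINT x : domain M | lebesgue. inertia \<rho> B x * (grad_perp B \<phi> x \<bullet> grad_perp B \<phi> x))"

text \<open>
  The last two conditions carry the weight \<open>\<rho>/B\<^sup>2\<close> of the boundary term in the potential equation.
  Where \<open>\<rho>/B\<^sup>2\<close> is constant on the boundary, the weight may be dropped
  (\<open>boundary_integral_inertia_const\<close> below). Otherwise it may not: on \<open>[1,2] \<times> [0,1] \<times> [0,1]\<close>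
  with \<open>B = (0,0,1)\<close>, \<open>\<rho> = 1/x\<close>, \<open>w = 0\<close>, \<open>\<phi> = s(t) (x\<^sup>2 - 7)/2\<close> the unweighted integrals
  vanish and every other hypothesis holds, but the energy is \<open>3 s(t)\<^sup>2/2\<close>.
\<close>

definition boundary_conditions ::
    "fe_mesh \<Rightarrow> real set \<Rightarrow> (real^3 \<Rightarrow> real) \<Rightarrow> (real^3 \<Rightarrow> real^3) \<Rightarrow>
     (real \<Rightarrow> real^3 \<Rightarrow> real^3) \<Rightarrow> (real \<Rightarrow> real^3 \<Rightarrow> real) \<Rightarrow> (real \<Rightarrow> real^3 \<Rightarrow> real) \<Rightarrow> bool" where
  "boundary_conditions M T \<rho> B v w \<phi> \<longleftrightarrow> (\<forall>t\<in>T.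
     boundary_integral M (\<lambda>n x.
       plus_value n (w t) x * \<phi> t x * (plus_value n (v t) x \<bullet> n)) = 0 \<and>
     boundary_integral M (\<lambda>n x.
       \<phi> t x * inertia \<rho> B x * normal_grad_perp B (\<phi> t) n x) = 0 \<and>
     boundary_integral M (\<lambda>n x.
       time_deriv \<phi> t x * inertia \<rho> B x * normal_grad_perp B (\<phi> t) n x) = 0)"

lemma boundary_integral_inertia_const:
  assumes "\<And>F x. F \<in> boundary_faces M \<Longrightarrow> x \<in> F \<Longrightarrow> inertia \<rho> B x = c" and "c \<noteq> 0"
  shows "boundary_integral M (\<lambda>n x. f x * inertia \<rho> B x * normal_grad_perp B \<phi> n x) = 0 \<longleftrightarrow>
         boundary_integral M (\<lambda>n x. f x * normal_grad_perp B \<phi> n x) = 0"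
proof -
  have "surface_integral F (\<lambda>x. f x * inertia \<rho> B x * normal_grad_perp B \<phi> (outer_normal M F) x) =
        c * surface_integral F (\<lambda>x. f x * normal_grad_perp B \<phi> (outer_normal M F) x)"
    if "F \<in> boundary_faces M" for F
  proof -
    have "indicator (flat_chart F -` F) y *\<^sub>R (f (flat_chart F y) * inertia \<rho> B (flat_chart F y) *
            normal_grad_perp B \<phi> (outer_normal M F) (flat_chart F y)) =
          c * (indicator (flat_chart F -` F) y *\<^sub>R (f (flat_chart F y) *
            normal_grad_perp B \<phi> (outer_normal M F) (flat_chart F y)))" for y
      using assms(1)[OF that] by (auto simp: indicator_def)
    then show ?thesis
      unfolding surface_integral_def set_lebesgue_integral_def
      by (simp only: integral_mult_right_zero)
  qed
  then show ?thesis
    using \<open>c \<noteq> 0\<close> by (simp add: boundary_integral_def flip: sum_distrib_left)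
qed

text \<open>
  Homogeneous Dirichlet conditions on what remains of the boundary after the periodic
  identifications. In the fully periodic case no boundary face is left and the condition is void.
\<close>

definition periodic_or_Dirichlet ::
    "fe_mesh \<Rightarrow> real set \<Rightarrow> (real \<Rightarrow> real^3 \<Rightarrow> real) \<Rightarrow> (real \<Rightarrow> real^3 \<Rightarrow> real) \<Rightarrow> bool" where
  "periodic_or_Dirichlet M T w \<phi> \<longleftrightarrow> (\<forall>t\<in>T. \<forall>F\<in>boundary_faces M.
     (\<forall>x\<in>F. \<phi> t x = 0) \<and> (\<forall>x\<in>rel_interior F. plus_value (outer_normal M F) (w t) x = 0))"

end

theory Submission
  imports Defs
begin

text \<open>
  Write \<open>a(\<psi>, \<phi>)\<close> for the weighted form of the potential equation, so that the energy is
  \<open>a(\<phi>, \<phi>)\<close>. Testing the potential equation with \<open>\<psi> = \<phi>\<close> and \<open>\<psi> = \<partial>\<^sub>t \<phi>\<close> gives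
  \<open>a(\<phi>, \<phi>) = \<integral>\<phi> w\<close> and \<open>a(\<partial>\<^sub>t \<phi>, \<phi>) = \<integral>\<partial>\<^sub>t \<phi> w\<close>; differentiating the first identity and
  comparing yields \<open>d/dt a(\<phi>, \<phi>) = 2 \<integral>\<phi> \<partial>\<^sub>t w\<close>. Testing the vorticity equation with \<open>\<phi>\<close>, which
  has no jump, turns this into \<open>- 2 \<integral>\<phi> v \<bullet> \<nabla>w\<close> plus twice the integral of \<open>v \<bullet> n \<phi> \<lbrakk>w\<rbrakk>\<close> over the
  internal faces. As \<open>v\<close> is divergence-free and orthogonal to \<open>\<nabla>\<phi>\<close>, \<open>\<phi> v \<bullet> \<nabla>w\<close> is the
  divergence of \<open>\<phi> w v\<close> in each cell, so the divergence theorem on the cells shows that both terms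
  cancel up to a vanishing boundary integral.

  The divergence theorem on a polytope \<open>K\<close> comes from decomposing \<open>K\<close> into the cones over its facets
  with a common apex \<open>z\<close> in the interior. Integration along the rays from \<open>z\<close> proves it for the
  radial fields \<open>f(x) (x - z)\<close>, and differences of two such fields give \<open>f\<close> times any constant
  direction.
\<close>

section \<open>Polynomials\<close>

text \<open>The data \<open>\<rho>\<close> and \<open>B\<close> are only measurable and cannot be
  differentiated. But \<open>v\<close> is polynomial in each cell by membership in
  \<open>HDiv_space\<close>, and the velocity formula enters the transport argument only through
  orthogonality, so the divergence theorem is needed for polynomial fields alone. Dependence on time
  is known only pointwise in \<open>x\<close>, without any uniformity. Interpolation nodes fixed in
  each cell turn a moving polynomial into finitely many scalar functions of time. This makes the
  time derivative of the potential a legitimate test function and lets time derivatives pass through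
  integrals. Traces are limits along the normal and are controlled only on relative interiors of
  faces; what remains is null because faces are convex. The charts of a face and of its periodic
  copy are chosen independently, so surface integrals must first be shown not to depend on the
  chart.\<close>

lemma real_polynomial_gradient:
  fixes f :: "real^3 \<Rightarrow> real"
  assumes "real_polynomial_function f"
  shows "\<exists>G. polynomial_function G \<and> (\<forall>x. (f has_derivative (\<lambda>h. G x \<bullet> h)) (at x))"
  using assms
proof induction
  case (linear f)
  obtain a where a: "f = (\<lambda>x. a \<bullet> x)"
  proof
    interpret bounded_linear f by fact
    show "f = (\<lambda>x. (\<Sum>i\<in>Basis. f i *\<^sub>R i) \<bullet> x)"
    proof
      fix x
      have "f x = f (\<Sum>i\<in>Basis. (x \<bullet> i) *\<^sub>R i)" by (simp add: euclidean_representation)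
      also have "\<dots> = (\<Sum>i\<in>Basis. f i *\<^sub>R i) \<bullet> x"
        by (subst inner_commute) (simp add: sum scale inner_sum_right mult.commute)
      finally show "f x = (\<Sum>i\<in>Basis. f i *\<^sub>R i) \<bullet> x" .
    qed
  qed
  show ?case
    unfolding a by (intro exI[of _ "\<lambda>x. a"]) (auto intro!: derivative_eq_intros)
next
  case (const c)
  show ?case by (intro exI[of _ "\<lambda>x. 0"]) auto
next
  case (add f g)
  then obtain F G where *: "polynomial_function F" "polynomial_function G"
      "\<forall>x. (f has_derivative (\<lambda>h. F x \<bullet> h)) (at x)" "\<forall>x. (g has_derivative (\<lambda>h. G x \<bullet> h)) (at x)"
    by blast
  show ?case
    by (intro exI[of _ "\<lambda>x. F x + G x"])
      (use * in \<open>auto intro!: derivative_eq_intros simp: inner_add_left\<close>)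
next
  case (mult f g)
  then obtain F G where *: "polynomial_function F" "polynomial_function G"
      "\<And>x. (f has_derivative (\<lambda>h. F x \<bullet> h)) (at x)" "\<And>x. (g has_derivative (\<lambda>h. G x \<bullet> h)) (at x)"
    by blast
  show ?case
  proof (intro exI[of _ "\<lambda>x. f x *\<^sub>R G x + g x *\<^sub>R F x"] conjI allI)
    show "polynomial_function (\<lambda>x. f x *\<^sub>R G x + g x *\<^sub>R F x)"
      using mult * by (auto simp: real_polynomial_function_eq)
    fix x
    show "((\<lambda>x. f x * g x) has_derivative (\<lambda>h. (f x *\<^sub>R G x + g x *\<^sub>R F x) \<bullet> h)) (at x)"
      by (rule derivative_eq_intros * refl)+ (auto simp: inner_add_left)
  qed
qed

lemma grad_eqI:
  assumes "(f has_derivative (\<lambda>h. a \<bullet> h)) (at x)"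
  shows "grad f x = a"
  unfolding grad_def frechet_derivative_at[OF assms, symmetric] by (simp add: vec_eq_iff inner_axis)

lemma polynomial_grad:
  assumes "real_polynomial_function f"
  shows "polynomial_function (grad f)" "(f has_derivative (\<lambda>h. grad f x \<bullet> h)) (at x)"
proof -
  obtain G where G: "polynomial_function G" "\<And>x. (f has_derivative (\<lambda>h. G x \<bullet> h)) (at x)"
    using real_polynomial_gradient[OF assms] by blast
  then have "grad f = G" by (auto intro!: grad_eqI)
  with G show "polynomial_function (grad f)" "(f has_derivative (\<lambda>h. grad f x \<bullet> h)) (at x)"
    by auto
qed

text \<open>\<open>frechet_derivative\<close> picks some map satisfying
  \<open>has_derivative\<close>, and that predicate is local; the choice is therefore the same for
  both functions even where no derivative exists. Mesh functions are known to be polynomial only in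
  cell interiors, hence the open set.\<close>

lemma grad_cong_open:
  assumes "open S" "x \<in> S" "\<And>y. y \<in> S \<Longrightarrow> f y = g y"
  shows "grad f x = grad g x"
proof -
  have "(f has_derivative D) (at x) \<longleftrightarrow> (g has_derivative D) (at x)" for D
    using assms has_derivative_transform_within_open[of f D x UNIV S g]
      has_derivative_transform_within_open[of g D x UNIV S f] by auto
  then show ?thesis by (simp add: grad_def frechet_derivative_def)
qed

lemma divergence_cong_open:
  assumes "open S" "x \<in> S" "\<And>y. y \<in> S \<Longrightarrow> f y = g y"
  shows "divergence f x = divergence g x"
proof -
  have "(f has_derivative D) (at x) \<longleftrightarrow> (g has_derivative D) (at x)" for D
    using assms has_derivative_transform_within_open[of f D x UNIV S g]
      has_derivative_transform_within_open[of g D x UNIV S f] by auto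
  then show ?thesis by (simp add: divergence_def frechet_derivative_def)
qed

lemma polynomial_function_component:
  fixes u :: "real^3 \<Rightarrow> real^3"
  assumes "polynomial_function u"
  shows "real_polynomial_function (\<lambda>x. u x $ i)"
  using assms bounded_linear_vec_nth[of i] unfolding polynomial_function_def o_def by blast

lemma divergence_polynomial:
  assumes "polynomial_function u"
  shows "divergence u x = (\<Sum>i\<in>UNIV. grad (\<lambda>x. u x $ i) x $ i)"
proof -
  have "(u has_derivative (\<lambda>h. \<chi> i. grad (\<lambda>x. u x $ i) x \<bullet> h)) (at x)"
    unfolding has_derivative_componentwise_within[of u _ x UNIV]
    using polynomial_grad(2)[OF polynomial_function_component[OF assms]]
    by (auto simp: Basis_vec_def inner_axis)
  from frechet_derivative_at[OF this, symmetric] show ?thesis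
    by (simp add: divergence_def inner_axis)
qed

lemma grad_mult:
  assumes "real_polynomial_function f" "real_polynomial_function g"
  shows "grad (\<lambda>x. f x * g x) x = f x *\<^sub>R grad g x + g x *\<^sub>R grad f x"
  by (rule grad_eqI) (rule derivative_eq_intros polynomial_grad(2) assms refl | simp add: inner_add_left mult.commute)+

lemma grad_sum_scaled:
  assumes "finite X" "\<And>i. i \<in> X \<Longrightarrow> real_polynomial_function (L i)"
  shows "grad (\<lambda>x. \<Sum>i\<in>X. c i * L i x) x = (\<Sum>i\<in>X. c i *\<^sub>R grad (L i) x)"
  by (rule grad_eqI)
    (auto intro!: derivative_eq_intros polynomial_grad(2) assms simp: inner_sum_left)

section \<open>Interpolation\<close>

definition monomial :: "(3 \<Rightarrow> nat) \<Rightarrow> real^3 \<Rightarrow> real" where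
  "monomial \<alpha> x = (\<Prod>i\<in>UNIV. x$i ^ \<alpha> i)"

definition multi_indices :: "nat \<Rightarrow> (3 \<Rightarrow> nat) set" where
  "multi_indices q = {\<alpha>. (\<Sum>i\<in>UNIV. \<alpha> i) \<le> q}"

definition poly_of :: "nat \<Rightarrow> ((3 \<Rightarrow> nat) \<Rightarrow> real) \<Rightarrow> real^3 \<Rightarrow> real" where
  "poly_of q c x = (\<Sum>\<alpha>\<in>multi_indices q. c \<alpha> * monomial \<alpha> x)"

lemma poly_degree_le_eq_range: "poly_degree_le q = range (poly_of q)"
  unfolding poly_degree_le_def poly_of_def multi_indices_def monomial_def
    full_SetCompr_eq[symmetric] fun_eq_iff
  by (rule refl)

lemma finite_multi_indices: "finite (multi_indices q)"
proof (rule finite_subset)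
  show "multi_indices q \<subseteq> PiE UNIV (\<lambda>_. {..q})"
  proof
    fix \<alpha> assume "\<alpha> \<in> multi_indices q"
    moreover have "\<alpha> i \<le> (\<Sum>i\<in>UNIV. \<alpha> i)" for i by (rule member_le_sum) auto
    ultimately show "\<alpha> \<in> PiE UNIV (\<lambda>_. {..q})"
      by (auto simp: multi_indices_def intro: order_trans)
  qed
qed (auto intro: finite_PiE)

lemma real_polynomial_monomial: "real_polynomial_function (monomial \<alpha>)"
proof -
  have "real_polynomial_function (\<lambda>x::real^3. x$i)" for i
    using bounded_linear_vec_nth by blast
  then have "real_polynomial_function (\<lambda>x::real^3. \<Prod>i\<in>UNIV. x$i ^ \<alpha> i)"
    by (intro real_polynomial_function_prod[where f = "\<lambda>x i. x$i ^ \<alpha> i"] real_polynomial_function_power) auto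
  then show ?thesis by (simp add: monomial_def[abs_def])
qed

lemma poly_degree_le_polynomial:
  assumes "f \<in> poly_degree_le q"
  shows "real_polynomial_function f"
proof -
  have "real_polynomial_function (poly_of q c)" for c
    unfolding poly_of_def[abs_def]
    by (intro real_polynomial_function_sum[OF finite_multi_indices]
        real_polynomial_function.intros(4)[OF real_polynomial_function.intros(2)] real_polynomial_monomial)
  then show ?thesis using assms by (auto simp: poly_degree_le_eq_range)
qed

lemma poly_degree_le_mono:
  assumes "p \<le> q"
  shows "poly_degree_le p \<subseteq> poly_degree_le q"
proof -
  have "poly_of p c = poly_of q (\<lambda>\<alpha>. if \<alpha> \<in> multi_indices p then c \<alpha> else 0)" for c
    unfolding poly_of_def[abs_def] using assms
    by (intro ext sum.mono_neutral_cong_left finite_multi_indices) (auto simp: multi_indices_def)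
  then show ?thesis by (auto simp: poly_degree_le_eq_range)
qed

lemma poly_degree_le_combination:
  assumes "finite X" "\<And>i. i \<in> X \<Longrightarrow> L i \<in> poly_degree_le q"
  shows "(\<lambda>x. \<Sum>i\<in>X. a i * L i x) \<in> poly_degree_le q"
proof -
  have "\<forall>i. \<exists>c. i \<in> X \<longrightarrow> L i = poly_of q c"
    using assms(2) by (auto simp: poly_degree_le_eq_range)
  then obtain c where c: "\<And>i. i \<in> X \<Longrightarrow> L i = poly_of q (c i)"
    by metis
  have "(\<Sum>i\<in>X. a i * L i x) = poly_of q (\<lambda>\<alpha>. \<Sum>i\<in>X. a i * c i \<alpha>) x" for x
  proof -
    have "(\<Sum>i\<in>X. a i * L i x) = (\<Sum>i\<in>X. \<Sum>\<alpha>\<in>multi_indices q. a i * c i \<alpha> * monomial \<alpha> x)"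
      by (rule sum.cong) (simp_all add: c poly_of_def sum_distrib_left mult.assoc)
    also have "\<dots> = poly_of q (\<lambda>\<alpha>. \<Sum>i\<in>X. a i * c i \<alpha>) x"
      unfolding poly_of_def sum_distrib_right by (rule sum.swap)
    finally show ?thesis .
  qed
  then show ?thesis by (auto simp: poly_degree_le_eq_range)
qed

text \<open>A node is added for each spanning function that is not yet reproduced on \<open>S\<close>.\<close>

lemma interpolation_span:
  fixes b :: "'i \<Rightarrow> 'a \<Rightarrow> real"
  assumes "finite I"
  shows "\<exists>X L. finite X \<and> X \<subseteq> S \<and> (\<forall>x\<in>X. \<exists>a. L x = (\<lambda>y. \<Sum>i\<in>I. a i * b i y)) \<and>
    (\<forall>c. \<forall>y\<in>S. (\<Sum>i\<in>I. c i * b i y) = (\<Sum>x\<in>X. (\<Sum>i\<in>I. c i * b i x) * L x y))"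
  using assms
proof induction
  case empty
  show ?case by (intro exI[of _ "{}"]) auto
next
  case (insert j I)
  from insert.IH obtain X L where X: "finite X" "X \<subseteq> S"
    and spanL: "\<forall>x\<in>X. \<exists>a. L x = (\<lambda>y. \<Sum>i\<in>I. a i * b i y)"
    and repr: "\<forall>c. \<forall>y\<in>S. (\<Sum>i\<in>I. c i * b i y) = (\<Sum>x\<in>X. (\<Sum>i\<in>I. c i * b i x) * L x y)"
    by (elim exE conjE)
  note L = repr[rule_format]
  obtain a where a: "\<And>x. x \<in> X \<Longrightarrow> L x = (\<lambda>y. \<Sum>i\<in>I. a x i * b i y)"
    using bchoice[OF spanL] by auto
  \<comment> \<open>The residual of \<open>b j\<close> after interpolation at the present nodes. If
    it vanishes on \<open>S\<close>, these nodes suffice; otherwise a point where it does not vanish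
    becomes the new node.\<close>
  define r where "r y = b j y - (\<Sum>x\<in>X. b j x * L x y)" for y
  have span: "\<exists>a. L x = (\<lambda>y. \<Sum>i\<in>insert j I. a i * b i y)" if "x \<in> X" for x
    using insert that by (intro exI[of _ "\<lambda>i. if i = j then 0 else a x i"])
      (auto simp: a fun_eq_iff intro!: sum.cong)
  have decomp: "(\<Sum>i\<in>insert j I. c i * b i y) =
      (\<Sum>x\<in>X. (\<Sum>i\<in>insert j I. c i * b i x) * L x y) + c j * r y" if "y \<in> S" for c y
    using insert L[OF that, of c]
    by (simp add: r_def algebra_simps sum.distrib sum_distrib_left)
  show ?case
  proof (cases "\<forall>y\<in>S. r y = 0")
    case True
    then show ?thesis
      using X span decomp by (intro exI[of _ X] exI[of _ L]) auto
  next
    case False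
    then obtain z where z: "z \<in> S" "r z \<noteq> 0" by auto
    \<comment> \<open>The two cases overlap on purpose. The induction hypothesis does not say that
      \<open>L\<close> is dual to the nodes, so \<open>z\<close> may already be one of them; both
      contributions are then added.\<close>
    define L' where "L' x y = (if x \<in> X then L x y - L x z * (r y / r z) else 0) +
        (if x = z then r y / r z else 0)" for x y
    obtain ar where ar: "r = (\<lambda>y. \<Sum>i\<in>insert j I. ar i * b i y)"
    proof
      show "r = (\<lambda>y. \<Sum>i\<in>insert j I. (if i = j then 1 else - (\<Sum>x\<in>X. b j x * a x i)) * b i y)"
      proof
        fix y
        have "(\<Sum>x\<in>X. b j x * L x y) = (\<Sum>i\<in>I. (\<Sum>x\<in>X. b j x * a x i) * b i y)"
          by (simp add: a sum_distrib_left sum_distrib_right mult.assoc) (rule sum.swap)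
        moreover have "(\<Sum>i\<in>I. (if i = j then 1 else - (\<Sum>x\<in>X. b j x * a x i)) * b i y) =
            - (\<Sum>i\<in>I. (\<Sum>x\<in>X. b j x * a x i) * b i y)"
          using insert by (subst sum_negf[symmetric], intro sum.cong) auto
        ultimately show "r y = (\<Sum>i\<in>insert j I. (if i = j then 1 else - (\<Sum>x\<in>X. b j x * a x i)) * b i y)"
          using insert by (simp add: r_def)
      qed
    qed
    have "\<exists>c. L' x = (\<lambda>y. \<Sum>i\<in>insert j I. c i * b i y)" if "x \<in> insert z X" for x
    proof (cases "x \<in> X")
      case True
      then obtain c where c: "L x = (\<lambda>y. \<Sum>i\<in>insert j I. c i * b i y)" using span by blast
      have "L' x = (\<lambda>y. \<Sum>i\<in>insert j I. (c i + ((if x = z then 1 else 0) - L x z) / r z * ar i) * b i y)"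
      proof
        fix y
        have "L' x y = L x y + ((if x = z then 1 else 0) - L x z) / r z * r y"
          using True z by (simp add: L'_def field_simps)
        also have "\<dots> = (\<Sum>i\<in>insert j I. (c i + ((if x = z then 1 else 0) - L x z) / r z * ar i) * b i y)"
          unfolding fun_cong[OF c, of y] fun_cong[OF ar, of y]
          by (simp only: sum_distrib_left sum.distrib[symmetric] distrib_right mult.assoc)
        finally show "L' x y = \<dots>" .
      qed
      then show ?thesis
        by (intro exI[of _ "\<lambda>i. c i + ((if x = z then 1 else 0) - L x z) / r z * ar i"])
    next
      case False
      then have "x = z" using that by auto
      then have "L' x = (\<lambda>y. \<Sum>i\<in>insert j I. (ar i / r z) * b i y)"
        using False by (auto simp: L'_def fun_eq_iff ar sum_divide_distrib)
      then show ?thesis by (intro exI[of _ "\<lambda>i. ar i / r z"])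
    qed
    moreover have "(\<Sum>i\<in>insert j I. c i * b i y) = (\<Sum>x\<in>insert z X. (\<Sum>i\<in>insert j I. c i * b i x) * L' x y)"
      if "y \<in> S" for c y
    proof -
      let ?f = "\<lambda>y. \<Sum>i\<in>insert j I. c i * b i y"
      have "(\<Sum>x\<in>insert z X. ?f x * L' x y) =
          (\<Sum>x\<in>insert z X. if x \<in> X then ?f x * (L x y - L x z * (r y / r z)) else 0) +
          (\<Sum>x\<in>insert z X. if x = z then ?f x * (r y / r z) else 0)"
        by (subst sum.distrib[symmetric], intro sum.cong) (auto simp: L'_def distrib_left)
      also have "(\<Sum>x\<in>insert z X. if x \<in> X then ?f x * (L x y - L x z * (r y / r z)) else 0) =
          (\<Sum>x\<in>X. ?f x * (L x y - L x z * (r y / r z)))"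
        using X by (intro sum.mono_neutral_cong_right) auto
      also have "(\<Sum>x\<in>insert z X. if x = z then ?f x * (r y / r z) else 0) = ?f z * (r y / r z)"
        using X by (subst sum.delta) auto
      also have "(\<Sum>x\<in>X. ?f x * (L x y - L x z * (r y / r z))) =
          (\<Sum>x\<in>X. ?f x * L x y) - (\<Sum>x\<in>X. ?f x * L x z) * (r y / r z)"
        by (simp only: sum_distrib_right right_diff_distrib sum_subtractf mult.assoc)
      also have "\<dots> + ?f z * (r y / r z) = (\<Sum>x\<in>X. ?f x * L x y) + (?f z - (\<Sum>x\<in>X. ?f x * L x z)) * (r y / r z)"
        by algebra
      \<comment> \<open>Interpolation at the old nodes misses \<open>?f\<close> by
        \<open>c j * r\<close>. The error at \<open>z\<close> thus determines \<open>c j\<close>,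
        and rescaling it by \<open>r y / r z\<close> corrects the value at every
        \<open>y\<close>.\<close>
      also have "?f z - (\<Sum>x\<in>X. ?f x * L x z) = c j * r z"
        using decomp[OF z(1), of c] by simp
      also have "(\<Sum>x\<in>X. ?f x * L x y) + c j * r z * (r y / r z) = ?f y"
        using decomp[OF that, of c] z by simp
      finally show ?thesis ..
    qed
    ultimately show ?thesis
      using X z by (intro exI[of _ "insert z X"] exI[of _ L'] conjI) auto
  qed
qed

section \<open>Facets\<close>

text \<open>Requiring the affine hull to be the whole plane, not merely contained in it, forces the
  face to be two-dimensional; this determines \<open>n\<close> up to sign and excludes the empty
  set.\<close>

definition flat_face :: "(real^3) set \<Rightarrow> real^3 \<Rightarrow> real \<Rightarrow> bool" where
  "flat_face F n b \<longleftrightarrow> compact F \<and> convex F \<and> norm n = 1 \<and> affine hull F = {x. n \<bullet> x = b}"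

lemma flat_face_nonempty: "flat_face F n b \<Longrightarrow> F \<noteq> {}"
proof
  assume *: "flat_face F n b" "F = {}"
  then have "n \<bullet> n = 1" by (simp add: flat_face_def norm_eq_1)
  then have "b *\<^sub>R n \<in> {x. n \<bullet> x = b}" by simp
  moreover have "{x. n \<bullet> x = b} = {}" using * by (simp add: flat_face_def)
  ultimately show False by simp
qed

lemma flat_face_subset: "flat_face F n b \<Longrightarrow> x \<in> F \<Longrightarrow> n \<bullet> x = b"
  using hull_subset[of F affine] by (auto simp: flat_face_def)

text \<open>A step from a point of \<open>F\<close> along the part of \<open>m\<close> orthogonal to
  \<open>n\<close> stays in the affine hull, where \<open>m \<bullet> x\<close> is constant. So
  \<open>m\<close> is orthogonal to that part, which must be zero.\<close>

lemma flat_face_normal_unique: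
  assumes F: "flat_face F n b" and m: "norm m = 1" "\<And>x. x \<in> F \<Longrightarrow> m \<bullet> x = c"
  shows "m = n \<or> m = - n"
proof -
  have n: "n \<bullet> n = 1" using F by (simp add: flat_face_def norm_eq_1)
  obtain x where x: "x \<in> F" using flat_face_nonempty[OF F] by auto
  define u where "u = m - (m \<bullet> n) *\<^sub>R n"
  have nu: "n \<bullet> u = 0" using n by (simp add: u_def inner_diff_right inner_commute)
  have "affine hull F \<subseteq> {x. m \<bullet> x = c}"
    by (rule hull_minimal) (auto simp: m affine_hyperplane)
  moreover have "x + u \<in> affine hull F"
    using F x nu by (simp add: flat_face_def flat_face_subset[OF F] inner_add_right)
  ultimately have "m \<bullet> (x + u) = c" by auto
  then have "m \<bullet> u = 0" using m(2)[OF x] by (simp add: inner_add_right)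
  then have "u \<bullet> u = 0" using nu by (simp add: u_def inner_diff_left)
  then have mn: "m = (m \<bullet> n) *\<^sub>R n" by (simp add: u_def)
  then have "\<bar>m \<bullet> n\<bar> = 1"
    using m(1) F by (metis abs_of_pos flat_face_def mult.right_neutral norm_scaleR zero_less_one)
  then have "m \<bullet> n = 1 \<or> m \<bullet> n = -1" by linarith
  then show ?thesis using mn by auto
qed

text \<open>A cell with interior is three-dimensional, so its facets have dimension 2 and their
  affine hulls fill the supporting planes.\<close>

lemma facet_flat:
  assumes K: "polytope K" "interior K \<noteq> {}" and F: "F facet_of K"
  obtains n b where "flat_face F n b" "outward_unit_normal K F n" "F = K \<inter> {x. n \<bullet> x = b}"
    "\<And>y. y \<in> K \<Longrightarrow> n \<bullet> y \<le> b" "\<And>y. y \<in> interior K \<Longrightarrow> n \<bullet> y < b"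
proof -
  obtain a c where ac: "a \<noteq> 0" "K \<subseteq> {x. a \<bullet> x \<le> c}" "F = K \<inter> {x. a \<bullet> x = c}"
    using facet_of_polyhedron[OF polytope_imp_polyhedron[OF K(1)] F] by metis
  define n where "n = a /\<^sub>R norm a"
  define b where "b = c / norm a"
  have n: "norm n = 1" "n \<noteq> 0" using ac by (auto simp: n_def)
  have le: "n \<bullet> y \<le> b" if "y \<in> K" for y
    using ac that by (auto simp: n_def b_def field_simps)
  have Feq: "F = K \<inter> {x. n \<bullet> x = b}"
    using ac by (auto simp: n_def b_def field_simps)
  have dim: "aff_dim F = 2"
    using F aff_dim_nonempty_interior[OF K(2)] by (simp add: facet_of_def)
  have aff: "affine hull F = {x. n \<bullet> x = b}"
  proof (rule affine_dim_equal)
    show "affine hull F \<subseteq> {x. n \<bullet> x = b}"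
      by (rule hull_minimal) (auto simp: Feq affine_hyperplane)
    show "affine hull F \<noteq> {}" using F by (simp add: facet_of_def)
    show "aff_dim (affine hull F) = aff_dim {x. n \<bullet> x = b}"
      using n dim by (simp add: aff_dim_hyperplane)
  qed (auto simp: affine_hyperplane)
  have flat: "flat_face F n b"
    unfolding flat_face_def
  proof (intro conjI n aff)
    show "compact F"
      using face_of_imp_compact[OF polytope_imp_convex[OF K(1)] polytope_imp_compact[OF K(1)]] F
      by (auto simp: facet_of_def)
    show "convex F" using F by (auto simp: facet_of_def dest: face_of_imp_convex)
  qed
  show thesis
  proof (rule that[OF flat _ Feq le])
    show "outward_unit_normal K F n"
      using n le by (auto simp: outward_unit_normal_def Feq inner_diff_right)
    show "n \<bullet> y < b" if "y \<in> interior K" for y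
    proof -
      obtain e where e: "e > 0" "cball y e \<subseteq> K"
        using \<open>y \<in> interior K\<close> mem_interior_cball by blast
      have "y + e *\<^sub>R n \<in> K" using e n by (auto simp: subset_eq dist_norm)
      from le[OF this] show ?thesis using e n by (simp add: inner_add_right norm_eq_1)
    qed
  qed
qed

definition facet_normal :: "(real^3) set \<Rightarrow> (real^3) set \<Rightarrow> real^3" where
  "facet_normal K F = (THE n. outward_unit_normal K F n)"

text \<open>As \<open>F\<close> is part of \<open>K\<close>, the defining inequality of an outward
  normal holds on \<open>F\<close> in both directions, so the normal is constant on \<open>F\<close>
  and determined up to sign; an interior point of \<open>K\<close> excludes the inward sign. This is
  what gives \<open>THE\<close> in \<open>facet_normal\<close> a meaning.\<close>

lemma facet_normal:
  assumes K: "polytope K" "interior K \<noteq> {}" and F: "F facet_of K"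
  shows outward_unit_normal_iff: "outward_unit_normal K F n \<longleftrightarrow> n = facet_normal K F"
    and flat_face_facet: "\<exists>b. flat_face F (facet_normal K F) b \<and> F = K \<inter> {x. facet_normal K F \<bullet> x = b} \<and>
      (\<forall>y\<in>K. facet_normal K F \<bullet> y \<le> b) \<and> (\<forall>y\<in>interior K. facet_normal K F \<bullet> y < b)"
proof -
  obtain n b where n: "flat_face F n b" "outward_unit_normal K F n" "F = K \<inter> {x. n \<bullet> x = b}"
    "\<And>y. y \<in> K \<Longrightarrow> n \<bullet> y \<le> b" "\<And>y. y \<in> interior K \<Longrightarrow> n \<bullet> y < b"
    using facet_flat[OF assms] by metis
  have uniq: "m = n" if m: "outward_unit_normal K F m" for m
  proof -
    obtain x where x: "x \<in> F" using flat_face_nonempty[OF n(1)] by auto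
    have "m \<bullet> y = m \<bullet> x" if "y \<in> F" for y
    proof -
      have "F \<subseteq> K" using n by auto
      then have "m \<bullet> (y - x) \<le> 0" "m \<bullet> (x - y) \<le> 0"
        using m x that by (auto simp: outward_unit_normal_def)
      then show ?thesis by (simp add: inner_diff_right)
    qed
    then have "m = n \<or> m = - n"
      using flat_face_normal_unique[OF n(1), of m "m \<bullet> x"] m by (auto simp: outward_unit_normal_def)
    moreover have "m \<noteq> - n"
    proof
      assume "m = - n"
      obtain y where y: "y \<in> interior K" using K by auto
      then have "m \<bullet> (y - x) \<le> 0"
        using m x interior_subset by (auto simp: outward_unit_normal_def)
      then show False using n(5)[OF y] flat_face_subset[OF n(1) x] \<open>m = - n\<close>
        by (simp add: inner_diff_right)
    qed
    ultimately show ?thesis by auto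
  qed
  have eq: "facet_normal K F = n"
    unfolding facet_normal_def using n(2) uniq by (rule the_equality)
  show "outward_unit_normal K F m \<longleftrightarrow> m = facet_normal K F" for m
    unfolding eq using n(2) uniq by blast
  show "\<exists>b. flat_face F (facet_normal K F) b \<and> F = K \<inter> {x. facet_normal K F \<bullet> x = b} \<and>
      (\<forall>y\<in>K. facet_normal K F \<bullet> y \<le> b) \<and> (\<forall>y\<in>interior K. facet_normal K F \<bullet> y < b)"
    unfolding eq using n by blast
qed

text \<open>Traces are limits along the normal, so the normal line through \<open>x\<close> must
  enter the cell. A segment from an interior point \<open>z\<close> to a suitable point
  \<open>y\<close> of the facet is made to cross that line below \<open>x\<close>; convexity then
  gives all shorter distances.\<close>

lemma facet_normal_ray:
  assumes K: "polytope K" "interior K \<noteq> {}" and F: "F facet_of K" and x: "x \<in> rel_interior F"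
  obtains e where "e > 0" "\<And>s. 0 < s \<Longrightarrow> s \<le> e \<Longrightarrow> x - s *\<^sub>R facet_normal K F \<in> interior K"
proof -
  define n where "n = facet_normal K F"
  obtain b where flat: "flat_face F n b" and Feq: "F = K \<inter> {x. n \<bullet> x = b}"
    and lt: "\<forall>y\<in>interior K. n \<bullet> y < b"
    using flat_face_facet[OF K F] unfolding n_def by blast
  have n1: "n \<bullet> n = 1" using flat by (simp add: flat_face_def norm_eq_1)
  have aff: "affine hull F = {x. n \<bullet> x = b}" using flat by (simp add: flat_face_def)
  have convK: "convex K" using K polytope_imp_convex by auto
  have xF: "x \<in> F" using x rel_interior_subset by auto
  then have xK: "x \<in> K" "n \<bullet> x = b" by (auto simp: Feq)
  obtain z where z: "z \<in> interior K" using K by auto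
  define t where "t = b - n \<bullet> z"
  have t: "t > 0" using lt z by (auto simp: t_def)
  \<comment> \<open>The projection of \<open>z\<close> to the plane of the facet; it may lie outside
    \<open>F\<close>.\<close>
  define z' where "z' = z + t *\<^sub>R n"
  have z': "n \<bullet> z' = b" using n1 by (simp add: z'_def t_def inner_add_right)
  obtain r where r: "r > 0" "ball x r \<inter> affine hull F \<subseteq> F"
    using x by (auto simp: mem_rel_interior_ball)
  define N where "N = norm (z' - x)"
  have N: "0 \<le> N" by (simp add: N_def)
  \<comment> \<open>Small enough for \<open>y\<close>, which lies beyond \<open>x\<close> as seen
    from \<open>z'\<close>, to remain in \<open>F\<close>. The summand 1 covers the case
    \<open>z' = x\<close>.\<close>
  define \<epsilon> where "\<epsilon> = r / (N + 1)"
  have \<epsilon>: "\<epsilon> > 0" using r(1) N by (simp add: \<epsilon>_def)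
  define y where "y = x - \<epsilon> *\<^sub>R (z' - x)"
  have "r * N < r * (N + 1)" using r(1) by simp
  then have "\<epsilon> * norm (z' - x) < r"
    using N by (simp add: \<epsilon>_def pos_divide_less_eq flip: N_def)
  then have "y \<in> ball x r" using \<epsilon> by (simp add: y_def dist_norm)
  moreover have "y \<in> affine hull F"
    using z' xK by (simp add: aff y_def inner_diff_right)
  ultimately have yK: "y \<in> K" using r Feq by auto
  \<comment> \<open>Chosen with \<open>\<mu> * (1 + \<epsilon>) = \<epsilon>\<close>: the tangential
    displacements then cancel, and the point on the segment from \<open>y\<close> to
    \<open>z\<close> lies exactly on the normal line through \<open>x\<close>.\<close>
  define \<mu> where "\<mu> = \<epsilon> / (1 + \<epsilon>)"
  have \<mu>: "0 < \<mu>" "\<mu> \<le> 1" using \<epsilon> by (auto simp: \<mu>_def)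
  have "y - \<mu> *\<^sub>R (y - z) \<in> interior K"
    by (rule mem_interior_convex_shrink[OF convK z yK \<mu>])
  moreover have "y - \<mu> *\<^sub>R (y - z) = x - (\<mu> * t) *\<^sub>R n"
  proof -
    have "\<mu> * (1 + \<epsilon>) = \<epsilon>" using \<epsilon> by (simp add: \<mu>_def)
    then have e: "\<epsilon> = \<mu> + \<mu> * \<epsilon>" by (simp add: algebra_simps)
    have "y - \<mu> *\<^sub>R (y - z) = x - (\<mu> * t) *\<^sub>R n + (\<mu> + \<mu> * \<epsilon> - \<epsilon>) *\<^sub>R (z' - x)"
      by (simp add: y_def z'_def algebra_simps)
    also have "\<mu> + \<mu> * \<epsilon> - \<epsilon> = 0" using e by simp
    finally show ?thesis by simp
  qed
  ultimately have in_int: "x - (\<mu> * t) *\<^sub>R n \<in> interior K" by simp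
  show thesis
  proof (rule that[of "\<mu> * t"])
    show "0 < \<mu> * t" using \<mu> t by simp
    show "x - s *\<^sub>R facet_normal K F \<in> interior K" if s: "0 < s" "s \<le> \<mu> * t" for s
    proof -
      have "x - (s / (\<mu> * t)) *\<^sub>R (x - (x - (\<mu> * t) *\<^sub>R n)) \<in> interior K"
        by (rule mem_interior_convex_shrink[OF convK in_int xK(1)]) (use s \<mu> t in auto)
      then show ?thesis using \<mu> t by (simp add: n_def)
    qed
  qed
qed

text \<open>The limit is taken along the inward ray of \<open>facet_normal_ray\<close>, on which
  \<open>u\<close> agrees with \<open>g\<close>. The value of \<open>u\<close> on the facet itself
  never matters.\<close>

lemma side_value_facet:
  fixes g :: "real^3 \<Rightarrow> 'a::t2_space"
  assumes K: "polytope K" "interior K \<noteq> {}" and F: "F facet_of K" and x: "x \<in> rel_interior F"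
    and u: "\<And>y. y \<in> interior K \<Longrightarrow> u y = g y" and g: "isCont g x"
  shows "plus_value (facet_normal K F) u x = g x"
proof -
  obtain e where e: "e > 0" "\<And>s. 0 < s \<Longrightarrow> s \<le> e \<Longrightarrow> x - s *\<^sub>R facet_normal K F \<in> interior K"
    using facet_normal_ray[OF K F x] by metis
  have "((\<lambda>s. g (x + s *\<^sub>R (- facet_normal K F))) \<longlongrightarrow> g (x + 0 *\<^sub>R (- facet_normal K F))) (at_right 0)"
    using g by (intro isCont_tendsto_compose[where g = g] tendsto_intros) auto
  moreover have "\<forall>\<^sub>F s in at_right 0. g (x + s *\<^sub>R (- facet_normal K F)) = u (x + s *\<^sub>R (- facet_normal K F))"
    unfolding eventually_at_right_field using e u by (intro exI[of _ e]) auto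
  ultimately have "((\<lambda>s. u (x + s *\<^sub>R (- facet_normal K F))) \<longlongrightarrow> g x) (at_right 0)"
    using filterlim_cong[OF refl refl] by force
  then show ?thesis
    unfolding side_value_def by (intro tendsto_Lim) auto
qed

section \<open>Surface integrals\<close>

text \<open>The residual \<open>r\<close> is orthogonal to \<open>e1\<close> and \<open>e2\<close>,
  so the double cross product formula makes its cross product with \<open>cross3 e1 e2\<close>
  vanish. Being orthogonal to this unit vector as well, \<open>r\<close> is zero.\<close>

lemma orthonormal_decomp:
  fixes x :: "real^3"
  assumes e: "norm e1 = 1" "norm e2 = 1" "e1 \<bullet> e2 = 0"
  shows "x = (x \<bullet> e1) *\<^sub>R e1 + (x \<bullet> e2) *\<^sub>R e2 + (x \<bullet> cross3 e1 e2) *\<^sub>R cross3 e1 e2"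
    and "norm (cross3 e1 e2) = 1"
proof -
  let ?m = "cross3 e1 e2"
  have "(norm ?m)\<^sup>2 = 1" unfolding norm_cross using e by simp
  then show m: "norm ?m = 1" using real_sqrt_unique[of "norm ?m" 1] by simp
  have mm: "?m \<bullet> ?m = 1" "e1 \<bullet> e1 = 1" "e2 \<bullet> e2 = 1" using m e by (simp_all add: norm_eq_1)
  have me: "?m \<bullet> e1 = 0" "?m \<bullet> e2 = 0" "e1 \<bullet> ?m = 0" "e2 \<bullet> ?m = 0"
    by (simp_all add: dot_cross_self inner_commute[of ?m])
  define r where "r = x - ((x \<bullet> e1) *\<^sub>R e1 + (x \<bullet> e2) *\<^sub>R e2 + (x \<bullet> ?m) *\<^sub>R ?m)"
  have r: "r \<bullet> e1 = 0" "r \<bullet> e2 = 0" "?m \<bullet> r = 0"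
    using e mm me by (simp_all add: r_def inner_diff_left inner_diff_right inner_add_left inner_add_right
      inner_commute[of e2 e1] inner_commute[of _ x] dot_cross_self)
  have "cross3 ?m r = 0"
    using r Lagrange[of r e1 e2] by (subst cross_skew) simp
  then have "r = 0" using r norm_and_cross_eq_0[of ?m r] m by auto
  then show "x = (x \<bullet> e1) *\<^sub>R e1 + (x \<bullet> e2) *\<^sub>R e2 + (x \<bullet> ?m) *\<^sub>R ?m" by (simp add: r_def)
qed

section \<open>Orthonormal charts of planes\<close>

definition chart :: "real^3 \<Rightarrow> real^3 \<Rightarrow> real^3 \<Rightarrow> real^2 \<Rightarrow> real^3" where
  "chart c e1 e2 y = c + y$1 *\<^sub>R e1 + y$2 *\<^sub>R e2"

definition chart_inv :: "real^3 \<Rightarrow> real^3 \<Rightarrow> real^3 \<Rightarrow> real^3 \<Rightarrow> real^2" where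
  "chart_inv c e1 e2 x = (\<chi> i. (x - c) \<bullet> (if i = 1 then e1 else e2))"

locale orthonormal_chart =
  fixes c e1 e2 :: "real^3"
  assumes e: "norm e1 = 1" "norm e2 = 1" "e1 \<bullet> e2 = 0"
begin

abbreviation "h \<equiv> chart c e1 e2"
abbreviation "h' \<equiv> chart_inv c e1 e2"

lemma ee: "e1 \<bullet> e1 = 1" "e2 \<bullet> e2 = 1" "e1 \<bullet> e2 = 0" "e2 \<bullet> e1 = 0"
  using e by (simp_all add: norm_eq_1 inner_commute)

lemma chart_inv_chart [simp]: "h' (h y) = y"
  by (simp add: vec_eq_iff forall_2 chart_def chart_inv_def inner_add_left ee)

lemma inj_chart: "inj h"
  by (metis chart_inv_chart injI)

lemma range_chart: "range h = {x. cross3 e1 e2 \<bullet> x = cross3 e1 e2 \<bullet> c}"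
proof (intro equalityI subsetI)
  fix x assume "x \<in> range h"
  then show "x \<in> {x. cross3 e1 e2 \<bullet> x = cross3 e1 e2 \<bullet> c}"
    by (auto simp: chart_def inner_add_right dot_cross_self inner_commute)
next
  fix x assume "x \<in> {x. cross3 e1 e2 \<bullet> x = cross3 e1 e2 \<bullet> c}"
  then have "cross3 e1 e2 \<bullet> (x - c) = 0" by (simp add: inner_diff_right)
  then have "(x - c) \<bullet> cross3 e1 e2 = 0" by (subst inner_commute)
  then have "x - c = ((x - c) \<bullet> e1) *\<^sub>R e1 + ((x - c) \<bullet> e2) *\<^sub>R e2"
    using orthonormal_decomp(1)[OF e, of "x - c"] by simp
  then have "x = h (h' x)" by (simp add: chart_def chart_inv_def algebra_simps)
  then show "x \<in> range h" by blast
qed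

lemma chart_chart_inv: "x \<in> range h \<Longrightarrow> h (h' x) = x" by auto

lemma chart_normal:
  assumes F: "flat_face F n b" and sub: "F \<subseteq> range h"
  shows "cross3 e1 e2 = n \<or> cross3 e1 e2 = - n" and "range h = {x. n \<bullet> x = b}"
proof -
  show *: "cross3 e1 e2 = n \<or> cross3 e1 e2 = - n"
    using flat_face_normal_unique[OF F orthonormal_decomp(2)[OF e]] sub by (auto simp: range_chart)
  obtain x where x: "x \<in> F" using flat_face_nonempty[OF F] by auto
  then have "cross3 e1 e2 \<bullet> x = cross3 e1 e2 \<bullet> c" using sub by (auto simp: range_chart)
  then have "n \<bullet> c = b" using * flat_face_subset[OF F x] by auto
  then show "range h = {x. n \<bullet> x = b}" using * by (auto simp: range_chart)
qed

lemma chart_linear: "linear (\<lambda>y. h y - c)"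
  by (rule linearI) (auto simp: chart_def algebra_simps)

lemma continuous_chart: "continuous_on S h"
  unfolding chart_def[abs_def] by (intro continuous_intros)

lemma continuous_chart_inv: "continuous_on S h'"
  unfolding chart_inv_def[abs_def] by (intro continuous_intros)

lemma norm_chart_diff: "norm (h x - h y) = norm (x - y)"
proof -
  define v where "v = x - y"
  have "h x - h y = v$1 *\<^sub>R e1 + v$2 *\<^sub>R e2" by (simp add: v_def chart_def algebra_simps)
  moreover have "(v$1 *\<^sub>R e1 + v$2 *\<^sub>R e2) \<bullet> (v$1 *\<^sub>R e1 + v$2 *\<^sub>R e2) = v$1 * v$1 + v$2 * v$2"
    by (simp add: inner_add_left inner_add_right ee)
  moreover have "v \<bullet> v = v$1 * v$1 + v$2 * v$2"
    by (subst inner_vec_def) (simp add: sum_2)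
  ultimately have "(norm (h x - h y))\<^sup>2 = (norm (x - y))\<^sup>2"
    unfolding power2_norm_eq_inner by (simp add: v_def)
  then show ?thesis by (simp add: power2_eq_iff_nonneg)
qed

lemma compact_vimage: "compact F \<Longrightarrow> F \<subseteq> range h \<Longrightarrow> compact (h -` F)"
proof -
  assume F: "compact F" "F \<subseteq> range h"
  have "h -` F = h' ` F"
  proof (intro equalityI subsetI)
    show "y \<in> h' ` F" if "y \<in> h -` F" for y
      using that by (intro image_eqI[of _ _ "h y"]) auto
    show "y \<in> h -` F" if "y \<in> h' ` F" for y
      using that F by auto
  qed
  then show ?thesis using compact_continuous_image[OF continuous_chart_inv F(1)] by simp
qed

lemma convex_vimage: "convex F \<Longrightarrow> convex (h -` F)"
proof -
  assume "convex F"
  then have "convex ((\<lambda>y. h y - c) -` ((\<lambda>x. x - c) ` F))"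
    by (intro convex_linear_vimage[OF chart_linear] convex_translation_subtract)
  also have "(\<lambda>y. h y - c) -` ((\<lambda>x. x - c) ` F) = h -` F" by (auto simp: image_iff)
  finally show ?thesis .
qed

lemma chart_interior:
  assumes F: "flat_face F n b" "F \<subseteq> range h" and y: "y \<in> interior (h -` F)"
  shows "h y \<in> rel_interior F"
proof -
  obtain e where e: "e > 0" "ball y e \<subseteq> h -` F" using y by (auto simp: mem_interior)
  have "ball (h y) e \<inter> affine hull F \<subseteq> F"
  proof
    fix x assume x: "x \<in> ball (h y) e \<inter> affine hull F"
    then have "x \<in> range h" using chart_normal[OF F] F by (auto simp: flat_face_def)
    then obtain z where z: "x = h z" by auto
    then have "z \<in> ball y e" using x by (simp add: dist_norm norm_chart_diff)
    then show "x \<in> F" using e z by auto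
  qed
  then show ?thesis using e y interior_subset by (auto simp: mem_rel_interior_ball intro!: exI[of _ e])
qed

text \<open>A chart is an isometry onto the plane, so it maps interior parameters to the relative
  interior; the others lie on the frontier of a convex planar set, which is null.\<close>

lemma negligible_rel_frontier:
  assumes F: "flat_face F n b" "F \<subseteq> range h"
  shows "negligible {y \<in> h -` F. h y \<notin> rel_interior F}"
proof (rule negligible_subset)
  show "negligible (frontier (h -` F))"
    using F by (intro negligible_convex_frontier convex_vimage) (auto simp: flat_face_def)
  show "{y \<in> h -` F. h y \<notin> rel_interior F} \<subseteq> frontier (h -` F)"
    using chart_interior[OF F] closure_subset[of "h -` F"] by (auto simp: frontier_def)
qed

end

text \<open>The \<open>SOME\<close> in \<open>flat_chart\<close> yields nothing until a chart is
  exhibited: one centred at \<open>b *\<^sub>R n\<close>, with \<open>e1\<close> orthogonal to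
  \<open>n\<close> and \<open>e2 = cross3 n e1\<close>.\<close>

lemma flat_chart_exists:
  assumes F: "flat_face F n b"
  obtains c e1 e2 where "flat_chart F = chart c e1 e2" "orthonormal_chart e1 e2" "F \<subseteq> range (chart c e1 e2)"
proof -
  have n: "norm n = 1" using F by (simp add: flat_face_def)
  obtain a where a: "a \<noteq> 0" "orthogonal n a" using orthogonal_to_vector_exists[of n] by auto
  define e1 where "e1 = a /\<^sub>R norm a"
  have e1: "norm e1 = 1" "n \<bullet> e1 = 0" using a by (auto simp: e1_def orthogonal_def)
  define e2 where "e2 = cross3 n e1"
  have e2: "norm e2 = 1" "e1 \<bullet> e2 = 0" "n \<bullet> e2 = 0"
    using orthonormal_decomp(2)[OF n e1] by (auto simp: e2_def dot_cross_self)
  interpret orthonormal_chart "b *\<^sub>R n" e1 e2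
    using e1 e2 by unfold_locales auto
  have nm: "n = (n \<bullet> cross3 e1 e2) *\<^sub>R cross3 e1 e2"
    using orthonormal_decomp(1)[OF e1(1) e2(1,2), of n] e1 e2 by simp
  have "F \<subseteq> range h"
  proof
    fix x assume "x \<in> F"
    have "n \<bullet> n = 1" using n by (simp add: norm_eq_1)
    then have 0: "n \<bullet> (x - b *\<^sub>R n) = 0"
      using flat_face_subset[OF F \<open>x \<in> F\<close>] by (simp add: inner_diff_right)
    have "n \<bullet> cross3 e1 e2 \<noteq> 0" using nm n by (metis norm_zero scaleR_zero_left zero_neq_one)
    moreover have "(n \<bullet> cross3 e1 e2) * (cross3 e1 e2 \<bullet> (x - b *\<^sub>R n)) = 0"
      using 0 by (subst (asm) nm) simp
    ultimately show "x \<in> range h" by (simp add: range_chart inner_diff_right)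
  qed
  moreover have "\<exists>c e1 e2. norm e1 = 1 \<and> norm e2 = 1 \<and> e1 \<bullet> e2 = 0 \<and>
      h = (\<lambda>y. c + y$1 *\<^sub>R e1 + y$2 *\<^sub>R e2)"
    unfolding chart_def[abs_def] using e
    by (intro exI[of _ "b *\<^sub>R n"] exI[of _ e1] exI[of _ e2] conjI refl)
  ultimately have "\<exists>g :: real^2 \<Rightarrow> real^3. (\<exists>c e1 e2. norm e1 = 1 \<and> norm e2 = 1 \<and> e1 \<bullet> e2 = 0 \<and>
      g = (\<lambda>y. c + y$1 *\<^sub>R e1 + y$2 *\<^sub>R e2)) \<and> F \<subseteq> range g"
    by (intro exI[of _ h] conjI)
  from someI_ex[OF this, folded flat_chart_def]
  obtain c' f1 f2 where f: "norm f1 = 1" "norm f2 = 1" "f1 \<bullet> f2 = 0"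
    "flat_chart F = (\<lambda>y. c' + y$1 *\<^sub>R f1 + y$2 *\<^sub>R f2)" "F \<subseteq> range (flat_chart F)"
    by (elim conjE exE)
  have "flat_chart F = chart c' f1 f2" by (simp add: f(4) chart_def[abs_def])
  with f show thesis
    by (intro that[of c' f1 f2]) (simp_all add: orthonormal_chart_def)
qed

section \<open>Change of variables and independence of the chart\<close>

lemma absolutely_integrable_on_compact:
  fixes f :: "'a::euclidean_space \<Rightarrow> 'b::euclidean_space"
  assumes "compact S" "continuous_on S f"
  shows "f absolutely_integrable_on S"
proof -
  have *: "integrable lborel (\<lambda>x. indicator S x *\<^sub>R f x)"
    by (rule borel_integrable_compact[OF assms])
  then have "integrable lebesgue (\<lambda>x. indicator S x *\<^sub>R f x)"
    by (subst integrable_completion) auto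
  then show ?thesis by (simp add: set_integrable_def)
qed

text \<open>Real values are passed to the vector-valued rule as elements of
  \<open>real^1\<close>.\<close>

lemma change_of_variables_real:
  fixes f :: "real^'m::{finite,wellorder} \<Rightarrow> real" and g :: "real^'m::_ \<Rightarrow> real^'m::_"
  assumes S: "S \<in> sets lebesgue"
    and der: "\<And>x. x \<in> S \<Longrightarrow> (g has_derivative g' x) (at x within S)"
    and inj: "inj_on g S"
    and int: "(\<lambda>x. \<bar>det (matrix (g' x))\<bar> * f (g x)) absolutely_integrable_on S"
  shows "f absolutely_integrable_on (g ` S)"
    and "integral (g ` S) f = integral S (\<lambda>x. \<bar>det (matrix (g' x))\<bar> * f (g x))"
proof -
  have "(\<lambda>x. vec (f x) :: real^1) absolutely_integrable_on (g ` S) \<and>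
      integral (g ` S) (\<lambda>x. vec (f x) :: real^1) = vec (integral S (\<lambda>x. \<bar>det (matrix (g' x))\<bar> * f (g x)))"
    using int
    by (subst has_absolute_integral_change_of_variables[OF S der inj, symmetric])
      (auto simp: absolutely_integrable_on_1_iff integral_on_1_eq)
  then show "f absolutely_integrable_on (g ` S)"
    and "integral (g ` S) f = integral S (\<lambda>x. \<bar>det (matrix (g' x))\<bar> * f (g x))"
    by (auto simp: absolutely_integrable_on_1_iff integral_on_1_eq vec_eq_iff)
qed

text \<open>Both charts parametrize the same plane isometrically, so the transition map is a
  translation of an orthogonal map \<open>L\<close>, whose determinant has absolute value 1.\<close>

lemma chart_change:
  fixes g :: "real^3 \<Rightarrow> real"
  assumes F: "flat_face F n b" and e: "orthonormal_chart e1 e2" and f: "orthonormal_chart f1 f2"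
    and sub: "F \<subseteq> range (chart c e1 e2)" "F \<subseteq> range (chart d f1 f2)" and g: "continuous_on F g"
  shows "(LINT y : chart c e1 e2 -` F | lebesgue. g (chart c e1 e2 y)) =
    (LINT y : chart d f1 f2 -` F | lebesgue. g (chart d f1 f2 y))"
proof -
  interpret A: orthonormal_chart c e1 e2 by (rule e)
  interpret B: orthonormal_chart d f1 f2 by (rule f)
  have range: "range A.h = range B.h"
    using A.chart_normal(2)[OF F sub(1)] B.chart_normal(2)[OF F sub(2)] by simp
  define \<phi> where "\<phi> y = B.h' (A.h y)" for y
  have B\<phi>: "B.h (\<phi> y) = A.h y" for y
    unfolding \<phi>_def by (rule B.chart_chart_inv) (use range in blast)
  define L where "L y = \<phi> y - \<phi> 0" for y
  have iso: "norm (\<phi> x - \<phi> y) = norm (x - y)" for x y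
    by (metis A.norm_chart_diff B.norm_chart_diff B\<phi>)
  have "linear L"
    by (rule linearI) (simp_all add: L_def \<phi>_def chart_inv_def chart_def vec_eq_iff inner_add_left
      inner_diff_left algebra_simps)
  moreover have "norm (L y) = norm y" for y using iso[of y 0] by (simp add: L_def)
  ultimately have L: "orthogonal_transformation L" by (simp add: orthogonal_transformation)
  have \<phi>L: "\<phi> = (\<lambda>y. \<phi> 0 + L y)" by (simp add: L_def)
  have der: "(\<phi> has_derivative L) (at y within S)" for y S
    by (subst \<phi>L) (auto intro!: derivative_eq_intros linear_imp_has_derivative \<open>linear L\<close>)
  have inj: "inj_on \<phi> S" for S
    using iso by (intro inj_onI) (metis eq_iff_diff_eq_0 norm_eq_zero)
  have image: "\<phi> ` (A.h -` F) = B.h -` F"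
  proof (intro equalityI subsetI)
    show "z \<in> B.h -` F" if "z \<in> \<phi> ` (A.h -` F)" for z using that B\<phi> by auto
    show "z \<in> \<phi> ` (A.h -` F)" if z: "z \<in> B.h -` F" for z
    proof -
      obtain y where y: "B.h z = A.h y" using range by (metis rangeE rangeI)
      then have "z = \<phi> y" by (metis B.chart_inv_chart \<phi>_def)
      then show ?thesis using z y by auto
    qed
  qed
  have cA: "compact (A.h -` F)" using A.compact_vimage F sub by (simp add: flat_face_def)
  have cB: "compact (B.h -` F)" using B.compact_vimage F sub by (simp add: flat_face_def)
  have gA: "(\<lambda>y. g (A.h y)) absolutely_integrable_on (A.h -` F)"
    by (intro absolutely_integrable_on_compact cA continuous_on_compose2[OF g A.continuous_chart]) auto
  have gB: "(\<lambda>y. g (B.h y)) absolutely_integrable_on (B.h -` F)"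
    by (intro absolutely_integrable_on_compact cB continuous_on_compose2[OF g B.continuous_chart]) auto
  have "A.h -` F \<in> sets lebesgue" using cA by (simp add: borel_compact)
  from change_of_variables_real(2)[OF this der inj, of "\<lambda>y. g (B.h y)"] gA
  have "integral (B.h -` F) (\<lambda>y. g (B.h y)) = integral (A.h -` F) (\<lambda>y. g (A.h y))"
    by (simp add: image B\<phi> L)
  then show ?thesis
    using set_lebesgue_integral_eq_integral(2)[OF gA] set_lebesgue_integral_eq_integral(2)[OF gB] by simp
qed

definition surface_integrable :: "(real^3) set \<Rightarrow> (real^3 \<Rightarrow> real) \<Rightarrow> bool" where
  "surface_integrable F f \<longleftrightarrow> (\<lambda>y. f (flat_chart F y)) absolutely_integrable_on (flat_chart F -` F)"

lemma surface_integrable_continuous: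
  assumes F: "flat_face F n b" and g: "continuous_on F g"
  shows "surface_integrable F g"
proof -
  obtain c e1 e2 where *: "flat_chart F = chart c e1 e2" "orthonormal_chart e1 e2" "F \<subseteq> range (chart c e1 e2)"
    using flat_chart_exists[OF F] by metis
  interpret orthonormal_chart c e1 e2 by (rule *)
  have "compact (h -` F)" using compact_vimage F * by (simp add: flat_face_def)
  then show ?thesis unfolding surface_integrable_def *
    by (intro absolutely_integrable_on_compact continuous_on_compose2[OF g continuous_chart]) auto
qed

text \<open>The entry point for traces: they are computed on the relative interior only, which omits
  a null set of parameters.\<close>

lemma surface_integral_spike:
  assumes F: "flat_face F n b" and g: "surface_integrable F g"
    and eq: "\<And>x. x \<in> rel_interior F \<Longrightarrow> f x = g x"
  shows "surface_integrable F f" "surface_integral F f = surface_integral F g"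
proof -
  obtain c e1 e2 where *: "flat_chart F = chart c e1 e2" "orthonormal_chart e1 e2" "F \<subseteq> range (chart c e1 e2)"
    using flat_chart_exists[OF F] by metis
  interpret orthonormal_chart c e1 e2 by (rule *)
  let ?N = "{y \<in> h -` F. h y \<notin> rel_interior F}"
  have neg: "negligible ?N" by (rule negligible_rel_frontier[OF F *(3)])
  have eq': "f (h y) = g (h y)" if "y \<in> h -` F - ?N" for y using eq that by auto
  have gi: "(\<lambda>y. g (h y)) absolutely_integrable_on (h -` F)"
    using g by (simp add: surface_integrable_def *)
  then have fi: "(\<lambda>y. f (h y)) absolutely_integrable_on (h -` F)"
    using neg eq' by (rule absolutely_integrable_spike)
  then show "surface_integrable F f" by (simp add: surface_integrable_def *)
  have "integral (h -` F) (\<lambda>y. f (h y)) = integral (h -` F) (\<lambda>y. g (h y))"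
    by (rule integral_spike[OF neg]) (use eq' in auto)
  then show "surface_integral F f = surface_integral F g"
    by (simp add: surface_integral_def * set_lebesgue_integral_eq_integral(2)[OF gi]
        set_lebesgue_integral_eq_integral(2)[OF fi])
qed

lemma surface_integral_add:
  assumes "surface_integrable F f" "surface_integrable F g"
  shows "surface_integral F (\<lambda>x. f x + g x) = surface_integral F f + surface_integral F g"
  using assms unfolding surface_integral_def surface_integrable_def by (rule set_integral_add)

lemma surface_integral_cmult: "surface_integral F (\<lambda>x. c * f x) = c * surface_integral F f"
  unfolding surface_integral_def by simp

text \<open>The chart selected for the translated face is unrelated to that of \<open>F\<close>.
  Shifting the chart of \<open>F\<close> by \<open>a\<close> gives another chart of the translated
  face, and \<open>chart_change\<close> compares the two for the continuous representative
  \<open>g\<close>.\<close>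

lemma surface_integral_translate:
  assumes F: "flat_face F n b" and g: "continuous_on ((+) a ` F) g"
    and f: "\<And>x. x \<in> rel_interior ((+) a ` F) \<Longrightarrow> f x = g x"
  shows "surface_integral ((+) a ` F) f = surface_integral F (\<lambda>x. f (x + a))"
proof -
  have Fa: "flat_face ((+) a ` F) n (b + n \<bullet> a)"
    unfolding flat_face_def
  proof (intro conjI)
    show "compact ((+) a ` F)" "convex ((+) a ` F)" "norm n = 1"
      using F compact_translation[of F a] convex_translation[of F a] by (auto simp: flat_face_def)
    have "affine hull ((+) a ` F) = (+) a ` {x. n \<bullet> x = b}"
      using F affine_hull_translation[of a F] by (simp add: flat_face_def)
    also have "\<dots> = {x. n \<bullet> x = b + n \<bullet> a}"
    proof (intro equalityI subsetI)
      show "x \<in> (+) a ` {x. n \<bullet> x = b}" if "x \<in> {x. n \<bullet> x = b + n \<bullet> a}" for x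
        using that by (intro image_eqI[of _ _ "x - a"]) (auto simp: inner_diff_right)
    qed (auto simp: inner_add_right)
    finally show "affine hull ((+) a ` F) = {x. n \<bullet> x = b + n \<bullet> a}" .
  qed
  obtain c e1 e2 where *: "flat_chart F = chart c e1 e2" "orthonormal_chart e1 e2" "F \<subseteq> range (chart c e1 e2)"
    using flat_chart_exists[OF F] by metis
  obtain d f1 f2 where **: "flat_chart ((+) a ` F) = chart d f1 f2" "orthonormal_chart f1 f2"
    "(+) a ` F \<subseteq> range (chart d f1 f2)"
    using flat_chart_exists[OF Fa] by metis
  have shift: "chart (c + a) e1 e2 y = a + chart c e1 e2 y" for y by (simp add: chart_def)
  have vim: "chart (c + a) e1 e2 -` ((+) a ` F) = chart c e1 e2 -` F"
    by (auto simp: shift)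
  have sub: "(+) a ` F \<subseteq> range (chart (c + a) e1 e2)"
    using *(3) by (fastforce simp: shift)
  have "surface_integral ((+) a ` F) f = surface_integral ((+) a ` F) g"
    by (rule surface_integral_spike(2)[OF Fa surface_integrable_continuous[OF Fa g] f])
  also have "\<dots> = (LINT y : chart (c + a) e1 e2 -` ((+) a ` F) | lebesgue. g (chart (c + a) e1 e2 y))"
    unfolding surface_integral_def **(1) by (rule chart_change[OF Fa **(2) *(2) **(3) sub g])
  also have "\<dots> = surface_integral F (\<lambda>x. g (x + a))"
    unfolding surface_integral_def vim *(1) shift by (simp add: add.commute)
  also have "\<dots> = surface_integral F (\<lambda>x. f (x + a))"
  proof (rule surface_integral_spike(2)[OF F, symmetric])
    show "surface_integrable F (\<lambda>x. g (x + a))"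
      by (rule surface_integrable_continuous[OF F])
        (auto intro!: continuous_on_compose2[OF g] continuous_intros simp: add.commute)
    show "f (x + a) = g (x + a)" if "x \<in> rel_interior F" for x
    proof (rule f)
      have "rel_interior ((+) a ` F) = (+) a ` rel_interior F" by (rule rel_interior_translation)
      moreover have "a + x \<in> (+) a ` rel_interior F" using that by (rule imageI)
      ultimately show "x + a \<in> rel_interior ((+) a ` F)" by (simp only: add.commute)
    qed
  qed
  finally show ?thesis .
qed

section \<open>The divergence theorem on a polytope\<close>

text \<open>Fubini works on the product type \<open>(real^2) \<times> real\<close>, the Jacobian
  rule on \<open>real^3\<close>; this map links them.\<close>

definition join_coords :: "(real^2) \<times> real \<Rightarrow> real^3" where
  "join_coords p = (\<chi> i. if i = 1 then fst p $ 1 else if i = 2 then fst p $ 2 else snd p)"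

definition planar_part :: "real^3 \<Rightarrow> real^2" where
  "planar_part u = (\<chi> i. if i = 1 then u$1 else u$2)"

lemma join_coords_simps [simp]:
  "join_coords (y, s) $ 1 = y$1" "join_coords (y, s) $ 2 = y$2" "join_coords (y, s) $ 3 = s"
  "planar_part (join_coords (y, s)) = y"
  by (auto simp: join_coords_def planar_part_def vec_eq_iff forall_2)

lemma continuous_join_coords: "continuous_on S join_coords"
proof -
  have "continuous_on S (\<lambda>p :: (real^2) \<times> real. if i = 1 then fst p $ 1 else if i = 2 then fst p $ 2 else snd p)"
    for i :: 3
    by (cases "i = 1"; cases "i = 2") (simp_all, (intro continuous_intros)+)
  then show ?thesis
    unfolding join_coords_def[abs_def] by (intro continuous_on_vec_lambda)
qed

lemma continuous_planar_part: "continuous_on S planar_part"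
proof -
  have "continuous_on S (\<lambda>u::real^3. if i = 1 then u$1 else u$2)" for i :: 2
    by (cases "i = 1") (simp_all, (intro continuous_intros)+)
  then show ?thesis unfolding planar_part_def[abs_def] by (intro continuous_on_vec_lambda)
qed

lemma prod_Basis_cart:
  fixes f :: "real^'n \<Rightarrow> 'a::comm_monoid_mult"
  shows "(\<Prod>b\<in>Basis. f b) = (\<Prod>i\<in>UNIV. f (axis i 1))"
proof -
  have "Basis = range (\<lambda>i. axis i (1::real) :: real^'n)" by (auto simp: Basis_vec_def)
  moreover have "inj (\<lambda>i. axis i (1::real) :: real^'n)" by (auto simp: inj_def axis_eq_axis)
  ultimately show ?thesis using prod.reindex[of "\<lambda>i. axis i (1::real) :: real^'n" UNIV f] by simp
qed

text \<open>Lebesgue measure is determined by its values on boxes, and a box pulls back to a planar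
  box times an interval.\<close>

lemma lborel_join_coords: "distr lborel borel join_coords = lborel"
proof (rule lborel_eqI[symmetric])
  have meas: "join_coords \<in> borel_measurable lborel"
    using borel_measurable_continuous_onI[OF continuous_join_coords] by simp
  fix l u :: "real^3" assume "\<And>b. b \<in> Basis \<Longrightarrow> l \<bullet> b \<le> u \<bullet> b"
  from this[of "axis _ 1"] have lu: "l$i \<le> u$i" for i by (auto simp: inner_axis Basis_vec_def)
  have "emeasure (distr lborel borel join_coords) (box l u) = emeasure lborel (join_coords -` box l u)"
    using meas by (subst emeasure_distr) auto
  also have "join_coords -` box l u = box (planar_part l) (planar_part u) \<times> {l$3<..<u$3}"
    by (auto simp: mem_box_cart forall_2 forall_3 planar_part_def)
  also have "emeasure lborel \<dots> = emeasure lborel (box (planar_part l) (planar_part u)) * emeasure lborel {l$3<..<u$3}"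
    by (subst lborel_prod[symmetric], rule lborel.emeasure_pair_measure_Times) auto
  also have "\<dots> = ennreal (\<Prod>b\<in>Basis. (u - l) \<bullet> b)"
  proof -
    have "planar_part l \<bullet> b \<le> planar_part u \<bullet> b" if "b \<in> Basis" for b
      using that lu by (auto simp: Basis_vec_def inner_axis planar_part_def)
    then have 1: "emeasure lborel (box (planar_part l) (planar_part u)) = ennreal ((u$1 - l$1) * (u$2 - l$2))"
      by (subst emeasure_lborel_box) (simp_all add: prod_Basis_cart inner_axis UNIV_2 planar_part_def)
    have 2: "emeasure lborel {l$3<..<u$3} = ennreal (u$3 - l$3)" using lu by simp
    have 3: "(\<Prod>b\<in>Basis. (u - l) \<bullet> b) = (u$1 - l$1) * (u$2 - l$2) * (u$3 - l$3)"
      unfolding prod_Basis_cart inner_axis UNIV_3 by (simp add: mult.assoc)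
    show ?thesis
      unfolding 1 2 3 by (rule ennreal_mult[symmetric]) (use lu in auto)
  qed
  finally show "emeasure (distr lborel borel join_coords) (box l u) = (\<Prod>b\<in>Basis. (u - l) \<bullet> b)" .
qed simp

text \<open>The apex is left out because at \<open>s = 0\<close> the parametrization collapses the
  whole base to \<open>z\<close> and would not be injective.\<close>

definition cone_over :: "real^3 \<Rightarrow> (real^3) set \<Rightarrow> (real^3) set" where
  "cone_over z F = (\<lambda>(s, x). z + s *\<^sub>R (x - z)) ` ({0<..1} \<times> F)"

text \<open>Fubini on the cylinder over \<open>S\<close>. The end \<open>s = 0\<close> is included
  so that the cylinder is compact and integrability follows from continuity.\<close>

lemma integral_cone_coords:
  fixes q :: "real^2 \<Rightarrow> real \<Rightarrow> real"
  assumes S: "compact S" and q: "continuous_on (S \<times> {0..1}) (\<lambda>(y, s). q y s)"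
  shows "(\<lambda>u. q (planar_part u) (u$3)) absolutely_integrable_on {u. planar_part u \<in> S \<and> 0 \<le> u$3 \<and> u$3 \<le> 1}"
    and "integral {u. planar_part u \<in> S \<and> 0 \<le> u$3 \<and> u$3 \<le> 1} (\<lambda>u. q (planar_part u) (u$3)) =
      (\<integral>y. indicator S y * (\<integral>s. q y s * indicator {0..1} s \<partial>lborel) \<partial>lborel)"
    and "compact {u. planar_part u \<in> S \<and> 0 \<le> u$3 \<and> u$3 \<le> 1}"
proof -
  let ?A = "{u :: real^3. planar_part u \<in> S \<and> 0 \<le> u$3 \<and> u$3 \<le> 1}"
  let ?q = "\<lambda>u :: real^3. q (planar_part u) (u$3)"
  have A: "?A = join_coords ` (S \<times> {0..1})"
  proof (intro equalityI subsetI)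
    fix u assume u: "u \<in> ?A"
    have "u = join_coords (planar_part u, u$3)"
      by (auto simp: vec_eq_iff forall_3) (auto simp: planar_part_def)
    then show "u \<in> join_coords ` (S \<times> {0..1})" using u by (intro image_eqI[of _ _ "(planar_part u, u$3)"]) auto
  qed auto
  show compact: "compact ?A"
    unfolding A by (intro compact_continuous_image continuous_join_coords compact_Times S) auto
  have cont: "continuous_on ?A ?q"
  proof -
    have "continuous_on ?A (\<lambda>u. (planar_part u, u$3))" by (intro continuous_intros continuous_planar_part)
    moreover have "(\<lambda>u. (planar_part u, u$3)) ` ?A \<subseteq> S \<times> {0..1}" by auto
    ultimately show ?thesis using continuous_on_compose2[OF q] by fastforce
  qed
  show ai: "?q absolutely_integrable_on ?A"
    by (rule absolutely_integrable_on_compact[OF compact cont])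
  have int: "integrable lborel (\<lambda>u. indicator ?A u *\<^sub>R ?q u)"
    by (rule borel_integrable_compact[OF compact cont])
  then have meas: "(\<lambda>u. indicator ?A u *\<^sub>R ?q u) \<in> borel_measurable borel"
    using borel_measurable_integrable[OF int] by simp
  have "integral ?A ?q = (\<integral>u. indicator ?A u *\<^sub>R ?q u \<partial>lebesgue)"
    using set_lebesgue_integral_eq_integral(2)[OF ai] by (simp add: set_lebesgue_integral_def)
  also have "\<dots> = (\<integral>u. indicator ?A u *\<^sub>R ?q u \<partial>lborel)"
    using int by (intro integral_completion) auto
  also have "\<dots> = (\<integral>u. indicator ?A u *\<^sub>R ?q u \<partial>distr lborel borel join_coords)"
    by (simp add: lborel_join_coords)
  also have "\<dots> = (\<integral>p. indicator ?A (join_coords p) *\<^sub>R ?q (join_coords p) \<partial>lborel)"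
  proof (rule integral_distr)
    show "join_coords \<in> lborel \<rightarrow>\<^sub>M borel"
      using borel_measurable_continuous_onI[OF continuous_join_coords] by simp
    show "(\<lambda>u. indicator ?A u *\<^sub>R ?q u) \<in> borel_measurable borel"
      by (rule meas)
  qed
  also have "\<dots> = (\<integral>p. indicator ?A (join_coords p) *\<^sub>R ?q (join_coords p) \<partial>(lborel \<Otimes>\<^sub>M lborel))"
    by (simp add: lborel_prod)
  also have "\<dots> = (\<integral>y. (\<integral>s. indicator ?A (join_coords (y, s)) *\<^sub>R ?q (join_coords (y, s)) \<partial>lborel) \<partial>lborel)"
  proof (rule lborel_pair.integral_fst'[symmetric])
    have "integrable (distr lborel borel join_coords) (\<lambda>u. indicator ?A u *\<^sub>R ?q u)"
      using int by (simp add: lborel_join_coords)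
    then have "integrable lborel (\<lambda>p. indicator ?A (join_coords p) *\<^sub>R ?q (join_coords p))"
      using borel_measurable_continuous_onI[OF continuous_join_coords] meas by (subst (asm) integrable_distr_eq) simp_all
    then show "integrable (lborel \<Otimes>\<^sub>M lborel) (\<lambda>p. indicator ?A (join_coords p) *\<^sub>R ?q (join_coords p))"
      by (simp add: lborel_prod)
  qed
  also have "\<dots> = (\<integral>y. indicator S y * (\<integral>s. q y s * indicator {0..1} s \<partial>lborel) \<partial>lborel)"
  proof (intro Bochner_Integration.integral_cong refl)
    fix y
    have "(\<integral>s. indicator ?A (join_coords (y, s)) *\<^sub>R ?q (join_coords (y, s)) \<partial>lborel) =
        (\<integral>s. indicator S y * (q y s * indicator {0..1} s) \<partial>lborel)"
      by (intro Bochner_Integration.integral_cong refl) (auto simp: indicator_def)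
    then show "(\<integral>s. indicator ?A (join_coords (y, s)) *\<^sub>R ?q (join_coords (y, s)) \<partial>lborel) =
        indicator S y * (\<integral>s. q y s * indicator {0..1} s \<partial>lborel)"
      by simp
  qed
  finally show "integral ?A ?q = (\<integral>y. indicator S y * (\<integral>s. q y s * indicator {0..1} s \<partial>lborel) \<partial>lborel)" .
qed

text \<open>
  In the coordinates \<open>(y, s) \<mapsto> z + s (h y - z)\<close> of the cone, the Jacobian turns the integrand
  \<open>3 f + (x - z) \<bullet> \<nabla>f\<close> into the \<open>s\<close>-derivative of \<open>s\<^sup>3 f (z + s (h y - z))\<close>.
\<close>

lemma integral_cone:
  assumes F: "flat_face F n b" and z: "n \<bullet> z < b" and f: "real_polynomial_function f"
  shows "((\<lambda>x. 3 * f x + grad f x \<bullet> (x - z)) has_integral (b - n \<bullet> z) * surface_integral F f) (cone_over z F)"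
    and "(\<lambda>x. 3 * f x + grad f x \<bullet> (x - z)) absolutely_integrable_on cone_over z F"
proof -
  obtain c e1 e2 where *: "flat_chart F = chart c e1 e2" "orthonormal_chart e1 e2" "F \<subseteq> range (chart c e1 e2)"
    using flat_chart_exists[OF F] by metis
  interpret orthonormal_chart c e1 e2 by (rule *)
  let ?P = "\<lambda>x. 3 * f x + grad f x \<bullet> (x - z)"
  \<comment> \<open>As \<open>n\<close> is a unit vector, this is the distance from the apex to the
    plane of the base.\<close>
  define d where "d = b - n \<bullet> z"
  have d: "d > 0" using z by (simp add: d_def)
  have cf: "continuous_on B f" for B using f by (simp add: continuous_on_polymonial_function real_polynomial_function_eq)
  have cg: "continuous_on B (grad f)" for B using f by (simp add: continuous_on_polymonial_function polynomial_grad)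
  have cP: "continuous_on B ?P" for B by (intro continuous_intros cf cg)
  define S where "S = h -` F"
  have S: "compact S" using compact_vimage F * by (simp add: flat_face_def S_def)
  have nh: "n \<bullet> h y = b" if "y \<in> S" for y using flat_face_subset[OF F] that by (simp add: S_def)
  \<comment> \<open>The integrand in cone coordinates, multiplied by the Jacobian
    \<open>d * s\<^sup>2\<close>.\<close>
  define q where "q y s = d * (s\<^sup>2 * ?P (z + s *\<^sub>R (h y - z)))" for y s
  define A where "A = {u. planar_part u \<in> S \<and> 0 \<le> u$3 \<and> u$3 \<le> 1}"
  define A' where "A' = {u. planar_part u \<in> S \<and> 0 < u$3 \<and> u$3 \<le> 1}"
  have cq: "continuous_on (S \<times> {0..1}) (\<lambda>(y, s). q y s)"
    unfolding q_def[abs_def] case_prod_beta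
    by (intro continuous_intros continuous_on_compose2[OF cP] continuous_on_compose2[OF continuous_chart]) auto
  note q = integral_cone_coords[OF S cq, folded A_def]
  have inner: "(\<integral>s. q y s * indicator {0..1} s \<partial>lborel) = d * f (h y)" for y
  proof -
    let ?g = "\<lambda>s. z + s *\<^sub>R (h y - z)"
    have "(\<integral>s. q y s * indicator {0..1} s \<partial>lborel) =
        d * (1 ^ 3 * f (?g 1)) - d * (0 ^ 3 * f (?g 0))"
    proof (rule integral_FTC_Icc_real)
      fix s :: real
      have "((\<lambda>s. f (?g s)) has_derivative (\<lambda>t. grad f (?g s) \<bullet> (t *\<^sub>R (h y - z)))) (at s)"
        by (rule has_derivative_compose[of ?g "\<lambda>t. t *\<^sub>R (h y - z)" s UNIV f])
          (auto intro!: derivative_eq_intros polynomial_grad(2)[OF f])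
      then have 1: "((\<lambda>s. f (?g s)) has_real_derivative (grad f (?g s) \<bullet> (h y - z))) (at s)"
        by (simp add: has_field_derivative_def mult.commute[of _ "grad f (?g s) \<bullet> (h y - z)"])
      have "((\<lambda>s. s ^ 3 * f (?g s)) has_real_derivative
          (3 * s\<^sup>2 * f (?g s) + (grad f (?g s) \<bullet> (h y - z)) * s ^ 3)) (at s)"
        using DERIV_mult[OF DERIV_pow[of 3 s UNIV] 1] by simp
      moreover have "q y s = d * (3 * s\<^sup>2 * f (?g s) + (grad f (?g s) \<bullet> (h y - z)) * s ^ 3)"
        by (simp add: q_def power2_eq_square power3_eq_cube distrib_left)
      ultimately show "((\<lambda>s. d * (s ^ 3 * f (?g s))) has_real_derivative q y s) (at s)"
        by (simp only: DERIV_cmult)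
      show "isCont (q y) s"
      proof -
        have "continuous_on UNIV (\<lambda>s. ?P (?g s))"
          by (rule continuous_on_compose2[OF cP[of UNIV]]) (intro continuous_intros, rule subset_UNIV)
        then have "continuous_on UNIV (q y)"
          unfolding q_def[abs_def]
          by (intro continuous_on_mult_left continuous_on_mult continuous_on_power continuous_on_id)
        then show ?thesis by (simp add: continuous_on_eq_continuous_at)
      qed
    qed simp
    then show ?thesis by simp
  qed
  have IA: "integral A (\<lambda>u. q (planar_part u) (u$3)) = d * surface_integral F f"
  proof -
    have "integrable lborel (\<lambda>y. indicator S y *\<^sub>R f (h y))"
      by (intro borel_integrable_compact S continuous_on_compose2[OF cf continuous_chart]) auto
    then have m: "(\<lambda>y. indicator S y *\<^sub>R f (h y)) \<in> borel_measurable lborel" by auto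
    have "integral A (\<lambda>u. q (planar_part u) (u$3)) = (\<integral>y. d * (indicator S y *\<^sub>R f (h y)) \<partial>lborel)"
      unfolding q(2) inner by (simp add: mult.left_commute)
    also have "\<dots> = d * (\<integral>y. indicator S y *\<^sub>R f (h y) \<partial>lebesgue)"
      using integral_completion[OF m] by simp
    finally show ?thesis by (simp add: surface_integral_def set_lebesgue_integral_def * S_def)
  qed
  \<comment> \<open>The two domains differ by the collapsed slice \<open>s = 0\<close>, where the
    factor \<open>s\<^sup>2\<close> annihilates \<open>q\<close>. Compactness is used on
    \<open>A\<close>, injectivity on \<open>A'\<close>.\<close>
  have spike: "negligible {u \<in> A - A'. q (planar_part u) (u$3) \<noteq> 0}" "negligible {u \<in> A' - A. q (planar_part u) (u$3) \<noteq> 0}"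
  proof -
    have e: "{u \<in> A - A'. q (planar_part u) (u$3) \<noteq> 0} = {}" "{u \<in> A' - A. q (planar_part u) (u$3) \<noteq> 0} = {}"
      by (auto simp: A_def A'_def q_def)
    show "negligible {u \<in> A - A'. q (planar_part u) (u$3) \<noteq> 0}" unfolding e by simp
    show "negligible {u \<in> A' - A. q (planar_part u) (u$3) \<noteq> 0}" unfolding e by simp
  qed
  have q': "(\<lambda>u. q (planar_part u) (u$3)) absolutely_integrable_on A'"
    by (rule absolutely_integrable_spike_set[OF q(1) spike])
  have IA': "integral A' (\<lambda>u. q (planar_part u) (u$3)) = d * surface_integral F f"
    unfolding IA[symmetric] by (rule integral_spike_set[symmetric, OF spike])
  define G where "G u = z + u$3 *\<^sub>R (h (planar_part u) - z)" for u
  define G' where "G' u v = v$3 *\<^sub>R (h (planar_part u) - z) + u$3 *\<^sub>R (v$1 *\<^sub>R e1 + v$2 *\<^sub>R e2)" for u v :: "real^3"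
  have pl: "h (planar_part u) = c + u$1 *\<^sub>R e1 + u$2 *\<^sub>R e2" for u by (simp add: chart_def planar_part_def)
  have der: "(G has_derivative G' u) (at u within B)" for u B
    unfolding G_def[abs_def] G'_def[abs_def] pl
    by (auto intro!: derivative_eq_intros bounded_linear.has_derivative[OF bounded_linear_vec_nth] simp: algebra_simps)
  have det: "\<bar>det (matrix (G' u))\<bar> = (u$3)\<^sup>2 * d" if "planar_part u \<in> S" for u
  proof -
    define w where "w = h (planar_part u) - z"
    \<comment> \<open>The columns of \<open>G'\<close> are \<open>e1\<close> and \<open>e2\<close>,
      each scaled by \<open>u$3\<close>, and \<open>w\<close>; the determinant is a triple product.
      Up to sign \<open>cross3 e1 e2\<close> is \<open>n\<close>, so it reads off the height
      \<open>d\<close>.\<close>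
    have "det (matrix (G' u)) = (u$3)\<^sup>2 * (cross3 e1 e2 \<bullet> w)"
      unfolding det_3 matrix_def G'_def w_def[symmetric]
      by (simp add: axis_def cross3_def inner_vec_def sum_3 vector_3 power2_eq_square) (simp add: algebra_simps)
    moreover have "n \<bullet> w = d" using nh[OF that] by (simp add: w_def d_def inner_diff_right)
    then have "\<bar>cross3 e1 e2 \<bullet> w\<bar> = d"
      using chart_normal(1)[OF F *(3)] d by auto
    ultimately show ?thesis by (simp add: abs_mult)
  qed
  have inj: "inj_on G A'"
  proof (rule inj_onI)
    fix u v assume u: "u \<in> A'" and v: "v \<in> A'" and eq: "G u = G v"
    \<comment> \<open>The height relative to the apex recovers the scale, and since the scale is
      positive the base point is then determined too.\<close>
    have "n \<bullet> (G u - z) = u$3 * d" if "u \<in> A'" for u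
      using nh[of "planar_part u"] that by (simp add: G_def A'_def d_def inner_diff_right)
    from this[OF u] this[OF v] eq d have 3: "u$3 = v$3" by simp
    moreover have "u$3 \<noteq> 0" using u by (simp add: A'_def)
    ultimately have "h (planar_part u) = h (planar_part v)" using eq by (simp add: G_def)
    then have "planar_part u = planar_part v" using inj_chart by (simp add: inj_eq)
    with 3 show "u = v" by (simp add: vec_eq_iff forall_3 forall_2 planar_part_def)
  qed
  have image: "G ` A' = cone_over z F"
  proof (intro equalityI subsetI)
    fix x assume "x \<in> G ` A'"
    then show "x \<in> cone_over z F" by (force simp: cone_over_def G_def A'_def S_def)
  next
    fix x assume "x \<in> cone_over z F"
    then obtain s w where sw: "0 < s" "s \<le> 1" "w \<in> F" "x = z + s *\<^sub>R (w - z)" by (auto simp: cone_over_def)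
    obtain y where y: "w = h y" using sw *(3) by auto
    then show "x \<in> G ` A'"
      using sw by (intro image_eqI[of _ _ "join_coords (y, s)"]) (auto simp: G_def A'_def S_def)
  qed
  have "A' \<in> sets lebesgue"
  proof -
    have "A' = A - {u. u$3 = 0}" by (auto simp: A_def A'_def)
    moreover have "closed {u :: real^3. u$3 = 0}" by (intro closed_Collect_eq continuous_intros)
    ultimately show ?thesis using q(3) by (auto simp: borel_compact borel_closed)
  qed
  note cov = change_of_variables_real[OF this der inj, of ?P, unfolded image]
  have qP: "\<bar>det (matrix (G' u))\<bar> * ?P (G u) = q (planar_part u) (u$3)" if "u \<in> A'" for u
    using det[of u] that by (simp add: q_def G_def A'_def algebra_simps)
  have "(\<lambda>u. \<bar>det (matrix (G' u))\<bar> * ?P (G u)) absolutely_integrable_on A'"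
    using q' by (rule absolutely_integrable_spike[OF _ negligible_empty]) (use qP in auto)
  note cov = cov[OF this]
  have "integral A' (\<lambda>u. \<bar>det (matrix (G' u))\<bar> * ?P (G u)) = d * surface_integral F f"
    unfolding IA'[symmetric] by (rule integral_cong) (rule qP)
  then show "(?P has_integral (b - n \<bullet> z) * surface_integral F f) (cone_over z F)"
    using cov(2) set_lebesgue_integral_eq_integral(1)[OF cov(1)] by (simp add: has_integral_iff d_def)
  show "?P absolutely_integrable_on cone_over z F" by (rule cov(1))
qed

section \<open>Decomposition of a polytope into cones over its facets\<close>

locale polytope_cell =
  fixes K :: "(real^3) set"
  assumes polytope: "polytope K" and interior_nonempty: "interior K \<noteq> {}"
begin

lemma convex: "convex K" and compact: "compact K"
  using polytope polytope_imp_convex polytope_imp_compact by auto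

lemma facet_face:
  assumes "F facet_of K"
  shows "F face_of K" "F \<subseteq> K" "aff_dim F = 2" "F \<inter> interior K = {}"
proof -
  show "F face_of K" using assms by (rule facet_of_imp_face_of)
  then show "F \<subseteq> K" by (rule face_of_imp_subset)
  show dim: "aff_dim F = 2" using assms aff_dim_nonempty_interior[OF interior_nonempty] by (simp add: facet_of_def)
  then have "F \<noteq> K" using aff_dim_nonempty_interior[OF interior_nonempty] by auto
  then show "F \<inter> interior K = {}" by (rule face_of_disjoint_interior[OF \<open>F face_of K\<close>])
qed

lemma segment_interior:
  assumes z: "z \<in> interior K" and w: "w \<in> K" and t: "0 \<le> t" "t < 1"
  shows "z + t *\<^sub>R (w - z) \<in> interior K"
  using mem_interior_convex_shrink[OF convex z w, of "1 - t"] t by (simp add: algebra_simps)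

text \<open>Segments from an interior point stay in the interior before their end, so the ray from
  \<open>z\<close> through \<open>x\<close> reaches the frontier at a parameter \<open>d\<close> of
  at least 1, and \<open>x\<close> has scale \<open>1 / d\<close>. The frontier point lies on a
  facet because facets make up the relative frontier of a polyhedron.\<close>

lemma cones_cover:
  assumes z: "z \<in> interior K"
  shows "(\<Union>F\<in>{F. F facet_of K}. cone_over z F) = K - {z}"
proof (intro equalityI subsetI)
  fix x assume "x \<in> (\<Union>F\<in>{F. F facet_of K}. cone_over z F)"
  then obtain F s w where F: "F facet_of K" and s: "0 < s" "s \<le> 1" and w: "w \<in> F" "x = z + s *\<^sub>R (w - z)"
    by (auto simp: cone_over_def)
  have wK: "w \<in> K" "w \<notin> interior K" using facet_face[OF F] w by auto
  then have "w \<noteq> z" using z by auto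
  then have "x \<noteq> z" using s w by auto
  moreover have "x \<in> K"
  proof (cases "s = 1")
    case False
    then show ?thesis using segment_interior[OF z wK(1), of s] s w interior_subset by auto
  qed (use w wK in auto)
  ultimately show "x \<in> K - {z}" by auto
next
  fix x assume x: "x \<in> K - {z}"
  then have "x - z \<noteq> 0" by auto
  obtain d where d: "0 < d" "z + d *\<^sub>R (x - z) \<in> frontier K"
    using ray_to_frontier[OF compact_imp_bounded[OF compact] z \<open>x - z \<noteq> 0\<close>] by metis
  define w where "w = z + d *\<^sub>R (x - z)"
  have "1 \<le> d"
  proof (rule ccontr)
    assume "\<not> 1 \<le> d"
    then have "w \<in> interior K" unfolding w_def using x d by (intro segment_interior[OF z]) auto
    then show False using d by (simp add: frontier_def w_def)
  qed
  have "w \<in> rel_frontier K"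
    using d by (simp add: rel_frontier_nonempty_interior[OF interior_nonempty] w_def)
  then obtain F where F: "F facet_of K" "w \<in> F"
    using rel_frontier_of_polyhedron[OF polytope_imp_polyhedron[OF polytope]] by auto
  have "x = z + (1 / d) *\<^sub>R (w - z)" using d by (simp add: w_def)
  then have "x \<in> cone_over z F"
    unfolding cone_over_def using F d \<open>1 \<le> d\<close> by (intro image_eqI[of _ _ "(1 / d, w)"]) auto
  then show "x \<in> (\<Union>F\<in>{F. F facet_of K}. cone_over z F)" using F by blast
qed

text \<open>A ray from \<open>z\<close> meets the boundary only once, so a common point of the two
  cones has the same scale and the same base point in both. It lies in the affine hull of
  \<open>z\<close> and \<open>F \<inter> G\<close>. Different facets meet in dimension at most 1,
  hence this hull has dimension at most 2.\<close>

lemma negligible_cones: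
  assumes z: "z \<in> interior K" and F: "F facet_of K" and G: "G facet_of K" and ne: "F \<noteq> G"
  shows "negligible (cone_over z F \<inter> cone_over z G)"
proof -
  have "cone_over z F \<inter> cone_over z G \<subseteq> affine hull (insert z (F \<inter> G))"
  proof
    fix x assume "x \<in> cone_over z F \<inter> cone_over z G"
    then obtain s t w y where s: "0 < s" "s \<le> 1" and t: "0 < t" "t \<le> 1" and w: "w \<in> F" and y: "y \<in> G"
      and eq: "x = z + s *\<^sub>R (w - z)" "x = z + t *\<^sub>R (y - z)"
      by (auto simp: cone_over_def)
    have bd: "w \<in> K" "w \<notin> interior K" "y \<in> K" "y \<notin> interior K"
      using facet_face[OF F] facet_face[OF G] w y by auto
    have ww: "s *\<^sub>R (w - z) = t *\<^sub>R (y - z)" using eq by simp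
    have "s = t"
    proof (rule ccontr)
      assume "s \<noteq> t"
      then consider "s < t" | "t < s" by linarith
      then show False
      proof cases
        case 1
        have "(s / t) *\<^sub>R (w - z) = (1 / t) *\<^sub>R (s *\<^sub>R (w - z))" by simp
        also have "\<dots> = y - z" unfolding ww using t by simp
        finally have "y = z + (s / t) *\<^sub>R (w - z)" by simp
        then show False using segment_interior[OF z bd(1), of "s / t"] bd 1 s t by simp
      next
        case 2
        have "(t / s) *\<^sub>R (y - z) = (1 / s) *\<^sub>R (t *\<^sub>R (y - z))" by simp
        also have "\<dots> = w - z" unfolding ww[symmetric] using s by simp
        finally have "w = z + (t / s) *\<^sub>R (y - z)" by simp
        then show False using segment_interior[OF z bd(3), of "t / s"] bd 2 s t by simp
      qed
    qed
    then have "w = y" using ww s by simp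
    then have "w \<in> affine hull (insert z (F \<inter> G))" using w y by (intro hull_inc) auto
    moreover have "z \<in> affine hull (insert z (F \<inter> G))" by (intro hull_inc) auto
    ultimately have "(1 - s) *\<^sub>R z + s *\<^sub>R w \<in> affine hull (insert z (F \<inter> G))"
      by (intro mem_affine) auto
    then show "x \<in> affine hull (insert z (F \<inter> G))" by (simp add: eq(1) algebra_simps)
  qed
  moreover have "negligible (affine hull (insert z (F \<inter> G)))"
  proof -
    have conv: "convex F" "convex G"
      using facet_face[OF F] facet_face[OF G] by (auto dest: face_of_imp_convex)
    have FG: "F \<inter> G face_of F"
      using face_of_subset[OF face_of_Int[OF facet_face(1)[OF F] facet_face(1)[OF G]] _ facet_face(2)[OF F]]
      by auto
    have "F \<inter> G \<noteq> F"
    proof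
      assume "F \<inter> G = F"
      then have "F face_of G"
        using face_of_subset[OF facet_face(1)[OF F] _ facet_face(2)[OF G]] by auto
      from face_of_aff_dim_lt[OF conv(2) this ne] show False
        using facet_face(3)[OF F] facet_face(3)[OF G] by simp
    qed
    from face_of_aff_dim_lt[OF conv(1) FG this] have "aff_dim (F \<inter> G) \<le> 1"
      using facet_face(3)[OF F] by simp
    then have "aff_dim (affine hull (insert z (F \<inter> G))) < DIM(real^3)"
      by (simp add: aff_dim_insert)
    then obtain a b where "a \<noteq> 0" "affine hull (insert z (F \<inter> G)) \<subseteq> {x. a \<bullet> x = b}"
      by (rule aff_lowdim_subset_hyperplane)
    then show ?thesis using negligible_hyperplane[of a b] negligible_subset by blast
  qed
  ultimately show ?thesis by (rule negligible_subset[rotated])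
qed

definition offset :: "(real^3) set \<Rightarrow> real" where
  "offset F = (SOME b. flat_face F (facet_normal K F) b)"

lemma facet_flat_face:
  assumes F: "F facet_of K"
  shows "flat_face F (facet_normal K F) (offset F)"
proof -
  have "\<exists>b. flat_face F (facet_normal K F) b"
    using flat_face_facet[OF polytope interior_nonempty F] by blast
  then show ?thesis unfolding offset_def by (rule someI_ex)
qed

lemma interior_below_facet:
  assumes F: "F facet_of K" and z: "z \<in> interior K"
  shows "facet_normal K F \<bullet> z < offset F"
proof -
  obtain b where b: "flat_face F (facet_normal K F) b" "\<forall>y\<in>interior K. facet_normal K F \<bullet> y < b"
    using flat_face_facet[OF polytope interior_nonempty F] by blast
  obtain x where "x \<in> F" using flat_face_nonempty[OF b(1)] by auto
  then have "b = offset F"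
    using flat_face_subset[OF b(1)] flat_face_subset[OF facet_flat_face[OF F]] by metis
  then show ?thesis using b z by auto
qed

text \<open>On a facet with normal \<open>n\<close> the factor \<open>(x - z) \<bullet> n\<close> is
  the constant \<open>offset F - n \<bullet> z\<close>, which can be taken out of the surface
  integral; this is the flux of the radial field.\<close>

lemma has_integral_radial:
  assumes f: "real_polynomial_function f" and z: "z \<in> interior K"
  shows "((\<lambda>x. 3 * f x + grad f x \<bullet> (x - z)) has_integral
    (\<Sum>F | F facet_of K. (offset F - facet_normal K F \<bullet> z) * surface_integral F f)) K"
proof -
  have "((\<lambda>x. 3 * f x + grad f x \<bullet> (x - z)) has_integral
      (\<Sum>F | F facet_of K. (offset F - facet_normal K F \<bullet> z) * surface_integral F f))
      (\<Union>F\<in>{F. F facet_of K}. cone_over z F)"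
  proof (rule has_integral_UN)
    show "finite {F. F facet_of K}" by (rule finite_polytope_facets[OF polytope])
    show "((\<lambda>x. 3 * f x + grad f x \<bullet> (x - z)) has_integral
        (offset F - facet_normal K F \<bullet> z) * surface_integral F f) (cone_over z F)"
      if "F \<in> {F. F facet_of K}" for F
      using that by (intro integral_cone facet_flat_face interior_below_facet z f) auto
    show "pairwise (\<lambda>F G. negligible (cone_over z F \<inter> cone_over z G)) {F. F facet_of K}"
      by (auto simp: pairwise_def intro: negligible_cones[OF z])
  qed
  then show ?thesis
    unfolding cones_cover[OF z]
    by (subst has_integral_spike_set_eq[of K "K - {z}"]) (auto intro: negligible_subset[of "{z}"])
qed

text \<open>The difference of two radial formulas with different centres has a constant direction.\<close>

lemma has_integral_directional_derivative:
  assumes f: "real_polynomial_function f"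
  shows "((\<lambda>x. grad f x \<bullet> e) has_integral (\<Sum>F | F facet_of K. (facet_normal K F \<bullet> e) * surface_integral F f)) K"
proof -
  obtain z r where z: "z \<in> interior K" "r > 0" "ball z r \<subseteq> interior K"
    using interior_nonempty open_interior[of K] by (metis all_not_in_conv open_contains_ball)
  \<comment> \<open>Keeps the shifted centre \<open>z - \<epsilon> *\<^sub>R e\<close> in the
    interior; the summand 1 admits \<open>e = 0\<close>.\<close>
  define \<epsilon> where "\<epsilon> = r / (1 + norm e)"
  have p: "0 < 1 + norm e" by (simp add: add_pos_nonneg)
  have \<epsilon>: "\<epsilon> > 0" using z p by (simp add: \<epsilon>_def)
  have "r * norm e < r * (1 + norm e)" using z by simp
  then have "\<epsilon> * norm e < r" using p by (simp add: \<epsilon>_def pos_divide_less_eq)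
  then have "z - \<epsilon> *\<^sub>R e \<in> ball z r" using \<epsilon> by (simp add: dist_norm)
  then have z': "z - \<epsilon> *\<^sub>R e \<in> interior K" using z by auto
  have "((\<lambda>x. (1 / \<epsilon>) * ((3 * f x + grad f x \<bullet> (x - (z - \<epsilon> *\<^sub>R e))) - (3 * f x + grad f x \<bullet> (x - z)))) has_integral
    (1 / \<epsilon>) * ((\<Sum>F | F facet_of K. (offset F - facet_normal K F \<bullet> (z - \<epsilon> *\<^sub>R e)) * surface_integral F f) -
      (\<Sum>F | F facet_of K. (offset F - facet_normal K F \<bullet> z) * surface_integral F f))) K"
    by (intro has_integral_mult_right has_integral_diff has_integral_radial f z z')
  also have "(\<lambda>x. (1 / \<epsilon>) * ((3 * f x + grad f x \<bullet> (x - (z - \<epsilon> *\<^sub>R e))) - (3 * f x + grad f x \<bullet> (x - z)))) =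
      (\<lambda>x. grad f x \<bullet> e)"
    using \<epsilon> by (simp add: inner_diff_right)
  also have "(1 / \<epsilon>) * ((\<Sum>F | F facet_of K. (offset F - facet_normal K F \<bullet> (z - \<epsilon> *\<^sub>R e)) * surface_integral F f) -
      (\<Sum>F | F facet_of K. (offset F - facet_normal K F \<bullet> z) * surface_integral F f)) =
      (\<Sum>F | F facet_of K. (facet_normal K F \<bullet> e) * surface_integral F f)"
    unfolding sum_subtractf[symmetric] sum_distrib_left
    using \<epsilon> by (intro sum.cong) (auto simp: inner_diff_right algebra_simps)
  finally show ?thesis .
qed

lemma surface_integrable_polynomial:
  assumes "F facet_of K" "real_polynomial_function f"
  shows "surface_integrable F f"
  using assms by (intro surface_integrable_continuous[OF facet_flat_face])
    (auto simp: continuous_on_polymonial_function real_polynomial_function_eq)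

text \<open>Each component of \<open>u\<close> is differentiated in its own coordinate direction;
  summing over the directions reassembles \<open>u \<bullet> n\<close> on every facet.\<close>

theorem divergence_theorem:
  assumes u: "polynomial_function u"
  shows "(divergence u has_integral (\<Sum>F | F facet_of K. surface_integral F (\<lambda>x. u x \<bullet> facet_normal K F))) K"
proof -
  note c = polynomial_function_component[OF u]
  have "((\<lambda>x. \<Sum>i\<in>UNIV. grad (\<lambda>x. u x $ i) x \<bullet> axis i 1) has_integral
      (\<Sum>i\<in>UNIV. \<Sum>F | F facet_of K. (facet_normal K F \<bullet> axis i 1) * surface_integral F (\<lambda>x. u x $ i))) K"
    by (intro has_integral_sum has_integral_directional_derivative c) auto
  also have "(\<lambda>x. \<Sum>i\<in>UNIV. grad (\<lambda>x. u x $ i) x \<bullet> axis i 1) = divergence u"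
    by (simp add: divergence_polynomial[OF u] fun_eq_iff inner_axis)
  also have "(\<Sum>i\<in>UNIV. \<Sum>F | F facet_of K. (facet_normal K F \<bullet> axis i 1) * surface_integral F (\<lambda>x. u x $ i)) =
      (\<Sum>F | F facet_of K. \<Sum>i\<in>UNIV. (facet_normal K F \<bullet> axis i 1) * surface_integral F (\<lambda>x. u x $ i))"
    by (rule sum.swap)
  also have "\<dots> = (\<Sum>F | F facet_of K. surface_integral F (\<lambda>x. u x \<bullet> facet_normal K F))"
  proof (rule sum.cong)
    fix F assume F: "F \<in> {F. F facet_of K}"
    let ?n = "facet_normal K F"
    have i: "surface_integrable F (\<lambda>x. ?n $ i * u x $ i)" for i
      using F by (intro surface_integrable_polynomial real_polynomial_function.intros(4)
          real_polynomial_function.intros(2) c) auto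
    have i2: "surface_integrable F (\<lambda>x. ?n $ 1 * u x $ 1 + ?n $ 2 * u x $ 2)"
      using F by (intro surface_integrable_polynomial real_polynomial_function.intros(2,3,4) c) auto
    have "surface_integral F (\<lambda>x. u x \<bullet> ?n) =
        surface_integral F (\<lambda>x. ?n $ 1 * u x $ 1 + ?n $ 2 * u x $ 2 + ?n $ 3 * u x $ 3)"
      by (simp add: inner_vec_def sum_3 mult.commute)
    also have "\<dots> = (\<Sum>i\<in>UNIV. (?n \<bullet> axis i 1) * surface_integral F (\<lambda>x. u x $ i))"
      by (simp add: surface_integral_add i i2 surface_integral_cmult sum_3 inner_axis)
    finally show "(\<Sum>i\<in>UNIV. (?n \<bullet> axis i 1) * surface_integral F (\<lambda>x. u x $ i)) =
        surface_integral F (\<lambda>x. u x \<bullet> ?n)" ..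
  qed simp
  finally show ?thesis .
qed

end

section \<open>Meshes\<close>

lemma self_neg_zero:
  fixes x :: "'a::real_vector"
  assumes "x = - x"
  shows "x = 0"
proof -
  have "2 *\<^sub>R x = x + x" by (rule scaleR_2)
  also have "\<dots> = 0" by (subst (2) assms) simp
  finally show ?thesis by simp
qed

locale mesh =
  fixes M :: fe_mesh
  assumes is_mesh: "is_fe_mesh M"
begin

lemma finite_cells: "finite (cells M)"
  using is_mesh by (simp add: is_fe_mesh_def)

lemma cell: "K \<in> cells M \<Longrightarrow> polytope_cell K"
  using is_mesh by (auto simp: is_fe_mesh_def polytope_cell_def)

text \<open>If \<open>K \<inter> L\<close> were all of \<open>K\<close>, then \<open>K\<close> would
  be a proper face of \<open>L\<close> and of lower dimension, although both have interior. So the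
  intersection is a proper face, which is flat and misses the interior.\<close>

lemma cell_inter:
  assumes K: "K \<in> cells M" and L: "L \<in> cells M" and ne: "K \<noteq> L"
  shows "negligible (K \<inter> L)" "interior K \<inter> L = {}"
proof -
  interpret K: polytope_cell K by (rule cell[OF K])
  interpret L: polytope_cell L by (rule cell[OF L])
  have face: "(K \<inter> L) face_of K" "(K \<inter> L) face_of L"
    using is_mesh K L by (auto simp: is_fe_mesh_def)
  have "K \<inter> L \<noteq> K"
  proof
    assume "K \<inter> L = K"
    then have "K face_of L" using face(2) by simp
    from face_of_aff_dim_lt[OF L.convex this ne] show False
      using aff_dim_nonempty_interior[OF K.interior_nonempty] aff_dim_nonempty_interior[OF L.interior_nonempty]
      by simp
  qed
  note proper = face(1) this
  show "interior K \<inter> L = {}"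
    using face_of_disjoint_interior[OF proper] interior_subset[of K] by blast
  have "aff_dim (K \<inter> L) < DIM(real^3)"
    using face_of_aff_dim_lt[OF K.convex proper] aff_dim_nonempty_interior[OF K.interior_nonempty] by simp
  then obtain a b where "a \<noteq> 0" "K \<inter> L \<subseteq> {x. a \<bullet> x = b}"
    by (rule aff_lowdim_subset_hyperplane)
  then show "negligible (K \<inter> L)" using negligible_hyperplane[of a b] negligible_subset by blast
qed

text \<open>Frontiers of convex cells are null and cells overlap only in null sets, so knowledge of
  \<open>f\<close> in the interiors is enough.\<close>

lemma integral_domain:
  assumes g: "\<And>K. K \<in> cells M \<Longrightarrow> g K absolutely_integrable_on K"
    and fg: "\<And>K x. K \<in> cells M \<Longrightarrow> x \<in> interior K \<Longrightarrow> f x = (g K x :: real)"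
  shows "set_integrable lebesgue (domain M) f"
    and "(LINT x : domain M | lebesgue. f x) = (\<Sum>K\<in>cells M. integral K (g K))"
proof -
  have f: "f absolutely_integrable_on K" "integral K f = integral K (g K)" if K: "K \<in> cells M" for K
  proof -
    interpret polytope_cell K by (rule cell[OF K])
    have neg: "negligible (frontier K)" by (rule negligible_convex_frontier[OF convex])
    have eq: "f x = g K x" if "x \<in> K - frontier K" for x
      using fg[OF K] that closure_subset[of K] by (auto simp: frontier_def)
    show "f absolutely_integrable_on K" using g[OF K] neg eq by (rule absolutely_integrable_spike)
    show "integral K f = integral K (g K)" by (rule integral_spike[OF neg]) (use eq in auto)
  qed
  have "set_integrable lebesgue (\<Union>K\<in>cells M. K) f"
    using f(1) polytope_cell.compact[OF cell]
    by (intro set_integrable_UN finite_cells) (auto simp: borel_compact)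
  then show si: "set_integrable lebesgue (domain M) f" by (simp add: domain_def)
  have "(f has_integral (\<Sum>K\<in>cells M. integral K f)) (domain M)"
    unfolding domain_def
  proof (rule has_integral_Union[OF finite_cells])
    show "(f has_integral integral K f) K" if "K \<in> cells M" for K
      using set_lebesgue_integral_eq_integral(1)[OF f(1)[OF that]] by (rule integrable_integral)
    show "pairwise (\<lambda>K L. negligible (K \<inter> L)) (cells M)"
      using cell_inter by (auto simp: pairwise_def)
  qed
  then show "(LINT x : domain M | lebesgue. f x) = (\<Sum>K\<in>cells M. integral K (g K))"
    using set_lebesgue_integral_eq_integral(2)[OF si] f(2) by (simp add: integral_unique)
qed

text \<open>The normals agree up to sign. With equal signs, a short inward segment at a relative
  interior point of \<open>F\<close> would enter both cells, whose interiors are disjoint.\<close>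

lemma facet_normals_opposite:
  assumes K: "K \<in> cells M" and L: "L \<in> cells M" and ne: "K \<noteq> L"
    and FK: "F facet_of K" and FL: "F facet_of L"
  shows "facet_normal L F = - facet_normal K F"
proof (rule ccontr)
  assume neg: "facet_normal L F \<noteq> - facet_normal K F"
  interpret K: polytope_cell K by (rule cell[OF K])
  interpret L: polytope_cell L by (rule cell[OF L])
  have eq: "facet_normal L F = facet_normal K F"
    using flat_face_normal_unique[OF K.facet_flat_face[OF FK], of "facet_normal L F" "L.offset F"]
      L.facet_flat_face[OF FL] flat_face_subset[OF L.facet_flat_face[OF FL]] neg
    by (auto simp: flat_face_def)
  have "convex F" "F \<noteq> {}"
    using K.facet_flat_face[OF FK] flat_face_nonempty by (auto simp: flat_face_def)
  then obtain x where x: "x \<in> rel_interior F" using rel_interior_eq_empty by blast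
  obtain d where d: "d > 0" "\<And>s. 0 < s \<Longrightarrow> s \<le> d \<Longrightarrow> x - s *\<^sub>R facet_normal K F \<in> interior K"
    using facet_normal_ray[OF K.polytope K.interior_nonempty FK x] by metis
  obtain e where e: "e > 0" "\<And>s. 0 < s \<Longrightarrow> s \<le> e \<Longrightarrow> x - s *\<^sub>R facet_normal L F \<in> interior L"
    using facet_normal_ray[OF L.polytope L.interior_nonempty FL x] by metis
  have "x - min d e *\<^sub>R facet_normal K F \<in> interior K \<inter> interior L"
    using d e eq by auto
  then show False using cell_inter(2)[OF K L ne] interior_subset[of L] by blast
qed

lemma norm_facet_normal:
  assumes "K \<in> cells M" "F facet_of K"
  shows "norm (facet_normal K F) = 1"
  using polytope_cell.facet_flat_face[OF cell] assms by (auto simp: flat_face_def)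

text \<open>The normal of a third cell would be opposite to each of two opposite vectors, hence
  zero. The names are assigned so that \<open>K\<close> is the \<open>+\<close> side, out of which
  \<open>nrm M F\<close> points.\<close>

lemma shared_face:
  assumes F: "F \<in> shared_faces M"
  obtains K L where "K \<in> cells M" "L \<in> cells M" "K \<noteq> L" "F facet_of K" "F facet_of L"
    "{K \<in> cells M. F facet_of K} = {K, L}" "facet_normal K F = nrm M F" "facet_normal L F = - nrm M F"
proof -
  obtain K L where KL: "K \<in> cells M" "L \<in> cells M" "K \<noteq> L" "F facet_of K" "F facet_of L"
    using F by (auto simp: shared_faces_def)
  interpret K: polytope_cell K by (rule cell[OF KL(1)])
  have opp: "facet_normal L F = - facet_normal K F" by (rule facet_normals_opposite[OF KL])
  have two: "{K \<in> cells M. F facet_of K} = {K, L}"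
  proof (rule ccontr)
    assume "\<not> ?thesis"
    then obtain N where N: "N \<in> cells M" "F facet_of N" "K \<noteq> N" "L \<noteq> N" using KL by blast
    have "facet_normal N F = - facet_normal K F" "facet_normal N F = - facet_normal L F"
      using facet_normals_opposite KL N by blast+
    then have "facet_normal N F = 0" using opp by (intro self_neg_zero) simp
    then show False using norm_facet_normal[OF N(1,2)] by simp
  qed
  have F_ne: "F \<noteq> {}" using KL by (simp add: facet_of_def)
  then obtain x0 where x0: "x0 \<in> F" by auto
  have nrm: "norm (nrm M F) = 1" "\<And>x y. x \<in> F \<Longrightarrow> y \<in> F \<Longrightarrow> nrm M F \<bullet> (y - x) = 0"
    using is_mesh F by (auto simp: is_fe_mesh_def)
  have "nrm M F = facet_normal K F \<or> nrm M F = - facet_normal K F"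
    using flat_face_normal_unique[OF K.facet_flat_face[OF KL(4)] nrm(1), of "nrm M F \<bullet> x0"] nrm(2)[OF x0]
    by (simp add: inner_diff_right)
  then show thesis
  proof
    assume nrm: "nrm M F = facet_normal K F"
    show thesis by (rule that[OF KL two]) (simp_all add: nrm opp)
  next
    assume nrm: "nrm M F = - facet_normal K F"
    have "{K \<in> cells M. F facet_of K} = {L, K}" unfolding two by (rule insert_commute)
    then show thesis
      by (rule that[OF KL(2,1) KL(3)[symmetric] KL(5,4)]) (simp_all add: nrm opp)
  qed
qed

lemma outer_face:
  assumes F: "F \<in> outer_faces M"
  obtains K where "K \<in> cells M" "F facet_of K" "{K \<in> cells M. F facet_of K} = {K}"
    "outer_normal M F = facet_normal K F"
proof -
  obtain K where K: "K \<in> cells M" "F facet_of K" using F by (auto simp: outer_faces_def)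
  have one: "{K \<in> cells M. F facet_of K} = {K}"
    using F K by (auto simp: outer_faces_def shared_faces_def)
  interpret polytope_cell K by (rule cell[OF K(1)])
  have "outer_normal M F = facet_normal K F"
    unfolding outer_normal_def
  proof (rule the_equality)
    show "\<exists>L\<in>cells M. F facet_of L \<and> outward_unit_normal L F (facet_normal K F)"
      using K outward_unit_normal_iff[OF polytope interior_nonempty K(2)] by (intro bexI[of _ K]) simp_all
    fix n assume "\<exists>K\<in>cells M. F facet_of K \<and> outward_unit_normal K F n"
    then obtain L where L: "L \<in> cells M" "F facet_of L" "outward_unit_normal L F n" by (elim bexE conjE)
    then have "L \<in> {K \<in> cells M. F facet_of K}" by simp
    then have "L = K" unfolding one by simp
    then show "n = facet_normal K F"
      using L(3) by (simp only: outward_unit_normal_iff[OF polytope interior_nonempty K(2)])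
  qed
  with K one show thesis by (rule that)
qed

section \<open>Regrouping sums over the facets of all cells\<close>

definition faces :: "(real^3) set set" where
  "faces = {F. \<exists>K\<in>cells M. F facet_of K}"

lemma finite_faces: "finite faces"
proof -
  have "faces = (\<Union>K\<in>cells M. {F. F facet_of K})" by (auto simp: faces_def)
  moreover have "finite {F. F facet_of K}" if "K \<in> cells M" for K
    using polytope_cell.polytope[OF cell[OF that]] by (rule finite_polytope_facets)
  ultimately show ?thesis using finite_cells by simp
qed

lemma faces_split: "faces = shared_faces M \<union> outer_faces M" "shared_faces M \<inter> outer_faces M = {}"
  by (auto simp: faces_def shared_faces_def outer_faces_def)

text \<open>The last fact holds because the two outer normals are opposite and nonzero; it ensures
  that a glued pair contributes two distinct summands.\<close>

lemma glueD:
  assumes "(F, a) \<in> glue M"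
  shows "F \<in> outer_faces M" "(+) a ` F \<in> outer_faces M" "nrm M F = outer_normal M F"
    "outer_normal M ((+) a ` F) = - outer_normal M F" "F \<noteq> (+) a ` F"
proof -
  show *: "F \<in> outer_faces M" "(+) a ` F \<in> outer_faces M" "nrm M F = outer_normal M F"
    "outer_normal M ((+) a ` F) = - outer_normal M F"
    using is_mesh assms by (auto simp: is_fe_mesh_def)
  obtain K where K: "K \<in> cells M" "F facet_of K" "outer_normal M F = facet_normal K F"
    using outer_face[OF *(1)] by metis
  then have "outer_normal M F \<noteq> 0" using norm_facet_normal[OF K(1,2)] by auto
  then show "F \<noteq> (+) a ` F" using *(4) self_neg_zero by metis
qed

lemma glue_disjoint:
  assumes "(F, a) \<in> glue M" "(G, b) \<in> glue M" "(F, a) \<noteq> (G, b)"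
  shows "{F, (+) a ` F} \<inter> {G, (+) b ` G} = {}"
proof -
  have "\<forall>(F, a)\<in>glue M. \<forall>(G, b)\<in>glue M. (F, a) \<noteq> (G, b) \<longrightarrow>
      {F, (+) a ` F} \<inter> {G, (+) b ` G} = {}"
    using is_mesh unfolding is_fe_mesh_def by (elim conjE)
  from bspec[OF this assms(1)] have "\<forall>(G, b)\<in>glue M. (F, a) \<noteq> (G, b) \<longrightarrow>
      {F, (+) a ` F} \<inter> {G, (+) b ` G} = {}"
    by (simp only: prod.case)
  from bspec[OF this assms(2)] show ?thesis
    using assms(3) by (simp only: prod.case not_False_eq_True simp_thms)
qed

text \<open>Disjointness of the pairs keeps a face from being the first member of two of them, so
  projection to the finitely many faces is injective.\<close>

lemma finite_glue: "finite (glue M)"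
proof (rule inj_on_finite[of fst _ faces])
  show "inj_on fst (glue M)"
  proof (rule inj_onI)
    fix x y assume xy: "x \<in> glue M" "y \<in> glue M" "fst x = fst y"
    obtain F a b where "x = (F, a)" "y = (F, b)" using xy(3) by (metis prod.collapse)
    then show "x = y" using glue_disjoint[of F a F b] xy(1,2) by auto
  qed
  show "fst ` glue M \<subseteq> faces" using glueD(1) faces_split(1) by auto
qed (rule finite_faces)

text \<open>Exchanging the sums counts each face once per adjacent cell: twice with opposite normals
  if it is shared, once if it is outer. Glued outer faces pair up in the same way, since their
  normals are opposite.\<close>

lemma sum_faces:
  fixes c :: "real^3 \<Rightarrow> (real^3) set \<Rightarrow> real"
  shows "(\<Sum>K\<in>cells M. \<Sum>F | F facet_of K. c (facet_normal K F) F) =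
    (\<Sum>F\<in>boundary_faces M. c (outer_normal M F) F) +
    (\<Sum>(F, a)\<in>internal_faces M. c (nrm M F) F + c (- nrm M F) ((+) a ` F))"
proof -
  let ?c = "\<lambda>K F. c (facet_normal K F) F"
  have "(\<Sum>K\<in>cells M. \<Sum>F | F facet_of K. ?c K F) = (\<Sum>K\<in>cells M. \<Sum>F | F \<in> faces \<and> F facet_of K. ?c K F)"
    by (intro sum.cong refl) (auto simp: faces_def)
  also have "\<dots> = (\<Sum>F\<in>faces. \<Sum>K | K \<in> cells M \<and> F facet_of K. ?c K F)"
    by (rule sum.swap_restrict[OF finite_cells finite_faces])
  also have "\<dots> = (\<Sum>F\<in>shared_faces M. \<Sum>K | K \<in> cells M \<and> F facet_of K. ?c K F) +
      (\<Sum>F\<in>outer_faces M. \<Sum>K | K \<in> cells M \<and> F facet_of K. ?c K F)"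
    using finite_faces unfolding faces_split(1) by (intro sum.union_disjoint) (auto simp: faces_split(2))
  also have "(\<Sum>F\<in>shared_faces M. \<Sum>K | K \<in> cells M \<and> F facet_of K. ?c K F) =
      (\<Sum>F\<in>shared_faces M. c (nrm M F) F + c (- nrm M F) F)"
  proof (rule sum.cong)
    fix F assume "F \<in> shared_faces M"
    then obtain K L where "K \<noteq> L" "{K \<in> cells M. F facet_of K} = {K, L}"
      "facet_normal K F = nrm M F" "facet_normal L F = - nrm M F"
      by (rule shared_face)
    then show "(\<Sum>K | K \<in> cells M \<and> F facet_of K. ?c K F) = c (nrm M F) F + c (- nrm M F) F" by simp
  qed simp
  also have "\<dots> = (\<Sum>(F, a)\<in>(\<lambda>F. (F, 0)) ` shared_faces M. c (nrm M F) F + c (- nrm M F) ((+) a ` F))"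
    by (subst sum.reindex) (auto simp: inj_on_def)
  also have "(\<Sum>F\<in>outer_faces M. \<Sum>K | K \<in> cells M \<and> F facet_of K. ?c K F) =
      (\<Sum>F\<in>outer_faces M. c (outer_normal M F) F)"
  proof (rule sum.cong)
    fix F assume "F \<in> outer_faces M"
    then obtain K where "{K \<in> cells M. F facet_of K} = {K}" "outer_normal M F = facet_normal K F"
      by (rule outer_face)
    then show "(\<Sum>K | K \<in> cells M \<and> F facet_of K. ?c K F) = c (outer_normal M F) F" by simp
  qed simp
  also have "\<dots> = (\<Sum>F\<in>boundary_faces M. c (outer_normal M F) F) +
      (\<Sum>F\<in>(\<Union>(F, a)\<in>glue M. {F, (+) a ` F}). c (outer_normal M F) F)"
  proof -
    have "(\<Union>(F, a)\<in>glue M. {F, (+) a ` F}) \<subseteq> outer_faces M"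
      using glueD by auto
    moreover have "finite (outer_faces M)" using finite_faces faces_split(1) by simp
    ultimately show ?thesis unfolding boundary_faces_def by (intro sum.subset_diff)
  qed
  also have "(\<Sum>F\<in>(\<Union>(F, a)\<in>glue M. {F, (+) a ` F}). c (outer_normal M F) F) =
      (\<Sum>(F, a)\<in>glue M. c (nrm M F) F + c (- nrm M F) ((+) a ` F))"
  proof (subst sum.UNION_disjoint)
    show "\<forall>p\<in>glue M. \<forall>q\<in>glue M. p \<noteq> q \<longrightarrow>
        (case p of (F, a) \<Rightarrow> {F, (+) a ` F}) \<inter> (case q of (F, a) \<Rightarrow> {F, (+) a ` F}) = {}"
    proof (intro ballI impI)
      fix p q assume pq: "p \<in> glue M" "q \<in> glue M" "p \<noteq> q"
      then show "(case p of (F, a) \<Rightarrow> {F, (+) a ` F}) \<inter> (case q of (F, a) \<Rightarrow> {F, (+) a ` F}) = {}"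
        using glue_disjoint[of "fst p" "snd p" "fst q" "snd q"] by (simp add: case_prod_beta)
    qed
    show "(\<Sum>p\<in>glue M. \<Sum>F\<in>(case p of (F, a) \<Rightarrow> {F, (+) a ` F}). c (outer_normal M F) F) =
        (\<Sum>(F, a)\<in>glue M. c (nrm M F) F + c (- nrm M F) ((+) a ` F))"
    proof (intro sum.cong refl)
      fix p assume "p \<in> glue M"
      then obtain F a where p: "p = (F, a)" "(F, a) \<in> glue M" by (cases p) auto
      note g = glueD[OF p(2)]
      show "(\<Sum>F\<in>(case p of (F, a) \<Rightarrow> {F, (+) a ` F}). c (outer_normal M F) F) =
          (case p of (F, a) \<Rightarrow> c (nrm M F) F + c (- nrm M F) ((+) a ` F))"
        unfolding p(1) prod.case using g(3-5) by (subst sum.insert) (simp_all only: finite.intros, auto)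
    qed
  qed (auto intro: finite_glue)
  finally have "(\<Sum>K\<in>cells M. \<Sum>F | F facet_of K. ?c K F) =
      (\<Sum>F\<in>boundary_faces M. c (outer_normal M F) F) +
      ((\<Sum>(F, a)\<in>(\<lambda>F. (F, 0)) ` shared_faces M. c (nrm M F) F + c (- nrm M F) ((+) a ` F)) +
       (\<Sum>(F, a)\<in>glue M. c (nrm M F) F + c (- nrm M F) ((+) a ` F)))"
    by simp
  also have "(\<Sum>(F, a)\<in>(\<lambda>F. (F, 0)) ` shared_faces M. c (nrm M F) F + c (- nrm M F) ((+) a ` F)) +
       (\<Sum>(F, a)\<in>glue M. c (nrm M F) F + c (- nrm M F) ((+) a ` F)) =
       (\<Sum>(F, a)\<in>internal_faces M. c (nrm M F) F + c (- nrm M F) ((+) a ` F))"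
  proof -
    have "finite ((\<lambda>F. (F, 0::real^3)) ` shared_faces M)" using finite_faces faces_split(1) by simp
    moreover have "(\<lambda>F. (F, 0)) ` shared_faces M \<inter> glue M = {}"
      using glueD(1) faces_split(2) by blast
    ultimately show ?thesis
      unfolding internal_faces_def by (intro sum.union_disjoint[symmetric] finite_glue)
  qed
  finally show ?thesis .
qed

lemma internal_face:
  assumes "(F, a) \<in> internal_faces M"
  obtains K L where "K \<in> cells M" "L \<in> cells M" "F facet_of K" "((+) a ` F) facet_of L"
    "facet_normal K F = nrm M F" "facet_normal L ((+) a ` F) = - nrm M F"
  using assms unfolding internal_faces_def
proof
  assume "(F, a) \<in> (\<lambda>F. (F, 0)) ` shared_faces M"
  then have F: "F \<in> shared_faces M" and a: "(+) a ` F = F" by auto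
  from F obtain K L where "K \<in> cells M" "L \<in> cells M" "F facet_of K" "F facet_of L"
    "facet_normal K F = nrm M F" "facet_normal L F = - nrm M F"
    by (rule shared_face)
  then show thesis using that[of K L] a by simp
next
  assume g: "(F, a) \<in> glue M"
  from glueD(1)[OF g] obtain K where "K \<in> cells M" "F facet_of K" "outer_normal M F = facet_normal K F"
    by (rule outer_face)
  moreover from glueD(2)[OF g] obtain L where "L \<in> cells M" "((+) a ` F) facet_of L"
      "outer_normal M ((+) a ` F) = facet_normal L ((+) a ` F)"
    by (rule outer_face)
  ultimately show thesis using that[of K L] glueD(3,4)[OF g] by simp
qed

lemma integrable_polynomial_cell:
  assumes "K \<in> cells M" "real_polynomial_function f"
  shows "f absolutely_integrable_on K"
  using assms polytope_cell.compact[OF cell]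
  by (intro absolutely_integrable_on_compact) (auto simp: continuous_on_polymonial_function real_polynomial_function_eq)

text \<open>Membership in \<open>L2_space\<close> constrains \<open>f\<close> in the open cell only;
  continuity carries the polynomial to the closed cell, which is the closure of its
  interior.\<close>

lemma H1_on_cell:
  assumes f: "f \<in> H1_space M p" and K: "K \<in> cells M"
  obtains g where "g \<in> poly_degree_le p" "\<And>x. x \<in> K \<Longrightarrow> f x = g x"
proof -
  interpret polytope_cell K by (rule cell[OF K])
  obtain g where g: "g \<in> poly_degree_le p" "\<And>x. x \<in> interior K \<Longrightarrow> f x = g x"
    using f K by (auto simp: H1_space_def L2_space_def)
  have "continuous_on K f"
    using f K continuous_on_subset[of "domain M" f K] by (auto simp: H1_space_def domain_def)
  moreover have "continuous_on K g"
    using poly_degree_le_polynomial[OF g(1)] by (auto simp: continuous_on_polymonial_function real_polynomial_function_eq)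
  ultimately have cont: "continuous_on K (\<lambda>x. f x - g x)" by (rule continuous_on_diff)
  have cl: "closure (interior K) = K"
    using convex_closure_interior[OF convex interior_nonempty] compact by (simp add: compact_imp_closed)
  have "f x - g x = 0" if "x \<in> K" for x
  proof (rule continuous_constant_on_closure[where f = "\<lambda>x. f x - g x" and S = "interior K"])
    show "continuous_on (closure (interior K)) (\<lambda>x. f x - g x)" unfolding cl by (rule cont)
    show "f x - g x = 0" if "x \<in> interior K" for x using g(2)[OF that] by simp
    show "x \<in> closure (interior K)" unfolding cl by (rule that)
  qed
  then show thesis by (intro that[OF g(1)]) auto
qed

end

section \<open>Transport by a divergence-free tangential field\<close>

text \<open>Of the velocity formula only orthogonality to the gradient of \<open>\<phi>\<close> is
  kept. The orders \<open>p\<close> and \<open>q\<close> are independent, so that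
  \<open>\<phi>\<close> and \<open>w\<close> can also exchange their roles.\<close>

locale transport = mesh +
  fixes p q :: nat and \<phi> w :: "real^3 \<Rightarrow> real" and v :: "real^3 \<Rightarrow> real^3"
  assumes phi: "\<phi> \<in> H1_space M p" and w: "w \<in> L2_space M q" and v: "v \<in> HDiv_space M"
    and div: "\<And>x. x \<in> cell_interiors M \<Longrightarrow> divergence v x = 0"
    and tangential: "\<And>x. x \<in> cell_interiors M \<Longrightarrow> v x \<bullet> grad \<phi> x = 0"
begin

text \<open>Agreement on the closed cell is demanded because \<open>\<phi>\<close> enters the flux
  by its values on faces, while \<open>w\<close> and \<open>v\<close> enter by traces.\<close>

definition "phi_on K = (SOME g. g \<in> poly_degree_le p \<and> (\<forall>x\<in>K. \<phi> x = g x))"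
definition "w_on K = (SOME g. g \<in> poly_degree_le q \<and> (\<forall>x\<in>interior K. w x = g x))"
definition "v_on K = (SOME g. polynomial_function g \<and> (\<forall>x\<in>interior K. v x = g x))"

lemma on_cell:
  assumes K: "K \<in> cells M"
  shows phi_on: "real_polynomial_function (phi_on K)" "\<And>x. x \<in> K \<Longrightarrow> \<phi> x = phi_on K x"
    and w_on: "real_polynomial_function (w_on K)" "\<And>x. x \<in> interior K \<Longrightarrow> w x = w_on K x"
    and v_on: "polynomial_function (v_on K)" "\<And>x. x \<in> interior K \<Longrightarrow> v x = v_on K x"
proof -
  have "\<exists>g. g \<in> poly_degree_le p \<and> (\<forall>x\<in>K. \<phi> x = g x)"
    using H1_on_cell[OF phi K] by metis
  from someI_ex[OF this] show "real_polynomial_function (phi_on K)" "\<And>x. x \<in> K \<Longrightarrow> \<phi> x = phi_on K x"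
    unfolding phi_on_def using poly_degree_le_polynomial by auto
  have "\<exists>g. g \<in> poly_degree_le q \<and> (\<forall>x\<in>interior K. w x = g x)"
    using w K by (auto simp: L2_space_def)
  from someI_ex[OF this] show "real_polynomial_function (w_on K)" "\<And>x. x \<in> interior K \<Longrightarrow> w x = w_on K x"
    unfolding w_on_def using poly_degree_le_polynomial by auto
  have "\<exists>g. polynomial_function g \<and> (\<forall>x\<in>interior K. v x = g x)"
    using v K by (auto simp: HDiv_space_def)
  from someI_ex[OF this] show "polynomial_function (v_on K)" "\<And>x. x \<in> interior K \<Longrightarrow> v x = v_on K x"
    unfolding v_on_def by auto
qed

text \<open>The outward flux of \<open>\<phi> w v\<close> as seen from the side from which
  \<open>n\<close> points away, in the form used by the first boundary condition.\<close>

definition flux_density :: "real^3 \<Rightarrow> real^3 \<Rightarrow> real" where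
  "flux_density n x = plus_value n w x * \<phi> x * (plus_value n v x \<bullet> n)"

definition flux_on :: "(real^3) set \<Rightarrow> real^3 \<Rightarrow> real^3" where
  "flux_on K x = (phi_on K x * w_on K x) *\<^sub>R v_on K x"

lemma polynomial_flux_on: "K \<in> cells M \<Longrightarrow> polynomial_function (flux_on K)"
  unfolding flux_on_def[abs_def]
  by (intro polynomial_function_mult) (auto simp: v_on phi_on w_on simp flip: real_polynomial_function_eq)

lemma cell_interiorI: "K \<in> cells M \<Longrightarrow> x \<in> interior K \<Longrightarrow> x \<in> cell_interiors M"
  by (auto simp: cell_interiors_def)

lemma divergence_flux_on:
  assumes K: "K \<in> cells M" and x: "x \<in> interior K"
  shows "divergence (flux_on K) x = \<phi> x * (v x \<bullet> grad w x)"
proof -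
  note P = on_cell[OF K]
  have xi: "x \<in> cell_interiors M" using cell_interiorI[OF K x] .
  have gw: "grad w x = grad (w_on K) x" and gphi: "grad \<phi> x = grad (phi_on K) x"
    by (rule grad_cong_open[OF open_interior x], use P interior_subset[of K] in auto)+
  have dv: "(\<Sum>i\<in>UNIV. grad (\<lambda>x. v_on K x $ i) x $ i) = 0"
    using div[OF xi] divergence_cong_open[OF open_interior x, of v "v_on K"] P
      divergence_polynomial[OF v_on(1)[OF K]] by auto
  have "divergence (flux_on K) x = (\<Sum>i\<in>UNIV. grad (\<lambda>x. (phi_on K x * w_on K x) * v_on K x $ i) x $ i)"
    unfolding divergence_polynomial[OF polynomial_flux_on[OF K]] by (simp add: flux_on_def)
  also have "\<dots> = (\<Sum>i\<in>UNIV. (phi_on K x * w_on K x) * grad (\<lambda>x. v_on K x $ i) x $ i +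
      v_on K x $ i * (phi_on K x * grad (w_on K) x $ i + w_on K x * grad (phi_on K) x $ i))"
    by (intro sum.cong refl, subst grad_mult)
      (auto intro!: real_polynomial_function.intros(4) P polynomial_function_component simp: grad_mult P)
  also have "\<dots> = (phi_on K x * w_on K x) * (\<Sum>i\<in>UNIV. grad (\<lambda>x. v_on K x $ i) x $ i) +
      (phi_on K x * (v_on K x \<bullet> grad (w_on K) x) + w_on K x * (v_on K x \<bullet> grad (phi_on K) x))"
    by (simp add: inner_vec_def sum_distrib_left sum.distrib[symmetric] algebra_simps)
  also have "\<dots> = \<phi> x * (v x \<bullet> grad w x)"
    using tangential[OF xi] P(2)[of x] P(4,6)[OF x] x interior_subset[of K] by (auto simp: dv gw gphi)
  finally show ?thesis .
qed

lemma flux_density_facet: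
  assumes K: "K \<in> cells M" and F: "F facet_of K" and x: "x \<in> rel_interior F"
  shows "plus_value (facet_normal K F) \<phi> x = \<phi> x"
    and "plus_value (facet_normal K F) w x = w_on K x"
    and "plus_value (facet_normal K F) v x = v_on K x"
    and "flux_density (facet_normal K F) x = flux_on K x \<bullet> facet_normal K F"
proof -
  interpret polytope_cell K by (rule cell[OF K])
  note P = on_cell[OF K]
  note side = side_value_facet[OF polytope interior_nonempty F x]
  have xK: "x \<in> K" using x rel_interior_subset[of F] facet_face(2)[OF F] by auto
  have 1: "isCont (phi_on K) x" "isCont (w_on K) x" "isCont (v_on K) x"
    using P by (auto simp: continuous_polymonial_function real_polynomial_function_eq)
  show p: "plus_value (facet_normal K F) \<phi> x = \<phi> x"
    using side[OF _ 1(1), of \<phi>] P(2) xK interior_subset[of K] by auto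
  show w: "plus_value (facet_normal K F) w x = w_on K x" using side[OF _ 1(2), of w] P(4) by auto
  show v: "plus_value (facet_normal K F) v x = v_on K x" using side[OF _ 1(3), of v] P(6) by auto
  show "flux_density (facet_normal K F) x = flux_on K x \<bullet> facet_normal K F"
    unfolding flux_density_def w v flux_on_def using P(2)[OF xK] by (simp add: mult_ac)
qed

lemma flux_facet:
  assumes K: "K \<in> cells M" and F: "F facet_of K"
  shows "surface_integrable F (flux_density (facet_normal K F))"
    and "surface_integral F (flux_density (facet_normal K F)) =
      surface_integral F (\<lambda>x. flux_on K x \<bullet> facet_normal K F)"
proof -
  interpret polytope_cell K by (rule cell[OF K])
  have "continuous_on F (\<lambda>x. flux_on K x \<bullet> facet_normal K F)"
    by (intro continuous_intros continuous_on_polymonial_function polynomial_flux_on K)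
  note i = surface_integrable_continuous[OF facet_flat_face[OF F] this]
  show "surface_integrable F (flux_density (facet_normal K F))"
    by (rule surface_integral_spike(1)[OF facet_flat_face[OF F] i flux_density_facet(4)[OF K F]])
  show "surface_integral F (flux_density (facet_normal K F)) =
      surface_integral F (\<lambda>x. flux_on K x \<bullet> facet_normal K F)"
    by (rule surface_integral_spike(2)[OF facet_flat_face[OF F] i flux_density_facet(4)[OF K F]])
qed

lemma transport_cells:
  shows "set_integrable lebesgue (domain M) (\<lambda>x. \<phi> x * (v x \<bullet> grad w x))"
    and "(LINT x : domain M | lebesgue. \<phi> x * (v x \<bullet> grad w x)) =
      (\<Sum>K\<in>cells M. \<Sum>F | F facet_of K. surface_integral F (flux_density (facet_normal K F)))"
proof -
  have int: "divergence (flux_on K) absolutely_integrable_on K" if K: "K \<in> cells M" for K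
  proof -
    note u = polynomial_flux_on[OF K]
    have "continuous_on K (divergence (flux_on K))"
      unfolding divergence_polynomial[OF u, abs_def]
      by (intro continuous_intros continuous_on_polymonial_function polynomial_grad(1)
          polynomial_function_component u)
    then show ?thesis by (intro absolutely_integrable_on_compact polytope_cell.compact cell K)
  qed
  note dom = integral_domain[where g = "\<lambda>K. divergence (flux_on K)", OF int divergence_flux_on[symmetric]]
  show "set_integrable lebesgue (domain M) (\<lambda>x. \<phi> x * (v x \<bullet> grad w x))" by (rule dom(1))
  have "(LINT x : domain M | lebesgue. \<phi> x * (v x \<bullet> grad w x)) =
      (\<Sum>K\<in>cells M. integral K (divergence (flux_on K)))"
    by (rule dom(2))
  also have "\<dots> = (\<Sum>K\<in>cells M. \<Sum>F | F facet_of K. surface_integral F (flux_density (facet_normal K F)))"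
  proof (rule sum.cong)
    fix K assume K: "K \<in> cells M"
    have "integral K (divergence (flux_on K)) =
        (\<Sum>F | F facet_of K. surface_integral F (\<lambda>x. flux_on K x \<bullet> facet_normal K F))"
      by (rule integral_unique polytope_cell.divergence_theorem cell K polynomial_flux_on)+
    then show "integral K (divergence (flux_on K)) =
        (\<Sum>F | F facet_of K. surface_integral F (flux_density (facet_normal K F)))"
      using flux_facet(2)[OF K] by simp
  qed simp
  finally show "(LINT x : domain M | lebesgue. \<phi> x * (v x \<bullet> grad w x)) =
      (\<Sum>K\<in>cells M. \<Sum>F | F facet_of K. surface_integral F (flux_density (facet_normal K F)))" .
qed

definition jump_density :: "real \<Rightarrow> real^3 \<Rightarrow> real^3 \<Rightarrow> real^3 \<Rightarrow> real" where
  "jump_density \<delta> n a x = (plus_value n v x \<bullet> n) * average n a \<phi> x * jump n a w x -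
    \<delta> * \<bar>plus_value n v x \<bullet> n\<bar> * jump n a \<phi> x * jump n a w x"

lemma phi_periodic: "(F, a) \<in> internal_faces M \<Longrightarrow> x \<in> F \<Longrightarrow> \<phi> (x + a) = \<phi> x"
  using phi by (auto simp: internal_faces_def H1_space_def)

text \<open>A \<open>-\<close> trace is the \<open>+\<close> trace at \<open>x + a\<close> for the
  normal \<open>- n\<close>. As \<open>\<phi>\<close> and the normal velocity agree on both sides,
  the two outward fluxes add up to normal velocity times \<open>\<phi>\<close> times the jump of
  \<open>w\<close>; the upwinding term carries the vanishing jump of \<open>\<phi>\<close>.\<close>

lemma two_sided:
  assumes Fa: "(F, a) \<in> internal_faces M" and x: "x \<in> rel_interior F"
  shows "average (nrm M F) a \<phi> x = \<phi> x" "jump (nrm M F) a \<phi> x = 0"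
    and "flux_density (nrm M F) x + flux_density (- nrm M F) (x + a) = jump_density \<delta> (nrm M F) a x"
proof -
  obtain K L where K: "K \<in> cells M" "F facet_of K" "facet_normal K F = nrm M F"
    and L: "L \<in> cells M" "((+) a ` F) facet_of L" "facet_normal L ((+) a ` F) = - nrm M F"
    using internal_face[OF Fa] by metis
  have "rel_interior ((+) a ` F) = (+) a ` rel_interior F" by (rule rel_interior_translation)
  moreover have "a + x \<in> (+) a ` rel_interior F" using x by (rule imageI)
  ultimately have xa: "x + a \<in> rel_interior ((+) a ` F)" by (simp only: add.commute)
  have xF: "x \<in> F" using x rel_interior_subset by auto
  note plus = flux_density_facet[OF K(1,2) x, unfolded K(3)]
  note minus = flux_density_facet[OF L(1,2) xa, unfolded L(3), simplified]
  have per: "\<phi> (x + a) = \<phi> x" by (rule phi_periodic[OF Fa xF])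
  then have per': "\<phi> (a + x) = \<phi> x" by (simp only: add.commute)
  show av: "average (nrm M F) a \<phi> x = \<phi> x" and j: "jump (nrm M F) a \<phi> x = 0"
    by (simp_all add: average_def jump_def plus(1) minus(1) per)
  have "plus_value (nrm M F) v x \<bullet> nrm M F = minus_value (nrm M F) a v x \<bullet> nrm M F"
    using v Fa x by (auto simp: HDiv_space_def)
  then show "flux_density (nrm M F) x + flux_density (- nrm M F) (x + a) = jump_density \<delta> (nrm M F) a x"
    unfolding jump_density_def av j by (simp add: flux_density_def per' jump_def algebra_simps)
qed

text \<open>On a periodic face the two fluxes live on different sets; the second is pulled back by
  the translation before they are added pointwise.\<close>

lemma flux_internal_face:
  assumes Fa: "(F, a) \<in> internal_faces M"
  shows "surface_integral F (flux_density (nrm M F)) + surface_integral ((+) a ` F) (flux_density (- nrm M F)) =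
    surface_integral F (jump_density \<delta> (nrm M F) a)"
proof -
  obtain K L where K: "K \<in> cells M" "F facet_of K" "facet_normal K F = nrm M F"
    and L: "L \<in> cells M" "((+) a ` F) facet_of L" "facet_normal L ((+) a ` F) = - nrm M F"
    using internal_face[OF Fa] by metis
  interpret K: polytope_cell K by (rule cell[OF K(1)])
  note F = K.facet_flat_face[OF K(2)]
  let ?g = "\<lambda>x. flux_on L x \<bullet> (- nrm M F)"
  have g: "continuous_on S ?g" for S
    by (intro continuous_intros continuous_on_polymonial_function polynomial_flux_on L)
  have eq: "flux_density (- nrm M F) x = ?g x" if "x \<in> rel_interior ((+) a ` F)" for x
    using flux_density_facet(4)[OF L(1,2) that] by (simp add: L(3))
  have 1: "surface_integral ((+) a ` F) (flux_density (- nrm M F)) =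
      surface_integral F (\<lambda>x. flux_density (- nrm M F) (x + a))"
    by (rule surface_integral_translate[OF F g eq])
  have i1: "surface_integrable F (flux_density (nrm M F))"
    using flux_facet(1)[OF K(1,2)] by (simp add: K(3))
  have i2: "surface_integrable F (\<lambda>x. flux_density (- nrm M F) (x + a))"
  proof (rule surface_integral_spike(1)[OF F])
    show "surface_integrable F (\<lambda>x. ?g (x + a))"
      by (rule surface_integrable_continuous[OF F], rule continuous_on_compose2[OF g[of UNIV]])
        (intro continuous_intros, rule subset_UNIV)
    fix x assume x: "x \<in> rel_interior F"
    have "rel_interior ((+) a ` F) = (+) a ` rel_interior F" by (rule rel_interior_translation)
    moreover have "a + x \<in> (+) a ` rel_interior F" using x by (rule imageI)
    ultimately have "x + a \<in> rel_interior ((+) a ` F)" by (simp only: add.commute)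
    then show "flux_density (- nrm M F) (x + a) = ?g (x + a)" by (rule eq)
  qed
  have i: "surface_integrable F (\<lambda>x. flux_density (nrm M F) x + flux_density (- nrm M F) (x + a))"
    using i1 i2 unfolding surface_integrable_def by (rule set_integral_add)
  have "surface_integral F (jump_density \<delta> (nrm M F) a) =
      surface_integral F (\<lambda>x. flux_density (nrm M F) x + flux_density (- nrm M F) (x + a))"
    by (rule surface_integral_spike(2)[OF F i two_sided(3)[OF Fa, symmetric]])
  then show ?thesis unfolding 1 using surface_integral_add[OF i1 i2] by simp
qed

text \<open>The interface term is written as in \<open>discontinuous_Galerkin\<close> with test
  function \<open>\<phi>\<close>, so that the scheme cancels it exactly and only the boundary term
  is left.\<close>

theorem transport_identity:
  "(LINT x : domain M | lebesgue. \<phi> x * (v x \<bullet> grad w x)) =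
    boundary_integral M (\<lambda>n x. plus_value n w x * \<phi> x * (plus_value n v x \<bullet> n)) +
    internal_face_integral M (\<lambda>n a x. (plus_value n v x \<bullet> n) * average n a \<phi> x * jump n a w x -
      \<delta> * \<bar>plus_value n v x \<bullet> n\<bar> * jump n a \<phi> x * jump n a w x)"
proof -
  have "(LINT x : domain M | lebesgue. \<phi> x * (v x \<bullet> grad w x)) =
      (\<Sum>F\<in>boundary_faces M. surface_integral F (flux_density (outer_normal M F))) +
      (\<Sum>(F, a)\<in>internal_faces M. surface_integral F (flux_density (nrm M F)) +
        surface_integral ((+) a ` F) (flux_density (- nrm M F)))"
    unfolding transport_cells(2) by (rule sum_faces)
  also have "(\<Sum>(F, a)\<in>internal_faces M. surface_integral F (flux_density (nrm M F)) +
        surface_integral ((+) a ` F) (flux_density (- nrm M F))) =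
      (\<Sum>(F, a)\<in>internal_faces M. surface_integral F (jump_density \<delta> (nrm M F) a))"
    by (intro sum.cong refl) (auto simp: flux_internal_face)
  finally show ?thesis
    by (simp add: boundary_integral_def internal_face_integral_def flux_density_def[abs_def] jump_density_def[abs_def])
qed

text \<open>Reduces the continuous scheme to the same transport identity: its interface term
  contains the jump of \<open>w\<close> as a factor.\<close>

lemma continuous_no_jump:
  assumes w: "w \<in> H1_space M q"
  shows "internal_face_integral M (\<lambda>n a x. (plus_value n v x \<bullet> n) * average n a \<phi> x * jump n a w x -
      \<delta> * \<bar>plus_value n v x \<bullet> n\<bar> * jump n a \<phi> x * jump n a w x) = 0"
  unfolding internal_face_integral_def
proof (rule sum.neutral, safe)
  fix F a assume Fa: "(F, a) \<in> internal_faces M"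
  \<comment> \<open>The roles of \<open>\<phi>\<close> and \<open>w\<close> are exchanged, so that
    \<open>two_sided\<close> speaks about the jump of \<open>w\<close>. The zero velocity fulfils
    the divergence and tangency conditions trivially.\<close>
  interpret W: transport M q p w \<phi> "\<lambda>x. 0"
  proof unfold_locales
    show "\<phi> \<in> L2_space M p" using phi by (simp add: H1_space_def)
    show "(\<lambda>x. 0) \<in> HDiv_space M" by (auto simp: HDiv_space_def side_value_def)
    show "divergence (\<lambda>x. 0) x = 0" for x by (simp add: divergence_def)
  qed (use w in simp_all)
  obtain K where K: "K \<in> cells M" "F facet_of K" using internal_face[OF Fa] by metis
  interpret K: polytope_cell K by (rule cell[OF K(1)])
  note F = K.facet_flat_face[OF K(2)]
  have "surface_integral F (\<lambda>x. (plus_value (nrm M F) v x \<bullet> nrm M F) * average (nrm M F) a \<phi> x * jump (nrm M F) a w x -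
      \<delta> * \<bar>plus_value (nrm M F) v x \<bullet> nrm M F\<bar> * jump (nrm M F) a \<phi> x * jump (nrm M F) a w x) =
      surface_integral F (\<lambda>x. 0)"
    by (rule surface_integral_spike(2)[OF F surface_integrable_continuous[OF F]])
      (auto simp: W.two_sided(2)[OF Fa])
  then show "surface_integral F (\<lambda>x. (plus_value (nrm M F) v x \<bullet> nrm M F) * average (nrm M F) a \<phi> x * jump (nrm M F) a w x -
      \<delta> * \<bar>plus_value (nrm M F) v x \<bullet> nrm M F\<bar> * jump (nrm M F) a \<phi> x * jump (nrm M F) a w x) = 0"
    by (simp add: surface_integral_def)
qed

end

section \<open>Time derivatives\<close>

definition interpolates :: "nat \<Rightarrow> (real^3) set \<Rightarrow> (real^3) set \<Rightarrow> (real^3 \<Rightarrow> real^3 \<Rightarrow> real) \<Rightarrow> bool" where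
  "interpolates q S X L \<longleftrightarrow> finite X \<and> X \<subseteq> S \<and> (\<forall>i\<in>X. L i \<in> poly_degree_le q) \<and>
    (\<forall>f\<in>poly_degree_le q. \<forall>y\<in>S. f y = (\<Sum>i\<in>X. f i * L i y))"

lemma interpolates_exists: "\<exists>X L. interpolates q S X L"
proof -
  have "\<exists>X L. finite X \<and> X \<subseteq> S \<and> (\<forall>x\<in>X. \<exists>a. L x = poly_of q a) \<and>
      (\<forall>c. \<forall>y\<in>S. poly_of q c y = (\<Sum>x\<in>X. poly_of q c x * L x y))"
    unfolding poly_of_def[abs_def] by (rule interpolation_span[OF finite_multi_indices])
  then obtain X L where "finite X" "X \<subseteq> S" "\<forall>x\<in>X. \<exists>a. L x = poly_of q a"
    "\<forall>c. \<forall>y\<in>S. poly_of q c y = (\<Sum>x\<in>X. poly_of q c x * L x y)"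
    by (elim exE conjE)
  then have "interpolates q S X L" by (auto simp: interpolates_def poly_degree_le_eq_range)
  then show ?thesis by blast
qed

lemma interpolates_family:
  obtains X L where "\<And>K. interpolates q (interior K) (X K) (L K)"
proof -
  have "\<forall>K. \<exists>XL. interpolates q (interior K) (fst XL) (snd XL)"
  proof
    fix K :: "(real^3) set"
    obtain X L where "interpolates q (interior K) X L" using interpolates_exists by blast
    then show "\<exists>XL. interpolates q (interior K) (fst XL) (snd XL)" by (intro exI[of _ "(X, L)"]) simp
  qed
  then obtain XL where "\<forall>K. interpolates q (interior K) (fst (XL K)) (snd (XL K))"
    by (rule choice[THEN exE])
  then show thesis using that[of "\<lambda>K. fst (XL K)" "\<lambda>K. snd (XL K)"] by simp
qed

text \<open>The nodes lie in \<open>S\<close>, so the values of \<open>f\<close> itself serve as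
  coefficients. No representing polynomial has to be selected, which matters once \<open>f\<close>
  moves in time.\<close>

lemma interpolates_eq:
  assumes X: "interpolates q S X L" and f: "\<exists>g\<in>poly_degree_le q. \<forall>y\<in>S. f y = g y" and y: "y \<in> S"
  shows "f y = (\<Sum>i\<in>X. f i * L i y)"
proof -
  obtain g where g: "g \<in> poly_degree_le q" "\<And>y. y \<in> S \<Longrightarrow> f y = g y" using f by auto
  have "f y = (\<Sum>i\<in>X. g i * L i y)" using X g y by (simp add: interpolates_def)
  also have "\<dots> = (\<Sum>i\<in>X. f i * L i y)"
    using X g by (intro sum.cong) (auto simp: interpolates_def)
  finally show ?thesis .
qed

lemma time_deriv_has_derivative:
  "(\<lambda>s. f s x) differentiable (at t) \<Longrightarrow> ((\<lambda>s. f s x) has_real_derivative time_deriv f t x) (at t)"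
  unfolding time_deriv_def by (simp add: DERIV_deriv_iff_real_differentiable)

lemma time_deriv_eqI:
  assumes "open T" "t \<in> T" "\<And>s. s \<in> T \<Longrightarrow> f s x = g s" "(g has_real_derivative d) (at t)"
  shows "time_deriv f t x = d"
proof -
  have "((\<lambda>s. f s x) has_real_derivative d) (at t)"
    using assms has_field_derivative_transform_within_open[of g d t T "\<lambda>s. f s x"] by auto
  then show ?thesis unfolding time_deriv_def by (rule DERIV_imp_deriv)
qed

text \<open>The functions \<open>L i\<close> do not move; the expansion is valid for all times in an
  open set, so it may be differentiated as a finite sum of nodal values.\<close>

lemma time_deriv_interpolates:
  assumes T: "open T" "t \<in> T" and X: "interpolates q S X L"
    and f: "\<And>s. s \<in> T \<Longrightarrow> \<exists>g\<in>poly_degree_le q. \<forall>y\<in>S. f s y = g y"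
    and diff: "\<And>x. x \<in> S \<Longrightarrow> (\<lambda>s. f s x) differentiable (at t)" and y: "y \<in> S"
  shows "time_deriv f t y = (\<Sum>i\<in>X. time_deriv f t i * L i y)"
proof (rule time_deriv_eqI[OF T])
  show "f s y = (\<Sum>i\<in>X. f s i * L i y)" if "s \<in> T" for s
    by (rule interpolates_eq[OF X f[OF that] y])
  have "((\<lambda>s. f s i) has_real_derivative time_deriv f t i) (at t)" if "i \<in> X" for i
    using X that by (intro time_deriv_has_derivative diff) (auto simp: interpolates_def)
  then show "((\<lambda>s. \<Sum>i\<in>X. f s i * L i y) has_real_derivative (\<Sum>i\<in>X. time_deriv f t i * L i y)) (at t)"
    by (intro DERIV_sum DERIV_cmult_right)
qed

lemma time_deriv_polynomial:
  assumes T: "open T" "t \<in> T"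
    and f: "\<And>s. s \<in> T \<Longrightarrow> \<exists>g\<in>poly_degree_le q. \<forall>y\<in>S. f s y = g y"
    and diff: "\<And>x. x \<in> S \<Longrightarrow> (\<lambda>s. f s x) differentiable (at t)"
  shows "\<exists>g\<in>poly_degree_le q. \<forall>y\<in>S. time_deriv f t y = g y"
proof -
  obtain X L where X: "interpolates q S X L" using interpolates_exists by blast
  show ?thesis
  proof (rule bexI)
    show "\<forall>y\<in>S. time_deriv f t y = (\<Sum>i\<in>X. time_deriv f t i * L i y)"
      using time_deriv_interpolates[OF T X f diff] by simp
    show "(\<lambda>y. \<Sum>i\<in>X. time_deriv f t i * L i y) \<in> poly_degree_le q"
      using X by (intro poly_degree_le_combination) (auto simp: interpolates_def)
  qed
qed

lemma H1_space_mono: "p \<le> q \<Longrightarrow> H1_space M p \<subseteq> H1_space M q"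
  using poly_degree_le_mono[of p q] by (fastforce simp: H1_space_def L2_space_def)

section \<open>Time derivatives within the finite element spaces\<close>

context mesh
begin

lemma time_deriv_L2:
  assumes T: "open T" "t \<in> T" and f: "\<And>s. s \<in> T \<Longrightarrow> f s \<in> L2_space M q"
    and diff: "\<And>x. x \<in> cell_interiors M \<Longrightarrow> (\<lambda>s. f s x) differentiable (at t)"
  shows "time_deriv f t \<in> L2_space M q"
  unfolding L2_space_def mem_Collect_eq
proof
  fix K assume K: "K \<in> cells M"
  show "\<exists>g\<in>poly_degree_le q. \<forall>x\<in>interior K. time_deriv f t x = g x"
  proof (rule time_deriv_polynomial[OF T])
    show "\<exists>g\<in>poly_degree_le q. \<forall>x\<in>interior K. f s x = g x" if "s \<in> T" for s
      using f[OF that] K by (simp add: L2_space_def)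
    show "(\<lambda>s. f s x) differentiable (at t)" if "x \<in> interior K" for x
      using K that by (intro diff) (auto simp: cell_interiors_def)
  qed
qed

lemma interior_subset_domain: "cell_interiors M \<subseteq> domain M"
  using interior_subset by (auto simp: cell_interiors_def domain_def)

text \<open>This admits the time derivative of the potential as a test function. Pointwise
  differentiability in time says nothing about continuity in space; that comes from interpolation on
  each closed cell, followed by gluing finitely many closed sets. Values at glued points agree
  because they are derivatives of the same function of time.\<close>

lemma time_deriv_H1:
  assumes T: "open T" "t \<in> T" and f: "\<And>s. s \<in> T \<Longrightarrow> f s \<in> H1_space M q"
    and diff: "\<And>x. x \<in> domain M \<Longrightarrow> (\<lambda>s. f s x) differentiable (at t)"
  shows "time_deriv f t \<in> H1_space M q"
proof -
  have "time_deriv f t \<in> L2_space M q"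
    using f diff interior_subset_domain by (intro time_deriv_L2[OF T]) (auto simp: H1_space_def)
  moreover have "continuous_on (domain M) (time_deriv f t)"
    unfolding domain_def
  proof (rule continuous_on_closed_Union[where U = "\<lambda>K. K", simplified])
    show "finite (cells M)" by (rule finite_cells)
    fix K assume K: "K \<in> cells M"
    show "closed K" using polytope_cell.compact[OF cell[OF K]] by (rule compact_imp_closed)
    have "\<exists>g\<in>poly_degree_le q. \<forall>y\<in>K. time_deriv f t y = g y"
    proof (rule time_deriv_polynomial[OF T])
      show "\<exists>g\<in>poly_degree_le q. \<forall>y\<in>K. f s y = g y" if "s \<in> T" for s
        using H1_on_cell[OF f[OF that] K] by metis
      show "(\<lambda>s. f s x) differentiable (at t)" if "x \<in> K" for x
        using diff that K by (auto simp: domain_def)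
    qed
    then obtain g where g: "g \<in> poly_degree_le q" "\<And>y. y \<in> K \<Longrightarrow> time_deriv f t y = g y" by auto
    have "continuous_on K g"
      using poly_degree_le_polynomial[OF g(1)]
      by (auto simp: continuous_on_polymonial_function real_polynomial_function_eq)
    then show "continuous_on K (time_deriv f t)" by (rule continuous_on_eq) (use g(2) in simp)
  qed
  moreover have "time_deriv f t (x + a) = time_deriv f t x" if Fa: "(F, a) \<in> glue M" and x: "x \<in> F" for F a x
  proof (rule time_deriv_eqI[OF T])
    show "f s (x + a) = f s x" if "s \<in> T" for s
      using f[OF that] Fa x by (auto simp: H1_space_def)
    obtain K where "K \<in> cells M" "F facet_of K" using glueD(1)[OF Fa] outer_face by metis
    then have "x \<in> domain M" using x facet_of_imp_subset by (auto simp: domain_def)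
    then show "((\<lambda>s. f s x) has_real_derivative time_deriv f t x) (at t)"
      by (intro time_deriv_has_derivative diff)
  qed
  ultimately show ?thesis by (auto simp: H1_space_def)
qed

text \<open>
  Integrals of local bilinear densities are, cell by cell, bilinear forms in finitely many nodal
  values, so only pointwise differentiability in time is needed.
\<close>

definition local_bilinear ::
    "nat \<Rightarrow> nat \<Rightarrow> ((real^3 \<Rightarrow> real) \<Rightarrow> (real^3 \<Rightarrow> real) \<Rightarrow> real^3 \<Rightarrow> real) \<Rightarrow> bool" where
  "local_bilinear p q \<beta> \<longleftrightarrow>
    (\<forall>U x f f' g g'. open U \<longrightarrow> x \<in> U \<longrightarrow> (\<forall>y\<in>U. f y = f' y) \<longrightarrow> (\<forall>y\<in>U. g y = g' y) \<longrightarrow> \<beta> f g x = \<beta> f' g' x) \<and>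
    (\<forall>X Y L N a b x. finite X \<longrightarrow> finite Y \<longrightarrow> (\<forall>i\<in>X. L i \<in> poly_degree_le p) \<longrightarrow> (\<forall>j\<in>Y. N j \<in> poly_degree_le q) \<longrightarrow>
      \<beta> (\<lambda>x. \<Sum>i\<in>X. a (i :: real^3) * L i x) (\<lambda>x. \<Sum>j\<in>Y. b (j :: real^3) * N j x) x =
      (\<Sum>i\<in>X. \<Sum>j\<in>Y. a i * b j * \<beta> (L i) (N j) x)) \<and>
    (\<forall>K\<in>cells M. \<forall>f\<in>poly_degree_le p. \<forall>g\<in>poly_degree_le q. \<beta> f g absolutely_integrable_on K)"

lemma local_bilinearD:
  assumes "local_bilinear p q \<beta>"
  shows local_bilinear_cong: "\<And>U x f f' g g'. open U \<Longrightarrow> x \<in> U \<Longrightarrow> (\<And>y. y \<in> U \<Longrightarrow> f y = f' y) \<Longrightarrow>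
      (\<And>y. y \<in> U \<Longrightarrow> g y = g' y) \<Longrightarrow> \<beta> f g x = \<beta> f' g' x"
    and local_bilinear_sum: "\<And>X Y L N a b x. finite X \<Longrightarrow> finite Y \<Longrightarrow>
      (\<And>i. i \<in> X \<Longrightarrow> L i \<in> poly_degree_le p) \<Longrightarrow> (\<And>j. j \<in> Y \<Longrightarrow> N j \<in> poly_degree_le q) \<Longrightarrow>
      \<beta> (\<lambda>x. \<Sum>i\<in>X. a (i :: real^3) * L i x) (\<lambda>x. \<Sum>j\<in>Y. b (j :: real^3) * N j x) x =
      (\<Sum>i\<in>X. \<Sum>j\<in>Y. a i * b j * \<beta> (L i) (N j) x)"
    and local_bilinear_cell: "\<And>K f g. K \<in> cells M \<Longrightarrow> f \<in> poly_degree_le p \<Longrightarrow> g \<in> poly_degree_le q \<Longrightarrow>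
      \<beta> f g absolutely_integrable_on K"
proof -
  note * = assms[unfolded local_bilinear_def]
  note 1 = *[THEN conjunct1, rule_format]
  note 2 = *[THEN conjunct2, THEN conjunct1, rule_format]
  note 3 = *[THEN conjunct2, THEN conjunct2, rule_format]
  show "\<beta> f g x = \<beta> f' g' x" if "open U" "x \<in> U" "\<And>y. y \<in> U \<Longrightarrow> f y = f' y" "\<And>y. y \<in> U \<Longrightarrow> g y = g' y"
    for U x f f' g g' using that by (rule 1)
  show "\<beta> (\<lambda>x. \<Sum>i\<in>X. a (i :: real^3) * L i x) (\<lambda>x. \<Sum>j\<in>Y. b (j :: real^3) * N j x) x =
      (\<Sum>i\<in>X. \<Sum>j\<in>Y. a i * b j * \<beta> (L i) (N j) x)"
    if "finite X" "finite Y" "\<And>i. i \<in> X \<Longrightarrow> L i \<in> poly_degree_le p" "\<And>j. j \<in> Y \<Longrightarrow> N j \<in> poly_degree_le q"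
    for X Y L N a b x using that by (rule 2)
  show "\<beta> f g absolutely_integrable_on K"
    if "K \<in> cells M" "f \<in> poly_degree_le p" "g \<in> poly_degree_le q" for K f g using that by (rule 3)
qed

text \<open>The integrals of \<open>\<beta> (L K i) (N K j)\<close> are the entries of element
  matrices. They depend on neither \<open>f\<close> nor \<open>g\<close>, so all time dependence
  will sit in the nodal values.\<close>

lemma local_bilinear_nodal:
  assumes \<beta>: "local_bilinear p q \<beta>"
    and X: "\<And>K. K \<in> cells M \<Longrightarrow> interpolates p (interior K) (X K) (L K)"
    and Y: "\<And>K. K \<in> cells M \<Longrightarrow> interpolates q (interior K) (Y K) (N K)"
    and f: "f \<in> L2_space M p" and g: "g \<in> L2_space M q"
  shows "set_integrable lebesgue (domain M) (\<beta> f g)"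
    and "(LINT x : domain M | lebesgue. \<beta> f g x) =
      (\<Sum>K\<in>cells M. \<Sum>i\<in>X K. \<Sum>j\<in>Y K. f i * g j * integral K (\<beta> (L K i) (N K j)))"
proof -
  let ?h = "\<lambda>K x. \<Sum>i\<in>X K. \<Sum>j\<in>Y K. f i * g j * \<beta> (L K i) (N K j) x"
  have fin: "finite (X K)" "finite (Y K)" if "K \<in> cells M" for K
    using X[OF that] Y[OF that] by (auto simp: interpolates_def)
  have ai: "\<beta> (L K i) (N K j) absolutely_integrable_on K" if "K \<in> cells M" "i \<in> X K" "j \<in> Y K" for K i j
    using X[OF that(1)] Y[OF that(1)] that by (intro local_bilinear_cell[OF \<beta>]) (auto simp: interpolates_def)
  have h: "?h K absolutely_integrable_on K" if K: "K \<in> cells M" for K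
    using fin[OF K] ai[OF K]
    by (intro absolutely_integrable_sum set_integrable_mult_right) auto
  have eq: "\<beta> f g x = ?h K x" if K: "K \<in> cells M" and x: "x \<in> interior K" for K x
  proof -
    have "\<beta> f g x = \<beta> (\<lambda>x. \<Sum>i\<in>X K. f i * L K i x) (\<lambda>x. \<Sum>j\<in>Y K. g j * N K j x) x"
    proof (rule local_bilinear_cong[OF \<beta> open_interior x])
      show "f y = (\<Sum>i\<in>X K. f i * L K i y)" if "y \<in> interior K" for y
        using f K that by (intro interpolates_eq[OF X[OF K]]) (auto simp: L2_space_def)
      show "g y = (\<Sum>i\<in>Y K. g i * N K i y)" if "y \<in> interior K" for y
        using g K that by (intro interpolates_eq[OF Y[OF K]]) (auto simp: L2_space_def)
    qed
    also have "\<dots> = ?h K x"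
      using X[OF K] Y[OF K] by (intro local_bilinear_sum[OF \<beta>]) (auto simp: interpolates_def)
    finally show ?thesis .
  qed
  show "set_integrable lebesgue (domain M) (\<beta> f g)" by (rule integral_domain(1)[OF h eq])
  have "(LINT x : domain M | lebesgue. \<beta> f g x) = (\<Sum>K\<in>cells M. integral K (?h K))"
    by (rule integral_domain(2)[OF h eq])
  also have "\<dots> = (\<Sum>K\<in>cells M. \<Sum>i\<in>X K. \<Sum>j\<in>Y K. f i * g j * integral K (\<beta> (L K i) (N K j)))"
  proof (rule sum.cong)
    fix K assume K: "K \<in> cells M"
    have "(?h K has_integral (\<Sum>i\<in>X K. \<Sum>j\<in>Y K. f i * g j * integral K (\<beta> (L K i) (N K j)))) K"
      using fin[OF K] set_lebesgue_integral_eq_integral(1)[OF ai[OF K]]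
      by (intro has_integral_sum has_integral_mult_right integrable_integral) auto
    then show "integral K (?h K) = (\<Sum>i\<in>X K. \<Sum>j\<in>Y K. f i * g j * integral K (\<beta> (L K i) (N K j)))"
      by (rule integral_unique)
  qed simp
  finally show "(LINT x : domain M | lebesgue. \<beta> f g x) =
      (\<Sum>K\<in>cells M. \<Sum>i\<in>X K. \<Sum>j\<in>Y K. f i * g j * integral K (\<beta> (L K i) (N K j)))" .
qed

lemma local_bilinear_integrable:
  assumes "local_bilinear p q \<beta>" "f \<in> L2_space M p" "g \<in> L2_space M q"
  shows "set_integrable lebesgue (domain M) (\<beta> f g)"
proof -
  obtain X L where X: "\<And>K. interpolates p (interior K) (X K) (L K)" by (rule interpolates_family) (rule that)
  obtain Y N where Y: "\<And>K. interpolates q (interior K) (Y K) (N K)" by (rule interpolates_family) (rule that)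
  show ?thesis by (rule local_bilinear_nodal(1)[OF assms(1) X Y assms(2,3)])
qed

text \<open>In nodal values the integral is a finite sum, for which the product rule suffices. The
  nodal formula, applied to the time derivatives as finite element functions, turns the result back
  into integrals.\<close>

lemma local_bilinear_deriv:
  assumes \<beta>: "local_bilinear p q \<beta>" and T: "open T" "t \<in> T"
    and f: "\<And>s. s \<in> T \<Longrightarrow> f s \<in> L2_space M p" and g: "\<And>s. s \<in> T \<Longrightarrow> g s \<in> L2_space M q"
    and df: "\<And>x. x \<in> cell_interiors M \<Longrightarrow> (\<lambda>s. f s x) differentiable (at t)"
    and dg: "\<And>x. x \<in> cell_interiors M \<Longrightarrow> (\<lambda>s. g s x) differentiable (at t)"
  shows "((\<lambda>s. LINT x : domain M | lebesgue. \<beta> (f s) (g s) x) has_real_derivative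
    (LINT x : domain M | lebesgue. \<beta> (time_deriv f t) (g t) x) +
    (LINT x : domain M | lebesgue. \<beta> (f t) (time_deriv g t) x)) (at t)"
proof -
  obtain X L where X: "\<And>K. interpolates p (interior K) (X K) (L K)" by (rule interpolates_family) (rule that)
  obtain Y N where Y: "\<And>K. interpolates q (interior K) (Y K) (N K)" by (rule interpolates_family) (rule that)
  define m where "m K i j = integral K (\<beta> (L K i) (N K j))" for K i j
  note nodal = local_bilinear_nodal(2)[OF \<beta> X Y, folded m_def]
  have f': "time_deriv f t \<in> L2_space M p" by (rule time_deriv_L2[OF T f df])
  have g': "time_deriv g t \<in> L2_space M q" by (rule time_deriv_L2[OF T g dg])
  have dF: "((\<lambda>s. f s i) has_real_derivative time_deriv f t i) (at t)" if "K \<in> cells M" "i \<in> X K" for K i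
    using X[of K] that by (intro time_deriv_has_derivative df) (auto simp: interpolates_def cell_interiors_def)
  have dG: "((\<lambda>s. g s i) has_real_derivative time_deriv g t i) (at t)" if "K \<in> cells M" "i \<in> Y K" for K i
    using Y[of K] that by (intro time_deriv_has_derivative dg) (auto simp: interpolates_def cell_interiors_def)
  have "((\<lambda>s. \<Sum>K\<in>cells M. \<Sum>i\<in>X K. \<Sum>j\<in>Y K. f s i * g s j * m K i j) has_real_derivative
      (\<Sum>K\<in>cells M. \<Sum>i\<in>X K. \<Sum>j\<in>Y K. (time_deriv f t i * g t j + time_deriv g t j * f t i) * m K i j)) (at t)"
    by (intro DERIV_sum DERIV_cmult_right DERIV_mult dF dG) auto
  also have "(\<Sum>K\<in>cells M. \<Sum>i\<in>X K. \<Sum>j\<in>Y K. (time_deriv f t i * g t j + time_deriv g t j * f t i) * m K i j) =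
      (LINT x : domain M | lebesgue. \<beta> (time_deriv f t) (g t) x) +
      (LINT x : domain M | lebesgue. \<beta> (f t) (time_deriv g t) x)"
    unfolding nodal[OF f' g[OF T(2)]] nodal[OF f[OF T(2)] g']
    by (simp add: sum.distrib[symmetric] algebra_simps)
  finally show ?thesis
  proof (rule has_field_derivative_transform_within_open[OF _ T])
    fix s assume "s \<in> T"
    then show "(\<Sum>K\<in>cells M. \<Sum>i\<in>X K. \<Sum>j\<in>Y K. f s i * g s j * m K i j) =
        (LINT x : domain M | lebesgue. \<beta> (f s) (g s) x)"
      by (simp add: nodal f g)
  qed
qed

lemma local_bilinear_mass: "local_bilinear p q (\<lambda>f g x. f x * g x)"
  unfolding local_bilinear_def
proof (intro conjI allI impI ballI)
  fix X Y :: "(real^3) set" and L N :: "real^3 \<Rightarrow> real^3 \<Rightarrow> real" and a b :: "real^3 \<Rightarrow> real" and x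
  show "(\<Sum>i\<in>X. a i * L i x) * (\<Sum>j\<in>Y. b j * N j x) = (\<Sum>i\<in>X. \<Sum>j\<in>Y. a i * b j * (L i x * N j x))"
    by (simp add: sum_product mult_ac)
next
  fix K f g assume "K \<in> cells M" "f \<in> poly_degree_le p" "g \<in> poly_degree_le q"
  then show "(\<lambda>x. f x * g x) absolutely_integrable_on K"
    by (intro integrable_polynomial_cell real_polynomial_function.intros(4)) (auto dest: poly_degree_le_polynomial)
qed auto

end

lemma perp_sum: "perp B x (\<Sum>i\<in>X. c i *\<^sub>R u i) = (\<Sum>i\<in>X. c i *\<^sub>R perp B x (u i))"
  unfolding perp_def
  by (simp add: inner_sum_right scaleR_diff_right sum_subtractf scaleR_sum_left)

lemma grad_perp_sum:
  assumes "finite X" "\<And>i. i \<in> X \<Longrightarrow> real_polynomial_function (L i)"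
  shows "grad_perp B (\<lambda>x. \<Sum>i\<in>X. c i * L i x) x = (\<Sum>i\<in>X. c i *\<^sub>R grad_perp B (L i) x)"
  unfolding grad_perp_def using grad_sum_scaled[where L = L and c = c, OF assms] by (simp add: perp_sum)

lemma norm_perp_le: "norm (perp B x u) \<le> 2 * norm u"
proof -
  \<comment> \<open>At a zero of \<open>B\<close> the convention \<open>inverse 0 = 0\<close> makes
    \<open>bhat\<close> zero; elsewhere it is a unit vector.\<close>
  have b: "norm (bhat B x) \<le> 1" by (cases "B x = 0") (simp_all add: bhat_def)
  have "norm (perp B x u) \<le> norm u + norm ((bhat B x \<bullet> u) *\<^sub>R bhat B x)"
    unfolding perp_def by (rule norm_triangle_ineq4)
  also have "norm ((bhat B x \<bullet> u) *\<^sub>R bhat B x) \<le> norm (bhat B x) * norm u * norm (bhat B x)"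
    by (simp add: mult_right_mono Cauchy_Schwarz_ineq2)
  also have "\<dots> \<le> 1 * norm u * 1"
    using b by (intro mult_mono) auto
  finally show ?thesis by simp
qed

section \<open>The energy form as a local bilinear density\<close>

context mesh
begin

lemma local_bilinear_energy:
  assumes \<rho>: "\<rho> \<in> borel_measurable borel" and B: "B \<in> borel_measurable borel"
    and bd: "bounded (inertia \<rho> B ` domain M)"
  shows "local_bilinear p q (\<lambda>f g x. inertia \<rho> B x * (grad_perp B f x \<bullet> grad_perp B g x))"
  unfolding local_bilinear_def
proof (intro conjI allI impI ballI)
  fix U and x :: "real^3" and f f' g g' :: "real^3 \<Rightarrow> real"
  assume U: "open U" "x \<in> U" and "\<forall>y\<in>U. f y = f' y" "\<forall>y\<in>U. g y = g' y"
  then have "grad f x = grad f' x" "grad g x = grad g' x"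
    using grad_cong_open[OF U, of f f'] grad_cong_open[OF U, of g g'] by auto
  then show "inertia \<rho> B x * (grad_perp B f x \<bullet> grad_perp B g x) =
      inertia \<rho> B x * (grad_perp B f' x \<bullet> grad_perp B g' x)"
    by (simp add: grad_perp_def)
next
  fix X Y :: "(real^3) set" and L N :: "real^3 \<Rightarrow> real^3 \<Rightarrow> real" and a b :: "real^3 \<Rightarrow> real" and x
  assume X: "finite X" "\<forall>i\<in>X. L i \<in> poly_degree_le p" and Y: "finite Y" "\<forall>j\<in>Y. N j \<in> poly_degree_le q"
  have "grad_perp B (\<lambda>x. \<Sum>i\<in>X. a i * L i x) x = (\<Sum>i\<in>X. a i *\<^sub>R grad_perp B (L i) x)"
    "grad_perp B (\<lambda>x. \<Sum>i\<in>Y. b i * N i x) x = (\<Sum>i\<in>Y. b i *\<^sub>R grad_perp B (N i) x)"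
    using X Y by (auto intro!: grad_perp_sum intro: poly_degree_le_polynomial)
  then show "inertia \<rho> B x * (grad_perp B (\<lambda>x. \<Sum>i\<in>X. a i * L i x) x \<bullet> grad_perp B (\<lambda>x. \<Sum>j\<in>Y. b j * N j x) x) =
      (\<Sum>i\<in>X. \<Sum>j\<in>Y. a i * b j * (inertia \<rho> B x * (grad_perp B (L i) x \<bullet> grad_perp B (N j) x)))"
    by (simp add: inner_sum_left inner_sum_right sum_distrib_left mult_ac) (rule sum.swap)
next
  fix K f g assume K: "K \<in> cells M" and f: "f \<in> poly_degree_le p" and g: "g \<in> poly_degree_le q"
  let ?h = "\<lambda>x. inertia \<rho> B x * (grad_perp B f x \<bullet> grad_perp B g x)"
  have compact: "compact K" using polytope_cell.compact[OF cell[OF K]] .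
  have cont: "continuous_on S (grad f)" "continuous_on S (grad g)" for S
    using f g by (auto intro!: continuous_on_polymonial_function polynomial_grad(1) dest: poly_degree_le_polynomial)
  have [measurable]: "grad f \<in> borel_measurable borel" "grad g \<in> borel_measurable borel"
    using cont by (auto intro: borel_measurable_continuous_onI)
  note [measurable] = \<rho> B
  have "?h \<in> borel_measurable borel"
    unfolding inertia_def grad_perp_def perp_def bhat_def by measurable
  then have meas: "?h \<in> borel_measurable (lebesgue_on K)"
    by (intro measurable_restrict_space1 measurable_completion) simp
  obtain C where C: "\<And>x. x \<in> K \<Longrightarrow> \<bar>inertia \<rho> B x\<bar> \<le> C"
    using bd K unfolding bounded_iff domain_def by fastforce
  obtain Cf where Cf: "\<And>x. x \<in> K \<Longrightarrow> norm (grad f x) \<le> Cf"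
    using compact_imp_bounded[OF compact_continuous_image[OF cont(1) compact]] by (fastforce simp: bounded_iff)
  obtain Cg where Cg: "\<And>x. x \<in> K \<Longrightarrow> norm (grad g x) \<le> Cg"
    using compact_imp_bounded[OF compact_continuous_image[OF cont(2) compact]] by (fastforce simp: bounded_iff)
  show "?h absolutely_integrable_on K"
  proof (rule measurable_bounded_by_integrable_imp_absolutely_integrable[OF meas])
    show "K \<in> sets lebesgue" using compact by (simp add: borel_compact)
    show "(\<lambda>x. C * ((2 * Cf) * (2 * Cg))) integrable_on K"
      using compact by (intro integrable_on_const lmeasurable_compact)
    fix x assume x: "x \<in> K"
    have "\<bar>grad_perp B f x \<bullet> grad_perp B g x\<bar> \<le> norm (grad_perp B f x) * norm (grad_perp B g x)"
      by (rule Cauchy_Schwarz_ineq2)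
    also have "\<dots> \<le> (2 * Cf) * (2 * Cg)"
    proof (rule mult_mono)
      show "norm (grad_perp B f x) \<le> 2 * Cf" "norm (grad_perp B g x) \<le> 2 * Cg"
        unfolding grad_perp_def
        using norm_perp_le[of B x "grad f x"] norm_perp_le[of B x "grad g x"] Cf[OF x] Cg[OF x] by linarith+
      show "0 \<le> 2 * Cf" using order_trans[OF norm_ge_zero Cf[OF x]] by simp
    qed simp
    finally show "norm (?h x) \<le> C * ((2 * Cf) * (2 * Cg))"
      unfolding real_norm_def abs_mult using C[OF x] by (intro mult_mono) auto
  qed
qed

end

section \<open>Conservation of energy\<close>

text \<open>The cross product is orthogonal to both of its factors, and the full gradient differs
  from \<open>grad_perp\<close> only by a multiple of \<open>bhat\<close>.\<close>

lemma velocity_orthogonal_grad: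
  assumes v: "v = cross3 (bhat B x /\<^sub>R norm (B x)) (grad_perp B f x)"
  shows "v \<bullet> grad f x = 0"
proof -
  let ?b = "bhat B x" and ?g = "grad_perp B f x"
  have "grad f x = ?g + (?b \<bullet> grad f x) *\<^sub>R ?b" by (simp add: grad_perp_def perp_def)
  moreover have "v \<bullet> ?g = 0" by (simp add: v dot_cross_self)
  moreover have "v \<bullet> ?b = 0" by (simp add: v cross_mult_left dot_cross_self inner_commute[of _ ?b])
  ultimately show ?thesis by (metis add.right_neutral inner_add_right inner_scaleR_right mult_zero_right)
qed

lemma boundary_integral_zero:
  assumes "\<And>F x. F \<in> boundary_faces M \<Longrightarrow> x \<in> F \<Longrightarrow> g (outer_normal M F) x = 0"
  shows "boundary_integral M g = 0"
  unfolding boundary_integral_def surface_integral_def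
proof (rule sum.neutral, rule ballI)
  fix F assume F: "F \<in> boundary_faces M"
  have "indicator (flat_chart F -` F) y *\<^sub>R g (outer_normal M F) (flat_chart F y) = 0" for y
    using assms[OF F] by (simp add: indicator_def)
  then show "(LINT y : flat_chart F -` F | lebesgue. g (outer_normal M F) (flat_chart F y)) = 0"
    unfolding set_lebesgue_integral_def by (simp only: Bochner_Integration.integral_zero)
qed

text \<open>Every integrand has the potential or its time derivative as a factor. The potential
  vanishes on boundary faces at all times of the open set \<open>T\<close>, hence so does its time
  derivative.\<close>

lemma boundary_conditions_periodic_or_Dirichlet:
  assumes T: "open T" and bc: "periodic_or_Dirichlet M T w \<phi>"
  shows "boundary_conditions M T \<rho> B v w \<phi>"
proof -
  have 0: "\<phi> t x = 0" if "t \<in> T" "F \<in> boundary_faces M" "x \<in> F" for t F x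
    using bc that by (auto simp: periodic_or_Dirichlet_def)
  moreover have "time_deriv \<phi> t x = 0" if t: "t \<in> T" and F: "F \<in> boundary_faces M" "x \<in> F" for t F x
    by (rule time_deriv_eqI[OF T t, where g = "\<lambda>_. 0"]) (use 0 F in auto)
  ultimately show ?thesis
    unfolding boundary_conditions_def by (intro ballI conjI boundary_integral_zero) simp_all
qed

theorem theorem3p5:
  fixes M :: fe_mesh and T :: "real set" and p p' :: nat and \<delta> :: real
    and \<rho> :: "real^3 \<Rightarrow> real" and B :: "real^3 \<Rightarrow> real^3"
    and w \<phi> :: "real \<Rightarrow> real^3 \<Rightarrow> real" and v :: "real \<Rightarrow> real^3 \<Rightarrow> real^3"
  assumes mesh: "is_fe_mesh M"
    and time: "open T"
    and density: "\<rho> \<in> borel_measurable borel" "\<And>x. x \<in> domain M \<Longrightarrow> \<rho> x > 0"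
    and field: "B \<in> borel_measurable borel" "\<And>x. x \<in> domain M \<Longrightarrow> B x \<noteq> 0"
    and coefficient: "bounded (inertia \<rho> B ` domain M)"
    and phi_diff: "\<And>t x. t \<in> T \<Longrightarrow> x \<in> domain M \<Longrightarrow> (\<lambda>s. \<phi> s x) differentiable (at t)"
    and w_diff: "\<And>t x. t \<in> T \<Longrightarrow> x \<in> cell_interiors M \<Longrightarrow> (\<lambda>s. w s x) differentiable (at t)"
    and phi_space: "\<And>t. t \<in> T \<Longrightarrow> \<phi> t \<in> H1_space M p"
    and potential: "\<And>t. t \<in> T \<Longrightarrow> potential_equation M p \<rho> B (w t) (\<phi> t)"
    and v_space: "\<And>t. t \<in> T \<Longrightarrow> v t \<in> HDiv_space M"
    and velocity: "\<And>t x. t \<in> T \<Longrightarrow> x \<in> cell_interiors M \<Longrightarrow>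
          v t x = cross3 (bhat B x /\<^sub>R norm (B x)) (grad_perp B (\<phi> t) x)"
    and upwinding: "0 \<le> \<delta>" "\<delta> \<le> 1 / 2"
    and degrees: "p \<le> p'"
    and vorticity:
      "(\<forall>t\<in>T. w t \<in> H1_space M p' \<and> continuous_Galerkin M p' (v t) (w t) (time_deriv w t)) \<or>
       (\<forall>t\<in>T. w t \<in> L2_space M p' \<and> discontinuous_Galerkin M p' \<delta> (v t) (w t) (time_deriv w t))"
    and div_free: "\<And>t x. t \<in> T \<Longrightarrow> x \<in> cell_interiors M \<Longrightarrow> divergence (v t) x = 0"
  shows "(boundary_conditions M T \<rho> B v w \<phi> \<longrightarrow>
            (\<forall>t\<in>T. ((\<lambda>s. energy M \<rho> B (\<phi> s)) has_real_derivative 0) (at t))) \<and>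
         (periodic_or_Dirichlet M T w \<phi> \<longrightarrow> boundary_conditions M T \<rho> B v w \<phi>)"
proof (intro conjI impI ballI)
  show "boundary_conditions M T \<rho> B v w \<phi>" if "periodic_or_Dirichlet M T w \<phi>"
    using time that by (rule boundary_conditions_periodic_or_Dirichlet)
next
  fix t assume bc: "boundary_conditions M T \<rho> B v w \<phi>" and t: "t \<in> T"
  interpret mesh M by unfold_locales (rule mesh)
  let ?D = "domain M" and ?\<phi>' = "time_deriv \<phi> t" and ?w' = "time_deriv w t"
  let ?a = "\<lambda>f g. LINT x : ?D | lebesgue. inertia \<rho> B x * (grad_perp B f x \<bullet> grad_perp B g x)"
  let ?m = "\<lambda>f g. LINT x : ?D | lebesgue. f x * g x"
  have phi_L2: "\<phi> s \<in> L2_space M p" if "s \<in> T" for s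
    using phi_space[OF that] by (simp add: H1_space_def)
  \<comment> \<open>Here \<open>p \<le> p'\<close> enters: it admits the potential as a test
    function in the vorticity equation.\<close>
  have phi_H1': "\<phi> t \<in> H1_space M p'" using phi_space[OF t] H1_space_mono[OF degrees] by blast
  have w_L2: "w s \<in> L2_space M p'" if "s \<in> T" for s
    using vorticity that by (auto simp: H1_space_def)
  have phi_diff': "(\<lambda>s. \<phi> s x) differentiable (at t)" if "x \<in> cell_interiors M" for x
    using phi_diff[OF t] that interior_subset_domain by blast
  have phi': "?\<phi>' \<in> H1_space M p" by (rule time_deriv_H1[OF time t phi_space phi_diff[OF t]])
  have w': "?w' \<in> L2_space M p'" by (rule time_deriv_L2[OF time t w_L2 w_diff[OF t]])
  have a_deriv: "((\<lambda>s. energy M \<rho> B (\<phi> s)) has_real_derivative (?a ?\<phi>' (\<phi> t) + ?a (\<phi> t) ?\<phi>')) (at t)"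
    unfolding energy_def
    by (rule local_bilinear_deriv[OF local_bilinear_energy[OF density(1) field(1) coefficient] time t
          phi_L2 phi_L2 phi_diff' phi_diff'])
  have m_deriv: "((\<lambda>s. ?m (\<phi> s) (w s)) has_real_derivative (?m ?\<phi>' (w t) + ?m (\<phi> t) ?w')) (at t)"
    by (rule local_bilinear_deriv[OF local_bilinear_mass time t phi_L2 w_L2 phi_diff' w_diff[OF t]])
  have a_sym: "?a (\<phi> t) ?\<phi>' = ?a ?\<phi>' (\<phi> t)" by (simp add: inner_commute)
  have bc1: "boundary_integral M (\<lambda>n x. plus_value n (w s) x * \<phi> s x * (plus_value n (v s) x \<bullet> n)) = 0"
    and bc2: "boundary_integral M (\<lambda>n x. \<phi> s x * inertia \<rho> B x * normal_grad_perp B (\<phi> s) n x) = 0"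
    and bc3: "boundary_integral M (\<lambda>n x. time_deriv \<phi> s x * inertia \<rho> B x * normal_grad_perp B (\<phi> s) n x) = 0"
    if "s \<in> T" for s
    using bc that unfolding boundary_conditions_def by auto
  have energy_m: "energy M \<rho> B (\<phi> s) = ?m (\<phi> s) (w s)" if s: "s \<in> T" for s
    using bspec[OF potential[OF s, unfolded potential_equation_def] phi_space[OF s]] bc2[OF s]
    by (simp add: energy_def)
  have a_m: "?a ?\<phi>' (\<phi> t) = ?m ?\<phi>' (w t)"
    using bspec[OF potential[OF t, unfolded potential_equation_def] phi'] bc3[OF t] by simp
  \<comment> \<open>The identity \<open>energy_m\<close> holds on all of the open set
    \<open>T\<close> and may therefore be differentiated at \<open>t\<close>.\<close>
  have "((\<lambda>s. energy M \<rho> B (\<phi> s)) has_real_derivative (?m ?\<phi>' (w t) + ?m (\<phi> t) ?w')) (at t)"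
    using m_deriv time t by (rule has_field_derivative_transform_within_open) (simp add: energy_m)
  \<comment> \<open>By symmetry the first expression for the derivative is
    \<open>2 * ?a ?\<phi>' (\<phi> t)\<close>. Subtracting \<open>a_m\<close> from the equality of
    both leaves \<open>?a ?\<phi>' (\<phi> t) = ?m (\<phi> t) ?w'\<close>, whence the factor
    2.\<close>
  from DERIV_unique[OF a_deriv this] have eq: "?a ?\<phi>' (\<phi> t) + ?a (\<phi> t) ?\<phi>' = 2 * ?m (\<phi> t) ?w'"
    using a_sym a_m by linarith
  interpret transport M p p' "\<phi> t" "w t" "v t"
  proof unfold_locales
    show "v t x \<bullet> grad (\<phi> t) x = 0" if "x \<in> cell_interiors M" for x
      using velocity[OF t that] by (rule velocity_orthogonal_grad)
  qed (use phi_space[OF t] w_L2[OF t] v_space[OF t] div_free[OF t] in auto)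
  \<comment> \<open>Additivity requires both parts to be integrable: the first as a product of
    finite element functions, the second by \<open>transport_cells(1)\<close>.\<close>
  have split: "(LINT x : ?D | lebesgue. \<phi> t x * (?w' x + v t x \<bullet> grad (w t) x)) =
      ?m (\<phi> t) ?w' + (LINT x : ?D | lebesgue. \<phi> t x * (v t x \<bullet> grad (w t) x))"
    using set_integral_add(2)[OF local_bilinear_integrable[OF local_bilinear_mass phi_L2[OF t] w'] transport_cells(1)]
    by (simp add: distrib_left)
  from vorticity have "?m (\<phi> t) ?w' = 0"
  proof
    assume "\<forall>t\<in>T. w t \<in> H1_space M p' \<and> continuous_Galerkin M p' (v t) (w t) (time_deriv w t)"
    then have w: "w t \<in> H1_space M p'" and "continuous_Galerkin M p' (v t) (w t) ?w'" using t by auto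
    then have "(LINT x : ?D | lebesgue. \<phi> t x * (?w' x + v t x \<bullet> grad (w t) x)) = 0"
      using phi_H1' unfolding continuous_Galerkin_def by blast
    then show ?thesis
      using split transport_identity[of \<delta>] continuous_no_jump[OF w, of \<delta>] bc1[OF t] by linarith
  next
    assume "\<forall>t\<in>T. w t \<in> L2_space M p' \<and> discontinuous_Galerkin M p' \<delta> (v t) (w t) (time_deriv w t)"
    then have dg: "discontinuous_Galerkin M p' \<delta> (v t) (w t) ?w'" using t by auto
    have "\<phi> t \<in> L2_space M p'" using phi_H1' by (simp add: H1_space_def)
    from bspec[OF dg[unfolded discontinuous_Galerkin_def] this] show ?thesis
      using split transport_identity[of \<delta>] bc1[OF t] by linarith
  qed
  with a_deriv eq show "((\<lambda>s. energy M \<rho> B (\<phi> s)) has_real_derivative 0) (at t)" by simp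
qed

end
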